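(* Let a vacuum pp-wave with $\alpha\neq0$ be given and suppose that $d\alpha\wedge d\alpha^*=d\alpha\wedge d\mu=0$ but $d\alpha\wedge d\nu\neq0$. Then it is a $G_2$ solution (its local isometry group has dimension exactly 2) if and only if $$d\alpha\wedge d\nu\wedge d\nu^*=0\quad\text{and}\quad d\alpha\wedge d\nu\wedge d(\Delta\nu)=0.$$
   Context: Setting. Everything is local, on a small connected coordinate domain with coordinates $(\zeta,\zeta^*,u,v)$, $\zeta$ complex, $u,v$ real; $^*$ (or a bar) is complex conjugation. A (non-flat) vacuum pp-wave is a metric $ds^2=2\,d\zeta\,d\bar\zeta-2\,du\,dv-2(f+\bar f)\,du^2$ with $f=f(\zeta,u)$ complex analytic in $\zeta$, smooth in $u$, $f_{\zeta\zeta}\neq0$ everywhere. Conditions "$\ne0$" are meant at every point, conditions "$=0$" identically. Invariants are assumed to have differentials spanning spaces of constant rank. The isometry dimension is that of the Lie algebra of local Killing vector fields. Normalized tetrad and scalars. Let $a=\tfrac14\log f_{\zeta\zeta}$ and $\alpha=e^{a-a^*}(a_\zeta)^*$. If $\alpha\neq0$, write $\zeta=Z(a,u)$, $L=\log Z_a$ (functions of $(a,u)$), and let $\omega^1=(\alpha^* )^{-1}da=e^{a-a^*}(d\zeta-Z_u\,du)$, $\omega^2=(\omega^1)^*$, $\omega^3=e^{a+a^*}du$, $\omega^4=e^{-a-a^*}\big((f+f^*+Z_uZ_u^* )du+dv-Z_u\,d\zeta^*-Z_u^*\,d\zeta\big)$, so the metric is $2\omega^1\omega^2-2\omega^3\omega^4$.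 Its dual frame $(\delta,\delta^*,\Delta,D)$ is the null tetrad normalized by $\Psi_4=1$, $\gamma=0$ (Newman–Penrose notation). On functions of $(a,a^*,u)$: $\delta Q=\alpha^*Q_a$, $\delta^*Q=\alpha Q_{a^*}$, $\Delta Q=e^{-a-a^*}Q_u$ ($a,a^*$ fixed), $DQ=0$. The remaining spin coefficients are $\mu=e^{-a-a^*}L_u$ and $\nu=e^{-a-3a^*}(Z_{uu}+(f_\zeta)^* )$. *)

theory Defs
  imports "HOL-Analysis.Analysis"
begin

text \<open>A point with coordinates \<open>(\<zeta>, \<zeta>*, u, v)\<close> is the triple \<open>(\<zeta>, u, v)\<close>; tangent vectors are written
  with respect to the same coordinates. Complex one-forms are real-linear maps into \<open>complex\<close>.\<close>

type_synonym point = "complex \<times> real \<times> real"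
type_synonym tangent = "complex \<times> real \<times> real"
type_synonym form = "tangent \<Rightarrow> complex"


section \<open>Calculus\<close>

text \<open>Meant for open \<open>S\<close>.\<close>

primrec C_k_on :: "nat \<Rightarrow> 'a::euclidean_space set \<Rightarrow> ('a \<Rightarrow> 'b::real_normed_vector) \<Rightarrow> bool" where
  "C_k_on 0 S F \<longleftrightarrow> continuous_on S F"
| "C_k_on (Suc k) S F \<longleftrightarrow> (\<forall>x\<in>S. F differentiable (at x)) \<and>
     (\<forall>v. C_k_on k S (\<lambda>x. frechet_derivative F (at x) v))"

definition smooth_on :: "'a::euclidean_space set \<Rightarrow> ('a \<Rightarrow> 'b::real_normed_vector) \<Rightarrow> bool" where
  "smooth_on S F \<longleftrightarrow> (\<forall>k. C_k_on k S F)"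

text \<open>Partial derivatives of functions of one complex and one real variable, complex analytic in
  the first: \<open>d1 f\<close> is \<open>f\<^sub>\<zeta>\<close>, \<open>d2 f\<close> is \<open>f\<^sub>u\<close>; \<open>d1 Z\<close> is \<open>Z\<^sub>a\<close>, \<open>d2 Z\<close> is \<open>Z\<^sub>u\<close>.\<close>

definition d1 :: "(complex \<Rightarrow> real \<Rightarrow> complex) \<Rightarrow> complex \<Rightarrow> real \<Rightarrow> complex" where
  "d1 F z u = deriv (\<lambda>w. F w u) z"

definition d2 :: "(complex \<Rightarrow> real \<Rightarrow> complex) \<Rightarrow> complex \<Rightarrow> real \<Rightarrow> complex" where
  "d2 F z u = vector_derivative (\<lambda>s. F z s) (at u)"

abbreviation ext_d :: "(point \<Rightarrow> complex) \<Rightarrow> point \<Rightarrow> form" where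
  "ext_d Q p \<equiv> frechet_derivative Q (at p)"

definition wedge2 :: "form \<Rightarrow> form \<Rightarrow> tangent \<Rightarrow> tangent \<Rightarrow> complex" where
  "wedge2 \<phi> \<psi> X Y = \<phi> X * \<psi> Y - \<phi> Y * \<psi> X"

definition wedge3 :: "form \<Rightarrow> form \<Rightarrow> form \<Rightarrow> tangent \<Rightarrow> tangent \<Rightarrow> tangent \<Rightarrow> complex" where
  "wedge3 \<phi> \<psi> \<theta> X Y W = \<phi> X * wedge2 \<psi> \<theta> Y W - \<phi> Y * wedge2 \<psi> \<theta> X W + \<phi> W * wedge2 \<psi> \<theta> X Y"


section \<open>Killing vector fields\<close>

text \<open>The coordinate formula for \<open>(L\<^sub>X g)(Y, W)\<close> with \<open>Y\<close>, \<open>W\<close> constant in the coordinates.\<close>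

definition lie_derivative ::
  "(point \<Rightarrow> tangent) \<Rightarrow> (point \<Rightarrow> tangent \<Rightarrow> tangent \<Rightarrow> real) \<Rightarrow> point \<Rightarrow> tangent \<Rightarrow> tangent \<Rightarrow> real" where
  "lie_derivative X g p Y W =
     frechet_derivative (\<lambda>q. g q Y W) (at p) (X p)
     + g p (frechet_derivative X (at p) Y) W
     + g p Y (frechet_derivative X (at p) W)"

definition killing_near ::
  "(point \<Rightarrow> tangent \<Rightarrow> tangent \<Rightarrow> real) \<Rightarrow> point \<Rightarrow> (point \<Rightarrow> tangent) \<Rightarrow> bool" where
  "killing_near g p X \<longleftrightarrow>
     (\<exists>V. open V \<and> p \<in> V \<and> smooth_on V X \<and> (\<forall>q\<in>V. \<forall>Y W. lie_derivative X g q Y W = 0))"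

text \<open>The germs at \<open>p\<close> of Killing fields form a real vector space with a basis of \<open>n\<close> elements;
  germs are equal iff representatives agree in a neighbourhood of \<open>p\<close>.\<close>

definition killing_germs_dim ::
  "(point \<Rightarrow> tangent \<Rightarrow> tangent \<Rightarrow> real) \<Rightarrow> point \<Rightarrow> nat \<Rightarrow> bool" where
  "killing_germs_dim g p n \<longleftrightarrow>
     (\<exists>B :: nat \<Rightarrow> point \<Rightarrow> tangent.
        (\<forall>i<n. killing_near g p (B i)) \<and>
        (\<forall>c :: nat \<Rightarrow> real. (\<forall>\<^sub>F q in nhds p. (\<Sum>i<n. c i *\<^sub>R B i q) = 0) \<longrightarrow> (\<forall>i<n. c i = 0)) \<and>
        (\<forall>X. killing_near g p X \<longrightarrow>
           (\<exists>c :: nat \<Rightarrow> real. \<forall>\<^sub>F q in nhds p. X q = (\<Sum>i<n. c i *\<^sub>R B i q))))"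

definition isometry_dim ::
  "point set \<Rightarrow> (point \<Rightarrow> tangent \<Rightarrow> tangent \<Rightarrow> real) \<Rightarrow> nat \<Rightarrow> bool" where
  "isometry_dim U g n \<longleftrightarrow> (\<forall>p\<in>U. killing_germs_dim g p n)"


section \<open>Vacuum pp-waves\<close>

text \<open>The polarization of \<open>2 d\<zeta> d\<zeta>* - 2 du dv - 2 (f + f*) du\<^sup>2\<close>.\<close>

definition pp_metric ::
  "(complex \<Rightarrow> real \<Rightarrow> complex) \<Rightarrow> point \<Rightarrow> tangent \<Rightarrow> tangent \<Rightarrow> real" where
  "pp_metric f = (\<lambda>(z, u, v) (x, xu, xv) (y, yu, yv).
     2 * Re (x * cnj y) - (xu * yv + xv * yu) - 4 * Re (f z u) * xu * yu)"

definition base :: "point set \<Rightarrow> (complex \<times> real) set" where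
  "base U = (\<lambda>(z, u, v). (z, u)) ` U"

definition vacuum_pp_wave :: "point set \<Rightarrow> (complex \<Rightarrow> real \<Rightarrow> complex) \<Rightarrow> bool" where
  "vacuum_pp_wave U f \<longleftrightarrow>
     open U \<and> connected U \<and> U \<noteq> {} \<and>
     smooth_on (base U) (\<lambda>(z, u). f z u) \<and>
     (\<forall>u. (\<lambda>z. f z u) holomorphic_on {z. (z, u) \<in> base U}) \<and>
     (\<forall>(z, u) \<in> base U. d1 (d1 f) z u \<noteq> 0)"

definition alpha :: "(complex \<Rightarrow> real \<Rightarrow> complex) \<Rightarrow> point \<Rightarrow> complex" where
  "alpha a = (\<lambda>(z, u, v). exp (a z u - cnj (a z u)) * cnj (d1 a z u))"

text \<open>A branch \<open>a\<close> of \<open>1/4 log f\<^sub>\<zeta>\<^sub>\<zeta>\<close>.\<close>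

definition log_potential ::
  "point set \<Rightarrow> (complex \<Rightarrow> real \<Rightarrow> complex) \<Rightarrow> (complex \<Rightarrow> real \<Rightarrow> complex) \<Rightarrow> bool" where
  "log_potential U f a \<longleftrightarrow>
     smooth_on (base U) (\<lambda>(z, u). a z u) \<and>
     (\<forall>(z, u) \<in> base U. exp (4 * a z u) = d1 (d1 f) z u)"

definition a_domain :: "point set \<Rightarrow> (complex \<Rightarrow> real \<Rightarrow> complex) \<Rightarrow> (complex \<times> real) set" where
  "a_domain U a = (\<lambda>(z, u). (a z u, u)) ` base U"

text \<open>\<open>\<zeta> = Z(a, u)\<close> and \<open>L\<close> is a branch of \<open>log Z\<^sub>a\<close>. If \<open>\<alpha> \<noteq> 0\<close>, such \<open>Z\<close> and \<open>L\<close> exist after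
  shrinking the domain; \<open>Z\<close> is determined on \<open>a_domain U a\<close>, and \<open>L\<close> up to a constant in \<open>2 \<pi> i \<int>\<close>.\<close>

definition inverse_coordinate ::
  "point set \<Rightarrow> (complex \<Rightarrow> real \<Rightarrow> complex) \<Rightarrow> (complex \<Rightarrow> real \<Rightarrow> complex) \<Rightarrow>
   (complex \<Rightarrow> real \<Rightarrow> complex) \<Rightarrow> bool" where
  "inverse_coordinate U a Z L \<longleftrightarrow>
     smooth_on (a_domain U a) (\<lambda>(A, u). Z A u) \<and>
     (\<forall>(z, u) \<in> base U. Z (a z u) u = z) \<and>
     smooth_on (a_domain U a) (\<lambda>(A, u). L A u) \<and>
     (\<forall>(A, u) \<in> a_domain U a. exp (L A u) = d1 Z A u)"

definition mu ::
  "(complex \<Rightarrow> real \<Rightarrow> complex) \<Rightarrow> (complex \<Rightarrow> real \<Rightarrow> complex) \<Rightarrow> point \<Rightarrow> complex" where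
  "mu a L = (\<lambda>(z, u, v). exp (- a z u - cnj (a z u)) * d2 L (a z u) u)"

definition nu ::
  "(complex \<Rightarrow> real \<Rightarrow> complex) \<Rightarrow> (complex \<Rightarrow> real \<Rightarrow> complex) \<Rightarrow> (complex \<Rightarrow> real \<Rightarrow> complex) \<Rightarrow>
   point \<Rightarrow> complex" where
  "nu f a Z = (\<lambda>(z, u, v).
     exp (- a z u - 3 * cnj (a z u)) * (d2 (d2 Z) (a z u) u + cnj (d1 f z u)))"


section \<open>The normalized tetrad\<close>

definition omega1 ::
  "(complex \<Rightarrow> real \<Rightarrow> complex) \<Rightarrow> (complex \<Rightarrow> real \<Rightarrow> complex) \<Rightarrow> point \<Rightarrow> form" where
  "omega1 a Z = (\<lambda>(z, u, v) (x, xu, xv).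
     exp (a z u - cnj (a z u)) * (x - d2 Z (a z u) u * of_real xu))"

definition omega2 ::
  "(complex \<Rightarrow> real \<Rightarrow> complex) \<Rightarrow> (complex \<Rightarrow> real \<Rightarrow> complex) \<Rightarrow> point \<Rightarrow> form" where
  "omega2 a Z p X = cnj (omega1 a Z p X)"

definition omega3 :: "(complex \<Rightarrow> real \<Rightarrow> complex) \<Rightarrow> point \<Rightarrow> form" where
  "omega3 a = (\<lambda>(z, u, v) (x, xu, xv). exp (a z u + cnj (a z u)) * of_real xu)"

definition omega4 ::
  "(complex \<Rightarrow> real \<Rightarrow> complex) \<Rightarrow> (complex \<Rightarrow> real \<Rightarrow> complex) \<Rightarrow> (complex \<Rightarrow> real \<Rightarrow> complex) \<Rightarrow>
   point \<Rightarrow> form" where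
  "omega4 f a Z = (\<lambda>(z, u, v) (x, xu, xv).
     let Zu = d2 Z (a z u) u in
     exp (- a z u - cnj (a z u)) *
       ((f z u + cnj (f z u) + Zu * cnj Zu) * of_real xu + of_real xv - Zu * cnj x - cnj Zu * x))"

lemma pp_metric_coframe:
  "complex_of_real (pp_metric f p X X) =
     2 * omega1 a Z p X * omega2 a Z p X - 2 * omega3 a p X * omega4 f a Z p X"
proof -
  obtain z u v where p: "p = (z, u, v)" by (cases p) auto
  obtain x xu xv where X: "X = (x, xu, xv)" by (cases X) auto
  define A where "A = a z u"
  define W where "W = d2 Z A u"
  have e1: "exp (A - cnj A) * exp (cnj A - A) = 1"
    by (simp flip: exp_add)
  have e2: "exp (A + cnj A) * exp (- A - cnj A) = 1"
    by (simp flip: exp_add)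
  have "2 * omega1 a Z p X * omega2 a Z p X - 2 * omega3 a p X * omega4 f a Z p X
    = 2 * (exp (A - cnj A) * exp (cnj A - A)) * ((x - W * of_real xu) * cnj (x - W * of_real xu))
      - 2 * (exp (A + cnj A) * exp (- A - cnj A)) * (of_real xu *
       ((f z u + cnj (f z u) + W * cnj W) * of_real xu + of_real xv - W * cnj x - cnj W * x))"
    by (simp add: p X omega1_def omega2_def omega3_def omega4_def Let_def exp_cnj
        flip: A_def W_def)
  also have "\<dots> = 2 * ((x - W * of_real xu) * cnj (x - W * of_real xu))
      - 2 * (of_real xu *
       ((f z u + cnj (f z u) + W * cnj W) * of_real xu + of_real xv - W * cnj x - cnj W * x))"
    by (simp only: e1 e2 mult_1_right)
  also have "\<dots> = complex_of_real (pp_metric f p X X)"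
    by (simp add: p X pp_metric_def complex_eq_iff algebra_simps)
  finally show ?thesis by simp
qed

text \<open>The derivatives \<open>(\<delta>Q, \<delta>*Q, \<Delta>Q, DQ)\<close> along the frame dual to \<open>\<omega>\<^sup>1, \<dots>, \<omega>\<^sup>4\<close> are the
  coefficients of \<open>dQ\<close> in the coframe.\<close>

definition frame_derivs ::
  "(complex \<Rightarrow> real \<Rightarrow> complex) \<Rightarrow> (complex \<Rightarrow> real \<Rightarrow> complex) \<Rightarrow> (complex \<Rightarrow> real \<Rightarrow> complex) \<Rightarrow>
   (point \<Rightarrow> complex) \<Rightarrow> point \<Rightarrow> complex \<times> complex \<times> complex \<times> complex" where
  "frame_derivs f a Z Q p = (THE (q1, q2, q3, q4). \<forall>X.
     ext_d Q p X = q1 * omega1 a Z p X + q2 * omega2 a Z p X + q3 * omega3 a p X + q4 * omega4 f a Z p X)"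

definition np_delta where "np_delta f a Z Q p = fst (frame_derivs f a Z Q p)"
definition np_delta_bar where "np_delta_bar f a Z Q p = fst (snd (frame_derivs f a Z Q p))"
definition np_Delta where "np_Delta f a Z Q p = fst (snd (snd (frame_derivs f a Z Q p)))"
definition np_D where "np_D f a Z Q p = snd (snd (snd (frame_derivs f a Z Q p)))"

lemma coframe_expansion:
  fixes f a Z z u v and \<phi> :: form
  defines "p \<equiv> (z, u, v)" and "A \<equiv> a z u" and "W \<equiv> d2 Z (a z u) u"
  defines "P \<equiv> \<lambda>(q1, q2, q3, q4). \<forall>X. \<phi> X =
     q1 * omega1 a Z p X + q2 * omega2 a Z p X + q3 * omega3 a p X + q4 * omega4 f a Z p X"
  assumes "linear \<phi>"
  shows "\<exists>!q. P q"
    and "P (q1, q2, q3, q4) \<Longrightarrow>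
      q3 = exp (- A - cnj A) * \<phi> (W, 1, Re (W * cnj W) - 2 * Re (f z u))"
proof -
  define e where "e = exp (A - cnj A)"
  define e' where "e' = exp (cnj A - A)"
  define h where "h = exp (A + cnj A)"
  define h' where "h' = exp (- A - cnj A)"
  have e: "e * e' = 1" "e' * e = 1" and h: "h * h' = 1" "h' * h = 1"
    by (simp_all add: e_def e'_def h_def h'_def flip: exp_add)
  have nz: "e \<noteq> 0" "e' \<noteq> 0" "h \<noteq> 0" "h' \<noteq> 0"
    using e h by auto
  define E where "E x = (x, 0 :: real, 2 * Re (W * cnj x))" for x
  define V where "V = (W, 1 :: real, Re (W * cnj W) - 2 * Re (f z u))"
  define N where "N = (0 :: complex, 0 :: real, 1 :: real)"
  have o1: "omega1 a Z p (x, xu, xv) = e * (x - W * of_real xu)" for x xu xv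
    by (simp add: omega1_def p_def e_def A_def W_def)
  have o2: "omega2 a Z p (x, xu, xv) = e' * cnj (x - W * of_real xu)" for x xu xv
    by (simp add: omega2_def o1 e_def e'_def exp_cnj)
  have o3: "omega3 a p (x, xu, xv) = h * of_real xu" for x xu xv
    by (simp add: omega3_def p_def h_def A_def)
  have o4: "omega4 f a Z p (x, xu, xv) =
      h' * of_real (xv - 2 * Re (W * cnj (x - W * of_real xu)) -
        xu * (Re (W * cnj W) - 2 * Re (f z u)))" for x xu xv
    by (simp add: omega4_def p_def h'_def A_def W_def Let_def complex_eq_iff algebra_simps)
  have val: "P (q1, q2, q3, q4) \<Longrightarrow>
      \<phi> (E 1) = q1 * e + q2 * e' \<and> \<phi> (E \<i>) = \<i> * (q1 * e - q2 * e') \<and>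
      \<phi> V = q3 * h \<and> \<phi> N = q4 * h'" for q1 q2 q3 q4
  proof -
    assume "P (q1, q2, q3, q4)"
    then have *: "\<phi> X = q1 * omega1 a Z p X + q2 * omega2 a Z p X + q3 * omega3 a p X
        + q4 * omega4 f a Z p X" for X
      by (cases X) (simp add: P_def)
    have "\<phi> (E x) = q1 * (e * x) + q2 * (e' * cnj x)" for x
      unfolding * E_def by (simp add: o1 o2 o3 o4)
    moreover have "\<phi> V = q3 * h" "\<phi> N = q4 * h'"
      unfolding * V_def N_def by (simp_all add: o1 o2 o3 o4)
    ultimately show ?thesis
      by (simp add: algebra_simps)
  qed
  have dec: "(x, xu, xv) = Re (x - W * of_real xu) *\<^sub>R E 1 + Im (x - W * of_real xu) *\<^sub>R E \<i>
      + xu *\<^sub>R V + (xv - 2 * Re (W * cnj (x - W * of_real xu)) -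
        xu * (Re (W * cnj W) - 2 * Re (f z u))) *\<^sub>R N" for x xu xv
    by (simp add: E_def V_def N_def complex_eq_iff algebra_simps)
  have P1: "P (e' * (\<phi> (E 1) - \<i> * \<phi> (E \<i>)) / 2, e * (\<phi> (E 1) + \<i> * \<phi> (E \<i>)) / 2,
      h' * \<phi> V, h * \<phi> N)"
  proof -
    have "\<phi> (x, xu, xv) = e' * (\<phi> (E 1) - \<i> * \<phi> (E \<i>)) / 2 * omega1 a Z p (x, xu, xv)
      + e * (\<phi> (E 1) + \<i> * \<phi> (E \<i>)) / 2 * omega2 a Z p (x, xu, xv)
      + h' * \<phi> V * omega3 a p (x, xu, xv) + h * \<phi> N * omega4 f a Z p (x, xu, xv)" (is "_ = ?R")
      for x xu xv
    proof -
      define s where "s = x - W * of_real xu"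
      define t where "t = xv - 2 * Re (W * cnj s) - xu * (Re (W * cnj W) - 2 * Re (f z u))"
      have "?R = (e' * e) * (\<phi> (E 1) - \<i> * \<phi> (E \<i>)) / 2 * s
        + (e * e') * (\<phi> (E 1) + \<i> * \<phi> (E \<i>)) / 2 * cnj s
        + (h' * h) * \<phi> V * of_real xu + (h * h') * \<phi> N * of_real t"
        by (simp only: o1 o2 o3 o4 flip: s_def t_def) (simp add: ac_simps)
      also have "\<dots> = of_real (Re s) * \<phi> (E 1) + of_real (Im s) * \<phi> (E \<i>)
          + of_real xu * \<phi> V + of_real t * \<phi> N"
        unfolding e h by (simp add: complex_eq_iff algebra_simps) (simp add: field_simps)
      also have "\<dots> = \<phi> (Re s *\<^sub>R E 1 + Im s *\<^sub>R E \<i> + xu *\<^sub>R V + t *\<^sub>R N)"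
        using \<open>linear \<phi>\<close> by (simp add: linear_add linear_scale scaleR_conv_of_real)
      also have "\<dots> = \<phi> (x, xu, xv)"
        by (subst dec) (simp only: s_def t_def)
      finally show ?thesis by simp
    qed
    then show ?thesis unfolding P_def by auto
  qed
  show "\<exists>!q. P q"
  proof (rule ex1I[of P, OF P1])
    fix q assume "P q"
    obtain q1 q2 q3 q4 where q: "q = (q1, q2, q3, q4)" by (cases q) auto
    have v: "\<phi> (E 1) = q1 * e + q2 * e'" "\<phi> (E \<i>) = \<i> * (q1 * e - q2 * e')"
        "\<phi> V = q3 * h" "\<phi> N = q4 * h'"
      using val[OF \<open>P q\<close>[unfolded q]] by auto
    have "e' * (\<phi> (E 1) - \<i> * \<phi> (E \<i>)) / 2 = (e * e') * q1"
      "e * (\<phi> (E 1) + \<i> * \<phi> (E \<i>)) / 2 = (e * e') * q2"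
      "h' * \<phi> V = (h * h') * q3" "h * \<phi> N = (h * h') * q4"
      unfolding v by (simp_all add: algebra_simps)
    then show "q = (e' * (\<phi> (E 1) - \<i> * \<phi> (E \<i>)) / 2, e * (\<phi> (E 1) + \<i> * \<phi> (E \<i>)) / 2,
      h' * \<phi> V, h * \<phi> N)"
      by (simp only: q e h mult_1_left)
  qed
  show "q3 = exp (- A - cnj A) * \<phi> (W, 1, Re (W * cnj W) - 2 * Re (f z u))"
    if "P (q1, q2, q3, q4)"
  proof -
    have "q3 = (h * h') * q3" by (simp add: h)
    also have "\<dots> = h' * \<phi> V" using val[OF that] by simp
    finally show ?thesis unfolding h'_def V_def .
  qed
qed

text \<open>In the coordinates \<open>(a, a*, u, v)\<close> this is \<open>e\<^bsup>-a-a*\<^esup> \<partial>\<^sub>u\<close> up to a multiple of \<open>\<partial>\<^sub>v\<close>.\<close>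

lemma np_Delta_explicit:
  fixes f a Z Q z u v
  defines "p \<equiv> (z, u, v)" and "A \<equiv> a z u" and "W \<equiv> d2 Z (a z u) u"
  assumes "Q differentiable (at p)"
  shows "np_Delta f a Z Q p =
    exp (- A - cnj A) * ext_d Q p (W, 1, Re (W * cnj W) - 2 * Re (f z u))"
proof -
  have lin: "linear (ext_d Q p)"
    using assms(4) by (rule linear_frechet_derivative)
  define q where "q = frame_derivs f a Z Q p"
  have "(\<lambda>(q1, q2, q3, q4). \<forall>X. ext_d Q p X = q1 * omega1 a Z p X + q2 * omega2 a Z p X
      + q3 * omega3 a p X + q4 * omega4 f a Z p X) q"
    unfolding q_def frame_derivs_def p_def
    by (rule theI') (rule coframe_expansion(1)[OF lin[unfolded p_def]])
  then have "fst (snd (snd q)) =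
      exp (- A - cnj A) * ext_d Q p (W, 1, Re (W * cnj W) - 2 * Re (f z u))"
    unfolding p_def A_def W_def
    by (cases q) (use coframe_expansion(2)[OF lin[unfolded p_def]] in auto)
  then show ?thesis by (simp add: np_Delta_def q_def)
qed


section \<open>Invariants\<close>

text \<open>The spin coefficients, their complex conjugates and iterated frame derivatives.\<close>

inductive_set invariants ::
  "(complex \<Rightarrow> real \<Rightarrow> complex) \<Rightarrow> (complex \<Rightarrow> real \<Rightarrow> complex) \<Rightarrow> (complex \<Rightarrow> real \<Rightarrow> complex) \<Rightarrow>
   (complex \<Rightarrow> real \<Rightarrow> complex) \<Rightarrow> (point \<Rightarrow> complex) set"
  for f a Z L where
  "alpha a \<in> invariants f a Z L"
| "mu a L \<in> invariants f a Z L"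
| "nu f a Z \<in> invariants f a Z L"
| "Q \<in> invariants f a Z L \<Longrightarrow> (\<lambda>p. cnj (Q p)) \<in> invariants f a Z L"
| "Q \<in> invariants f a Z L \<Longrightarrow> np_delta f a Z Q \<in> invariants f a Z L"
| "Q \<in> invariants f a Z L \<Longrightarrow> np_delta_bar f a Z Q \<in> invariants f a Z L"
| "Q \<in> invariants f a Z L \<Longrightarrow> np_Delta f a Z Q \<in> invariants f a Z L"
| "Q \<in> invariants f a Z L \<Longrightarrow> np_D f a Z Q \<in> invariants f a Z L"

text \<open>Real and imaginary parts are used to get real one-forms; since the invariants are closed under
  conjugation, this real rank is the complex rank of the span of all \<open>dQ\<close>.\<close>

definition invariant_rank ::
  "(complex \<Rightarrow> real \<Rightarrow> complex) \<Rightarrow> (complex \<Rightarrow> real \<Rightarrow> complex) \<Rightarrow> (complex \<Rightarrow> real \<Rightarrow> complex) \<Rightarrow>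
   (complex \<Rightarrow> real \<Rightarrow> complex) \<Rightarrow> point \<Rightarrow> nat" where
  "invariant_rank f a Z L p = dim (\<Union>Q\<in>invariants f a Z L.
     {Blinfun (\<lambda>X. Re (ext_d Q p X)), Blinfun (\<lambda>X. Im (ext_d Q p X))})"

end

theory Submission
  imports Defs
begin

text \<open>
  Write \<open>e = 1 / a\<^sub>\<zeta> = Z\<^sub>a\<close>, \<open>w = - a\<^sub>u / a\<^sub>\<zeta> = Z\<^sub>u\<close>, \<open>M = w\<^sub>\<zeta> = L\<^sub>u\<close> and \<open>C = 1 + e\<^sub>\<zeta> = 1 + L\<^sub>a\<close>. Then
  \<open>d log \<alpha> = \<beta> := da - C* da* - M* du\<close>, and the hypotheses on \<open>\<alpha>\<close> and \<open>\<mu>\<close> say that \<open>C\<close> is locally constant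
  of modulus one and that \<open>M\<close> is a real function of \<open>u\<close> with \<open>C M = - M\<close> and \<open>M' = M\<^sup>2\<close>. Consequently
  \<open>\<nu> = e\<^bsup>-a-3a*\<^esup> g + F\<close> with \<open>g\<close> a function of \<open>u\<close> alone and \<open>dF\<close> a multiple of \<open>d\<alpha>\<close>, so that both
  wedge conditions become vanishing \<open>3 \<times> 3\<close> determinants in \<open>C, M, g, g', g''\<close>.

  The Killing equations integrate, modulo \<open>\<partial>\<^sub>v\<close>, to fields whose projection to \<open>(a, u)\<close>-space is
  \<open>k \<partial>\<^sub>a + k* \<partial>\<^sub>a\<^sub>* + s \<partial>\<^sub>u\<close> with \<open>s' = \<sigma>\<close> and \<open>k = - (\<sigma> + i\<theta>) / 2\<close> constant, subject to \<open>\<beta> = 0\<close> on the field and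
  \<open>s g' + (2\<sigma> - i\<theta>) g = 0\<close>. Such a field with \<open>s \<noteq> 0\<close> lies in the kernel of both determinants; if \<open>s = 0\<close>
  at a point it is a constant multiple of \<open>\<partial>\<^sub>v\<close>. Conversely, the determinant conditions give
  \<open>p' = p Re p / 2\<close> for \<open>p = g' / g\<close>, and \<open>s = exp (- \<integral> Re p / 2)\<close> solves the remaining equations.
\<close>

section \<open>Smooth functions and symmetry of second derivatives\<close>

text \<open>The constants come from scaling. A Killing field X acts on u at a constant rate \<sigma>
  and rotates \<zeta> at a constant rate \<theta>. The twice \<zeta>-differentiated equation reads X
  F = - 2 (\<sigma> + i \<theta>) F for F = f_\<zeta>\<zeta> = exp (4 a), which gives X a = k. The
  weights 2 \<sigma> - i \<theta> and 3 \<sigma> - i \<theta> of g and g' are - k - 3 cnj k and - 2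
  k - 4 cnj k, read off from the prefactors exp (- a - 3 cnj a) of \<nu> and exp (- 2 a - 4 cnj a)
  of \<Delta>\<nu>. The common kernel vector of the determinants is (k, cnj k, s).

  The obstacle in the converse is that a kernel vector at each point need not come from a field: its
  first two entries must be conjugate, k must be constant and s must have derivative \<sigma>. The
  law for p makes p s constant, and this one complex constant yields both \<sigma> and \<theta>; the
  condition with cnj \<nu> then becomes \<beta> = 0. Dividing by g is legitimate because |C| = 1
  excludes C = - 2, and the function g exists because it excludes C = - 3.

  The Killing equations are integrated by computing mixed second derivatives in two orders;
  f_\<zeta>\<zeta> being nonzero then forces s to depend on u alone.\<close>

lemma C_k_on_cong:
  assumes "open S" "\<And>x. x \<in> S \<Longrightarrow> F x = G x" "C_k_on k S F"
  shows "C_k_on k S G"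
  using assms(2,3)
proof (induction k arbitrary: F G)
  case 0
  then show ?case using continuous_on_cong by (metis C_k_on.simps(1))
next
  case (Suc k)
  have *: "(G has_derivative frechet_derivative F (at x)) (at x)" if "x \<in> S" for x
    by (rule has_derivative_transform_within_open[of F _ x UNIV S])
      (use Suc.prems that \<open>open S\<close> in \<open>auto simp: frechet_derivative_works\<close>)
  then have "frechet_derivative G (at x) = frechet_derivative F (at x)" if "x \<in> S" for x
    using that frechet_derivative_at by metis
  with * Suc show ?case
    by (auto simp: differentiable_def)
qed

text \<open>Lets each closure lemma below supply its own derivative formula in place of the chosen
  \<open>frechet_derivative\<close>.\<close>

lemma C_k_on_SucI:
  assumes "open S" "\<And>x. x \<in> S \<Longrightarrow> (F has_derivative F' x) (at x)" "\<And>v. C_k_on k S (\<lambda>x. F' x v)"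
  shows "C_k_on (Suc k) S F"
proof -
  have "frechet_derivative F (at x) = F' x" if "x \<in> S" for x
    using assms(2)[OF that] frechet_derivative_at by metis
  then have "C_k_on k S (\<lambda>x. frechet_derivative F (at x) v)" for v
    by (intro C_k_on_cong[OF assms(1) _ assms(3)[of v]]) simp
  then show ?thesis using assms(2) by (auto simp: differentiable_def)
qed

lemma C_k_on_has_derivative:
  assumes "C_k_on (Suc k) S F" "x \<in> S"
  shows "(F has_derivative frechet_derivative F (at x)) (at x)"
  using assms by (simp add: frechet_derivative_works)

lemma C_k_on_lower:
  assumes "C_k_on (Suc k) S F"
  shows "C_k_on k S F"
  using assms
proof (induction k arbitrary: F)
  case 0
  then show ?case
    by (auto intro!: differentiable_imp_continuous_on simp: differentiable_on_def
        differentiable_at_withinI)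
next
  case (Suc k)
  show ?case
    using Suc.prems Suc.IH[of "\<lambda>x. frechet_derivative F (at x) v" for v]
    by (metis C_k_on.simps(2))
qed

lemma C_k_on_subset:
  assumes "C_k_on k S F" "T \<subseteq> S"
  shows "C_k_on k T F"
  using assms by (induction k arbitrary: F) (auto intro: continuous_on_subset)

lemma C_k_on_const: "C_k_on k S (\<lambda>x. c)"
  by (induction k arbitrary: c) (auto simp: frechet_derivative_const)

lemma C_k_on_add:
  assumes "open S" "C_k_on k S F" "C_k_on k S G"
  shows "C_k_on k S (\<lambda>x. F x + G x)"
  using assms(2,3)
proof (induction k arbitrary: F G)
  case 0
  then show ?case by (auto intro: continuous_on_add)
next
  case (Suc k)
  show ?case
    by (rule C_k_on_SucI[OF \<open>open S\<close> has_derivative_add[OF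
            C_k_on_has_derivative[OF Suc.prems(1)] C_k_on_has_derivative[OF Suc.prems(2)]]])
      (use Suc in auto)
qed

lemma C_k_on_bounded_linear:
  assumes "open S" "bounded_linear T" "C_k_on k S F"
  shows "C_k_on k S (\<lambda>x. T (F x))"
  using assms(3)
proof (induction k arbitrary: F)
  case 0
  then show ?case
    using assms(2) by (auto intro: bounded_linear.continuous_on)
next
  case (Suc k)
  show ?case
    by (rule C_k_on_SucI[OF \<open>open S\<close> bounded_linear.has_derivative[OF assms(2)
            C_k_on_has_derivative[OF Suc.prems]]])
      (use Suc in auto)
qed

lemma C_k_on_bilinear:
  assumes "open S" "bounded_bilinear B" "C_k_on k S F" "C_k_on k S G"
  shows "C_k_on k S (\<lambda>x. B (F x) (G x))"
  using assms(3,4)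
proof (induction k arbitrary: F G)
  case 0
  then show ?case
    using bounded_bilinear.continuous_on[OF assms(2)] by auto
next
  case (Suc k)
  have "C_k_on k S F" "C_k_on k S G"
    using Suc.prems C_k_on_lower by blast+
  with Suc show ?case
    by (intro C_k_on_SucI[OF \<open>open S\<close>, where F' = "\<lambda>x v. B (F x) (frechet_derivative G (at x) v)
          + B (frechet_derivative F (at x) v) (G x)"]
        bounded_bilinear.FDERIV[OF assms(2)] C_k_on_has_derivative C_k_on_add[OF \<open>open S\<close>])
      auto
qed

text \<open>The derivative of the inverse contains the inverse again, so level k + 1 reuses the
  claim for the same F at level k.\<close>

lemma C_k_on_inverse:
  fixes F :: "'a::euclidean_space \<Rightarrow> 'b::real_normed_field"
  assumes "open S" "C_k_on k S F" "\<And>x. x \<in> S \<Longrightarrow> F x \<noteq> 0"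
  shows "C_k_on k S (\<lambda>x. inverse (F x))"
  using assms(2)
proof (induction k)
  case 0
  then show ?case using assms(3) by (auto intro: continuous_on_inverse)
next
  case (Suc k)
  have inv: "C_k_on k S (\<lambda>x. inverse (F x))"
    using Suc C_k_on_lower by blast
  show ?case
  proof (rule C_k_on_SucI[OF \<open>open S\<close>])
    fix x assume "x \<in> S"
    then show "((\<lambda>x. inverse (F x)) has_derivative
        (\<lambda>v. - (inverse (F x) * frechet_derivative F (at x) v * inverse (F x)))) (at x)"
      using Suc.prems assms(3) by (intro Deriv.has_derivative_inverse C_k_on_has_derivative) auto
  next
    fix v
    show "C_k_on k S (\<lambda>x. - (inverse (F x) * frechet_derivative F (at x) v * inverse (F x)))"
      using Suc.prems inv
      by (intro C_k_on_bounded_linear[OF \<open>open S\<close> bounded_linear_minus[OF bounded_linear_ident]]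
          C_k_on_bilinear[OF \<open>open S\<close> bounded_bilinear_mult]) auto
  qed
qed

text \<open>An affine inner map has the constant derivative T, so directional derivatives of the
  composite are composites of the same kind and the induction closes without a chain rule for
  general smooth maps.\<close>

lemma C_k_on_affine_comp:
  assumes "open S" "open S'" "bounded_linear T" "\<And>x. x \<in> S' \<Longrightarrow> T x + c \<in> S" "C_k_on k S F"
  shows "C_k_on k S' (\<lambda>x. F (T x + c))"
  using assms(5)
proof (induction k arbitrary: F)
  case 0
  have "continuous_on S' (\<lambda>x. T x + c)"
    by (intro continuous_on_add bounded_linear.continuous_on[OF assms(3)] continuous_on_id
        continuous_on_const)
  with 0 show ?case
    using assms(4) by (auto intro!: continuous_on_compose2[of S F S' "\<lambda>x. T x + c"])
next
  case (Suc k)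
  have T: "((\<lambda>x. T x + c) has_derivative T) (at x)" for x
    using has_derivative_add[OF bounded_linear_imp_has_derivative[OF assms(3)] has_derivative_const]
    by simp
  have "((\<lambda>x. F (T x + c)) has_derivative (\<lambda>v. frechet_derivative F (at (T x + c)) (T v))) (at x)"
    if "x \<in> S'" for x
  proof -
    have "(F has_derivative frechet_derivative F (at (T x + c))) (at (T x + c))"
      using Suc.prems assms(4)[OF that] by (rule C_k_on_has_derivative)
    from has_derivative_compose[OF T this] show ?thesis .
  qed
  moreover have "C_k_on k S' (\<lambda>x. frechet_derivative F (at (T x + c)) (T v))" for v
    using Suc by auto
  ultimately show ?case
    by (rule C_k_on_SucI[OF assms(2)])
qed

lemma smooth_onI: "(\<And>k. C_k_on k S F) \<Longrightarrow> smooth_on S F"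
  and smooth_onD: "smooth_on S F \<Longrightarrow> C_k_on k S F"
  by (auto simp: smooth_on_def)

lemma smooth_on_subset: "smooth_on S F \<Longrightarrow> T \<subseteq> S \<Longrightarrow> smooth_on T F"
  unfolding smooth_on_def using C_k_on_subset by blast

lemma smooth_on_const: "smooth_on S (\<lambda>x. c)"
  by (simp add: smooth_on_def C_k_on_const)

lemma smooth_on_add:
  "open S \<Longrightarrow> smooth_on S F \<Longrightarrow> smooth_on S G \<Longrightarrow> smooth_on S (\<lambda>x. F x + G x)"
  by (simp add: smooth_on_def C_k_on_add)

lemma smooth_on_bounded_linear:
  "open S \<Longrightarrow> bounded_linear T \<Longrightarrow> smooth_on S F \<Longrightarrow> smooth_on S (\<lambda>x. T (F x))"
  by (simp add: smooth_on_def C_k_on_bounded_linear)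

lemma smooth_on_minus: "open S \<Longrightarrow> smooth_on S F \<Longrightarrow> smooth_on S (\<lambda>x. - F x)"
  by (rule smooth_on_bounded_linear[OF _ bounded_linear_minus[OF bounded_linear_ident]])

lemma smooth_on_diff:
  "open S \<Longrightarrow> smooth_on S F \<Longrightarrow> smooth_on S G \<Longrightarrow> smooth_on S (\<lambda>x. F x - G x)"
  using smooth_on_add[of S F "\<lambda>x. - G x"] smooth_on_minus[of S G] by simp

lemma smooth_on_bilinear:
  "open S \<Longrightarrow> bounded_bilinear B \<Longrightarrow> smooth_on S F \<Longrightarrow> smooth_on S G \<Longrightarrow>
    smooth_on S (\<lambda>x. B (F x) (G x))"
  by (simp add: smooth_on_def C_k_on_bilinear)

lemmas smooth_on_mult = smooth_on_bilinear[OF _ bounded_bilinear_mult]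

lemma smooth_on_inverse:
  fixes F :: "'a::euclidean_space \<Rightarrow> 'b::real_normed_field"
  shows "open S \<Longrightarrow> smooth_on S F \<Longrightarrow> (\<And>x. x \<in> S \<Longrightarrow> F x \<noteq> 0) \<Longrightarrow> smooth_on S (\<lambda>x. inverse (F x))"
  by (simp add: smooth_on_def C_k_on_inverse)

lemma smooth_on_divide:
  fixes F :: "'a::euclidean_space \<Rightarrow> 'b::real_normed_field"
  shows "open S \<Longrightarrow> smooth_on S F \<Longrightarrow> smooth_on S G \<Longrightarrow> (\<And>x. x \<in> S \<Longrightarrow> G x \<noteq> 0) \<Longrightarrow>
    smooth_on S (\<lambda>x. F x / G x)"
  unfolding divide_inverse by (intro smooth_on_mult smooth_on_inverse) auto

lemma smooth_on_affine_comp: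
  "smooth_on S F \<Longrightarrow> open S \<Longrightarrow> open S' \<Longrightarrow> bounded_linear T \<Longrightarrow> (\<And>x. x \<in> S' \<Longrightarrow> T x + c \<in> S) \<Longrightarrow>
    smooth_on S' (\<lambda>x. F (T x + c))"
  by (simp add: smooth_on_def C_k_on_affine_comp)

lemma smooth_on_linear_comp:
  "smooth_on S F \<Longrightarrow> open S \<Longrightarrow> open S' \<Longrightarrow> bounded_linear T \<Longrightarrow> (\<And>x. x \<in> S' \<Longrightarrow> T x \<in> S) \<Longrightarrow>
    smooth_on S' (\<lambda>x. F (T x))"
  using smooth_on_affine_comp[of S F S' T 0] by simp

lemma smooth_on_has_derivative:
  "smooth_on S F \<Longrightarrow> x \<in> S \<Longrightarrow> (F has_derivative frechet_derivative F (at x)) (at x)"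
  using C_k_on_has_derivative smooth_onD by blast

lemma smooth_on_frechet_derivative:
  "smooth_on S F \<Longrightarrow> smooth_on S (\<lambda>x. frechet_derivative F (at x) v)"
  by (metis C_k_on.simps(2) smooth_on_def)

lemma smooth_on_continuous: "smooth_on S F \<Longrightarrow> continuous_on S F"
  using smooth_onD[of S F 0] by simp

lemma smooth_on_ident: "open S \<Longrightarrow> smooth_on S (\<lambda>x. x)"
proof (rule smooth_onI)
  fix k assume "open S"
  show "C_k_on k S (\<lambda>x. x)"
  proof (cases k)
    case (Suc n)
    show ?thesis unfolding Suc
      by (rule C_k_on_SucI[OF \<open>open S\<close> has_derivative_ident C_k_on_const])
  qed simp
qed

lemma smooth_on_linear: "open S \<Longrightarrow> bounded_linear T \<Longrightarrow> smooth_on S T"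
  using smooth_on_bounded_linear[OF _ _ smooth_on_ident] by blast

text \<open>Serves functions known only through their derivative: \<open>s\<close> and the
  antiderivative \<open>T\<close> in the construction of a Killing field.\<close>

lemma smooth_on_Suc:
  assumes "open S" "\<And>x. x \<in> S \<Longrightarrow> (F has_derivative F' x) (at x)" "\<And>v. smooth_on S (\<lambda>x. F' x v)"
  shows "smooth_on S F"
proof (rule smooth_onI)
  fix k
  have "C_k_on (Suc k) S F"
    using assms by (intro C_k_on_SucI smooth_onD) auto
  then show "C_k_on k S F" by (rule C_k_on_lower)
qed

lemma smooth_on_Pair:
  assumes "open S" "smooth_on S F" "smooth_on S G"
  shows "smooth_on S (\<lambda>x. (F x, G x))"
proof -
  have "smooth_on S (\<lambda>x. (F x, 0) + (0, G x))"
    using assms by (intro smooth_on_add[OF assms(1)]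
        smooth_on_bounded_linear[OF assms(1), of "\<lambda>y. (y, 0)"]
        smooth_on_bounded_linear[OF assms(1), of "\<lambda>y. (0, y)"])
      (auto intro: bounded_linear_Pair bounded_linear_ident bounded_linear_zero)
  then show ?thesis by simp
qed

section \<open>Symmetry of second derivatives\<close>

text \<open>The mean value theorem along v, applied to the difference of F on two parallel segments,
  and then along w. The left side is symmetric in v and w, which forces the mixed derivatives to
  agree in the limit.\<close>

lemma second_difference:
  fixes F :: "'a::euclidean_space \<Rightarrow> real"
  assumes "h > 0"
    and in_S: "\<And>s t. 0 \<le> s \<Longrightarrow> s \<le> h \<Longrightarrow> 0 \<le> t \<Longrightarrow> t \<le> h \<Longrightarrow> x + s *\<^sub>R v + t *\<^sub>R w \<in> S"
    and dF: "\<And>y. y \<in> S \<Longrightarrow> (F has_derivative F' y) (at y)"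
    and dF': "\<And>y. y \<in> S \<Longrightarrow> ((\<lambda>y. F' y v) has_derivative F'' y) (at y)"
  shows "\<exists>s t. 0 \<le> s \<and> s \<le> h \<and> 0 \<le> t \<and> t \<le> h \<and>
    F (x + h *\<^sub>R v + h *\<^sub>R w) - F (x + h *\<^sub>R v) - F (x + h *\<^sub>R w) + F x
      = h * (h * F'' (x + s *\<^sub>R v + t *\<^sub>R w) w)"
proof -
  have line: "((\<lambda>s. G (y + s *\<^sub>R d)) has_real_derivative G' d) (at s)"
    if "(G has_derivative G') (at (y + s *\<^sub>R d))" for G :: "'a \<Rightarrow> real" and G' y d s
  proof -
    have "((\<lambda>s. y + s *\<^sub>R d) has_derivative (\<lambda>k. k *\<^sub>R d)) (at s)"
      by (auto intro!: derivative_eq_intros)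
    from has_derivative_compose[OF this that]
    have "((\<lambda>s. G (y + s *\<^sub>R d)) has_derivative (\<lambda>k. G' (k *\<^sub>R d))) (at s)" .
    moreover have "G' (k *\<^sub>R d) = G' d * k" for k
      using linear_scale[OF has_derivative_linear[OF that]] by simp
    ultimately show ?thesis
      by (simp add: has_field_derivative_def)
  qed
  define \<phi> where "\<phi> s = F ((x + h *\<^sub>R w) + s *\<^sub>R v) - F (x + s *\<^sub>R v)" for s
  have "\<exists>s. 0 < s \<and> s < h \<and> \<phi> h - \<phi> 0 = (h - 0) *
      (F' ((x + h *\<^sub>R w) + s *\<^sub>R v) v - F' (x + s *\<^sub>R v) v)"
    unfolding \<phi>_def using \<open>h > 0\<close>
    by (intro MVT2 DERIV_diff line dF) (use in_S[of _ h] in_S[of _ 0] in \<open>auto simp: add_ac\<close>)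
  then obtain s where s: "0 < s" "s < h" and
    s_eq: "\<phi> h - \<phi> 0 = h * (F' ((x + h *\<^sub>R w) + s *\<^sub>R v) v - F' (x + s *\<^sub>R v) v)" by auto
  have "\<exists>t. 0 < t \<and> t < h \<and> F' ((x + s *\<^sub>R v) + h *\<^sub>R w) v - F' ((x + s *\<^sub>R v) + 0 *\<^sub>R w) v
      = (h - 0) * F'' ((x + s *\<^sub>R v) + t *\<^sub>R w) w"
    using \<open>h > 0\<close> by (intro MVT2 line dF') (use in_S[of s] s in auto)
  then obtain t where t: "0 < t" "t < h" and
    "F' ((x + s *\<^sub>R v) + h *\<^sub>R w) v - F' (x + s *\<^sub>R v) v = h * F'' ((x + s *\<^sub>R v) + t *\<^sub>R w) w"
    by auto
  then have "\<phi> h - \<phi> 0 = h * (h * F'' ((x + s *\<^sub>R v) + t *\<^sub>R w) w)"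
    using s_eq by (simp add: add_ac)
  then show ?thesis
    using s t by (intro exI[of _ s] exI[of _ t]) (auto simp: \<phi>_def add_ac)
qed

lemma second_derivative_symmetric_real:
  fixes F :: "'a::euclidean_space \<Rightarrow> real"
  assumes "open S" "smooth_on S F" "x \<in> S"
  shows "frechet_derivative (\<lambda>y. frechet_derivative F (at y) v) (at x) w =
    frechet_derivative (\<lambda>y. frechet_derivative F (at y) w) (at x) v"
proof -
  define D where "D v w y = frechet_derivative (\<lambda>y. frechet_derivative F (at y) v) (at y) w" for v w y
  have cont: "isCont (D v w) x" for v w
    unfolding D_def using smooth_on_continuous[OF smooth_on_frechet_derivative[OF
          smooth_on_frechet_derivative[OF assms(2)]], of v w] assms
    by (simp add: continuous_on_eq_continuous_at)
  have "D v w x = D w v x"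
  proof (rule ccontr)
    assume ne: "D v w x \<noteq> D w v x"
    define \<epsilon> where "\<epsilon> = \<bar>D v w x - D w v x\<bar> / 2"
    have "\<epsilon> > 0" using ne by (simp add: \<epsilon>_def)
    obtain d1 where d1: "d1 > 0" "\<And>y. dist y x < d1 \<Longrightarrow> dist (D v w y) (D v w x) < \<epsilon>"
      using cont[of v w] \<open>\<epsilon> > 0\<close> unfolding continuous_at_eps_delta by metis
    obtain d2 where d2: "d2 > 0" "\<And>y. dist y x < d2 \<Longrightarrow> dist (D w v y) (D w v x) < \<epsilon>"
      using cont[of w v] \<open>\<epsilon> > 0\<close> unfolding continuous_at_eps_delta by metis
    obtain d3 where d3: "d3 > 0" "ball x d3 \<subseteq> S"
      using assms openE by blast
    define d where "d = min d1 (min d2 d3)"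
    \<comment> \<open>This h keeps the parallelogram with sides h v and h w within d of x; the
      summand 1 covers v = w = 0.\<close>
    define h where "h = d / (2 * (norm v + norm w + 1))"
    have "d > 0" using d1 d2 d3 by (simp add: d_def)
    then have "h > 0" by (simp add: h_def add_nonneg_pos)
    have near: "dist (x + s *\<^sub>R v + t *\<^sub>R w) x < d" if "0 \<le> s" "s \<le> h" "0 \<le> t" "t \<le> h" for s t
    proof -
      have "dist (x + s *\<^sub>R v + t *\<^sub>R w) x = norm (s *\<^sub>R v + t *\<^sub>R w)"
        by (simp add: dist_norm)
      also have "\<dots> \<le> norm (s *\<^sub>R v) + norm (t *\<^sub>R w)"
        by (rule norm_triangle_ineq)
      also have "\<dots> \<le> h * norm v + h * norm w"
        using that by (auto intro!: add_mono mult_right_mono)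
      also have "\<dots> \<le> h * (norm v + norm w + 1)"
        using \<open>h > 0\<close> by (simp add: algebra_simps)
      also have "\<dots> = d / 2"
      proof -
        have "d / (2 * c) * c = d / 2" if "c > 0" for c
          using that by (simp add: field_simps)
        then show ?thesis unfolding h_def by (simp only: add_nonneg_pos norm_ge_zero zero_less_one add_nonneg_nonneg)
      qed
      also have "\<dots> < d" using \<open>d > 0\<close> by simp
      finally show ?thesis .
    qed
    have in_S: "x + s *\<^sub>R v + t *\<^sub>R w \<in> S" if "0 \<le> s" "s \<le> h" "0 \<le> t" "t \<le> h" for s t
      using near[OF that] d3 by (auto simp: d_def dist_commute)
    have in_S': "x + s *\<^sub>R w + t *\<^sub>R v \<in> S" if "0 \<le> s" "s \<le> h" "0 \<le> t" "t \<le> h" for s t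
      using in_S[of t s] that by (simp add: add_ac)
    note der = smooth_on_has_derivative[OF assms(2)]
      smooth_on_has_derivative[OF smooth_on_frechet_derivative[OF assms(2)]]
    obtain s t where st: "0 \<le> s" "s \<le> h" "0 \<le> t" "t \<le> h" and
      1: "F (x + h *\<^sub>R v + h *\<^sub>R w) - F (x + h *\<^sub>R v) - F (x + h *\<^sub>R w) + F x
        = h * (h * D v w (x + s *\<^sub>R v + t *\<^sub>R w))"
      unfolding D_def using second_difference[OF \<open>h > 0\<close> in_S der(1) der(2)] by blast
    obtain s' t' where st': "0 \<le> s'" "s' \<le> h" "0 \<le> t'" "t' \<le> h" and
      2: "F (x + h *\<^sub>R w + h *\<^sub>R v) - F (x + h *\<^sub>R w) - F (x + h *\<^sub>R v) + F x
        = h * (h * D w v (x + s' *\<^sub>R w + t' *\<^sub>R v))"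
      unfolding D_def using second_difference[OF \<open>h > 0\<close> in_S' der(1) der(2)] by blast
    have "h * (h * D v w (x + s *\<^sub>R v + t *\<^sub>R w)) = h * (h * D w v (x + t' *\<^sub>R v + s' *\<^sub>R w))"
    proof -
      have "x + h *\<^sub>R w + h *\<^sub>R v = x + h *\<^sub>R v + h *\<^sub>R w"
        "x + s' *\<^sub>R w + t' *\<^sub>R v = x + t' *\<^sub>R v + s' *\<^sub>R w"
        by (simp_all add: add_ac)
      then show ?thesis using 1 2 by (smt (verit))
    qed
    then have "D v w (x + s *\<^sub>R v + t *\<^sub>R w) = D w v (x + t' *\<^sub>R v + s' *\<^sub>R w)"
      using \<open>h > 0\<close> by simp
    moreover have "\<bar>D v w (x + s *\<^sub>R v + t *\<^sub>R w) - D v w x\<bar> < \<epsilon>"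
      using d1(2) near[OF st] by (simp add: d_def dist_real_def)
    moreover have "\<bar>D w v (x + t' *\<^sub>R v + s' *\<^sub>R w) - D w v x\<bar> < \<epsilon>"
      using d2(2) near[of t' s'] st' by (simp add: d_def dist_real_def)
    ultimately show False by (simp add: \<epsilon>_def abs_if split: if_splits)
  qed
  then show ?thesis by (simp add: D_def)
qed

lemma frechet_derivative_bounded_linear:
  assumes "bounded_linear T" "F differentiable (at x)"
  shows "frechet_derivative (\<lambda>y. T (F y)) (at x) v = T (frechet_derivative F (at x) v)"
  using bounded_linear.has_derivative[OF assms(1) assms(2)[unfolded frechet_derivative_works]]
    frechet_derivative_at by metis

lemma second_derivative_symmetric:
  fixes F :: "'a::euclidean_space \<Rightarrow> 'b::euclidean_space"
  assumes "open S" "smooth_on S F" "x \<in> S"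
  shows "frechet_derivative (\<lambda>y. frechet_derivative F (at y) v) (at x) w =
    frechet_derivative (\<lambda>y. frechet_derivative F (at y) w) (at x) v"
proof (rule euclidean_eqI)
  fix b :: 'b
  note bl = bounded_linear_inner_left[of b]
  have *: "frechet_derivative (\<lambda>y. frechet_derivative F (at y) v) (at x) w \<bullet> b =
    frechet_derivative (\<lambda>y. frechet_derivative (\<lambda>y. F y \<bullet> b) (at y) v) (at x) w" for v w
  proof -
    have "((\<lambda>y. frechet_derivative F (at y) v \<bullet> b) has_derivative
        (\<lambda>w. frechet_derivative (\<lambda>y. frechet_derivative F (at y) v) (at x) w \<bullet> b)) (at x)"
      by (rule bounded_linear.has_derivative[OF bl smooth_on_has_derivative[OF
              smooth_on_frechet_derivative[OF assms(2)] assms(3)]])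
    then have "((\<lambda>y. frechet_derivative (\<lambda>y. F y \<bullet> b) (at y) v) has_derivative
        (\<lambda>w. frechet_derivative (\<lambda>y. frechet_derivative F (at y) v) (at x) w \<bullet> b)) (at x)"
      by (rule has_derivative_transform_within_open[OF _ assms(1,3)])
        (rule frechet_derivative_bounded_linear[OF bl differentiableI[OF
              smooth_on_has_derivative[OF assms(2)]], symmetric])
    from frechet_derivative_at[OF this] show ?thesis by metis
  qed
  show "frechet_derivative (\<lambda>y. frechet_derivative F (at y) v) (at x) w \<bullet> b =
    frechet_derivative (\<lambda>y. frechet_derivative F (at y) w) (at x) v \<bullet> b"
    unfolding * using smooth_on_bounded_linear[OF assms(1) bl assms(2)] assms
    by (intro second_derivative_symmetric_real) auto
qed

section \<open>Functions holomorphic in \<open>\<zeta>\<close> and smooth in \<open>u\<close>\<close>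

text \<open>Derivatives of the map on pairs, so that the Frechet calculus applies;
  \<open>D1 F\<close> is a complex partial derivative only where \<open>has_partials\<close>
  holds.\<close>

definition D1 :: "(complex \<times> real \<Rightarrow> complex) \<Rightarrow> complex \<times> real \<Rightarrow> complex" where
  "D1 F x = frechet_derivative F (at x) (1, 0)"

definition D2 :: "(complex \<times> real \<Rightarrow> complex) \<Rightarrow> complex \<times> real \<Rightarrow> complex" where
  "D2 F x = frechet_derivative F (at x) (0, 1)"

text \<open>Complex linearity in the first slot encodes the Cauchy-Riemann equations in
  \<zeta>.\<close>

definition has_partials ::
  "(complex \<times> real \<Rightarrow> complex) \<Rightarrow> complex \<times> real \<Rightarrow> complex \<Rightarrow> complex \<Rightarrow> bool" where
  "has_partials F x p q \<longleftrightarrow>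
     (F has_derivative (\<lambda>v. p * fst v + q * of_real (snd v))) (at x)"

definition hol_smooth :: "(complex \<times> real) set \<Rightarrow> (complex \<times> real \<Rightarrow> complex) \<Rightarrow> bool" where
  "hol_smooth S F \<longleftrightarrow> smooth_on S F \<and> (\<forall>x\<in>S. has_partials F x (D1 F x) (D2 F x))"

lemma has_partials_D:
  assumes "has_partials F x p q"
  shows "D1 F x = p" "D2 F x = q"
  unfolding D1_def D2_def frechet_derivative_at[OF assms[unfolded has_partials_def], symmetric]
  by simp_all

lemma has_partials_eq: "has_partials F x p q \<Longrightarrow> p = p' \<Longrightarrow> q = q' \<Longrightarrow> has_partials F x p' q'"
  by simp

lemma has_partials_cong:
  assumes "has_partials F x p q" "open S" "x \<in> S" "\<And>y. y \<in> S \<Longrightarrow> F y = G y"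
  shows "has_partials G x p q"
  using has_derivative_transform_within_open[OF assms(1)[unfolded has_partials_def] assms(2,3)] assms(4)
  unfolding has_partials_def by blast

lemma has_partials_const: "has_partials (\<lambda>y. c) x 0 0"
  unfolding has_partials_def by simp

lemma has_partials_fst: "has_partials fst x 1 0"
  unfolding has_partials_def by (auto intro!: derivative_eq_intros)

lemma has_partials_add:
  "has_partials F x p q \<Longrightarrow> has_partials G x p' q' \<Longrightarrow> has_partials (\<lambda>y. F y + G y) x (p + p') (q + q')"
  unfolding has_partials_def by (auto intro!: derivative_eq_intros simp: algebra_simps)

lemma has_partials_minus:
  "has_partials F x p q \<Longrightarrow> has_partials (\<lambda>y. - F y) x (- p) (- q)"
  unfolding has_partials_def by (auto intro!: derivative_eq_intros simp: algebra_simps)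

lemma has_partials_diff:
  "has_partials F x p q \<Longrightarrow> has_partials G x p' q' \<Longrightarrow> has_partials (\<lambda>y. F y - G y) x (p - p') (q - q')"
  unfolding has_partials_def by (auto intro!: derivative_eq_intros simp: algebra_simps)

lemma has_partials_mult:
  "has_partials F x p q \<Longrightarrow> has_partials G x p' q' \<Longrightarrow>
    has_partials (\<lambda>y. F y * G y) x (p * G x + F x * p') (q * G x + F x * q')"
  unfolding has_partials_def by (auto intro!: derivative_eq_intros simp: algebra_simps)

lemma has_partials_divide:
  assumes "has_partials F x p q" "has_partials G x p' q'" "G x \<noteq> 0"
  shows "has_partials (\<lambda>y. F y / G y) x ((p * G x - F x * p') / (G x * G x))
    ((q * G x - F x * q') / (G x * G x))"
  using assms unfolding has_partials_def
  by (auto intro!: derivative_eq_intros simp: field_simps)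

lemma has_partials_exp:
  assumes "has_partials F x p q"
  shows "has_partials (\<lambda>y. exp (F y)) x (exp (F x) * p) (exp (F x) * q)"
proof -
  have "(exp has_derivative (\<lambda>h. exp (F x) * h)) (at (F x))"
    using DERIV_exp[of "F x"] by (simp add: has_field_derivative_def)
  from has_derivative_compose[OF assms[unfolded has_partials_def] this] show ?thesis
    unfolding has_partials_def by (simp add: algebra_simps)
qed

lemma hol_smoothI:
  assumes "smooth_on S F" "\<And>x. x \<in> S \<Longrightarrow> \<exists>p q. has_partials F x p q"
  shows "hol_smooth S F"
  using assms has_partials_D unfolding hol_smooth_def by metis

lemma hol_smoothI':
  assumes "smooth_on S F" "\<And>x. x \<in> S \<Longrightarrow> has_partials F x (p x) (q x)"
  shows "hol_smooth S F"
  using assms by (blast intro: hol_smoothI)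

lemma hol_smooth_smooth_on: "hol_smooth S F \<Longrightarrow> smooth_on S F"
  and hol_smooth_has_partials: "hol_smooth S F \<Longrightarrow> x \<in> S \<Longrightarrow> has_partials F x (D1 F x) (D2 F x)"
  by (auto simp: hol_smooth_def)

lemma hol_smooth_const: "hol_smooth S (\<lambda>y. c)"
  by (rule hol_smoothI) (use smooth_on_const has_partials_const in blast)+

lemma hol_smooth_fst: "open S \<Longrightarrow> hol_smooth S fst"
  by (rule hol_smoothI) (use smooth_on_linear[OF _ bounded_linear_fst] has_partials_fst in blast)+

lemma hol_smooth_add:
  "open S \<Longrightarrow> hol_smooth S F \<Longrightarrow> hol_smooth S G \<Longrightarrow> hol_smooth S (\<lambda>y. F y + G y)"
  by (rule hol_smoothI'[OF smooth_on_add has_partials_add[OF hol_smooth_has_partials hol_smooth_has_partials]])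
    (auto intro: hol_smooth_smooth_on)

lemma hol_smooth_minus: "open S \<Longrightarrow> hol_smooth S F \<Longrightarrow> hol_smooth S (\<lambda>y. - F y)"
  by (rule hol_smoothI'[OF smooth_on_minus has_partials_minus[OF hol_smooth_has_partials]])
    (auto intro: hol_smooth_smooth_on)

lemma hol_smooth_diff:
  "open S \<Longrightarrow> hol_smooth S F \<Longrightarrow> hol_smooth S G \<Longrightarrow> hol_smooth S (\<lambda>y. F y - G y)"
  by (rule hol_smoothI'[OF smooth_on_diff has_partials_diff[OF hol_smooth_has_partials hol_smooth_has_partials]])
    (auto intro: hol_smooth_smooth_on)

lemma hol_smooth_mult:
  "open S \<Longrightarrow> hol_smooth S F \<Longrightarrow> hol_smooth S G \<Longrightarrow> hol_smooth S (\<lambda>y. F y * G y)"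
  by (rule hol_smoothI'[OF smooth_on_mult has_partials_mult[OF hol_smooth_has_partials hol_smooth_has_partials]])
    (auto intro: hol_smooth_smooth_on)

lemma hol_smooth_divide:
  "open S \<Longrightarrow> hol_smooth S F \<Longrightarrow> hol_smooth S G \<Longrightarrow> (\<And>x. x \<in> S \<Longrightarrow> G x \<noteq> 0) \<Longrightarrow>
    hol_smooth S (\<lambda>y. F y / G y)"
  by (rule hol_smoothI'[OF smooth_on_divide has_partials_divide[OF hol_smooth_has_partials hol_smooth_has_partials]])
    (auto intro: hol_smooth_smooth_on)

text \<open>Symmetry of second derivatives takes the place of Cauchy's formula: the derivative of
  \<open>D1 F\<close> along (h, 0) is the derivative along (1, 0) of the derivative of F along (h,
  0), and the latter is h times \<open>D1 F\<close>.\<close>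

lemma hol_smooth_partials:
  assumes "open S" "hol_smooth S F"
  shows "hol_smooth S (D1 F)" "hol_smooth S (D2 F)"
    and "x \<in> S \<Longrightarrow> D1 (D2 F) x = D2 (D1 F) x"
proof -
  note sm = hol_smooth_smooth_on[OF assms(2)]
  have sm1: "smooth_on S (D1 F)" and sm2: "smooth_on S (D2 F)"
    unfolding D1_def[abs_def] D2_def[abs_def] using sm by (auto intro: smooth_on_frechet_derivative)
  have der: "frechet_derivative F (at y) v = D1 F y * fst v + D2 F y * of_real (snd v)" if "y \<in> S" for y v
    using fun_cong[OF frechet_derivative_at[OF
          hol_smooth_has_partials[OF assms(2) that, unfolded has_partials_def]], of v] by simp
  have lin: "frechet_derivative (\<lambda>y. frechet_derivative F (at y) (h, 0)) (at x) w
      = frechet_derivative (D1 F) (at x) w * h" if "x \<in> S" for x h w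
  proof -
    have "(D1 F has_derivative frechet_derivative (D1 F) (at x)) (at x)"
      using smooth_on_has_derivative[OF sm1 that] .
    then have "((\<lambda>y. D1 F y * h) has_derivative (\<lambda>w. frechet_derivative (D1 F) (at x) w * h)) (at x)"
      by (rule bounded_linear.has_derivative[OF bounded_linear_mult_left])
    then have "((\<lambda>y. frechet_derivative F (at y) (h, 0)) has_derivative
        (\<lambda>w. frechet_derivative (D1 F) (at x) w * h)) (at x)"
      by (rule has_derivative_transform_within_open[OF _ assms(1) that]) (simp add: der)
    from frechet_derivative_at[OF this] show ?thesis by metis
  qed
  have split: "G (h, k) = G (h, 0) + k *\<^sub>R G (0, 1)" if "linear G"
    for G :: "complex \<times> real \<Rightarrow> complex" and h k
    using linear_add[OF that, of "(h, 0)" "k *\<^sub>R (0, 1)"] linear_scale[OF that, of k "(0, 1)"] by simp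
  have hp: "has_partials G x (D1 G x) (D2 G x)"
    if "smooth_on S G" "x \<in> S" "\<And>h. frechet_derivative G (at x) (h, 0) = D1 G x * h" for G x
  proof -
    have *: "(G has_derivative frechet_derivative G (at x)) (at x)"
      using smooth_on_has_derivative[OF that(1,2)] .
    have "frechet_derivative G (at x) = (\<lambda>v. D1 G x * fst v + D2 G x * of_real (snd v))"
    proof
      fix v :: "complex \<times> real"
      show "frechet_derivative G (at x) v = D1 G x * fst v + D2 G x * of_real (snd v)"
        using split[OF has_derivative_linear[OF *], of "fst v" "snd v"] that(3)
        by (simp add: D2_def scaleR_conv_of_real)
    qed
    with * show ?thesis by (simp add: has_partials_def)
  qed
  show "hol_smooth S (D1 F)"
  proof (rule hol_smoothI[OF sm1])
    fix x assume "x \<in> S"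
    have "frechet_derivative (D1 F) (at x) (h, 0) = D1 (D1 F) x * h" for h
      using second_derivative_symmetric[OF assms(1) sm \<open>x \<in> S\<close>, of "(h, 0)" "(1, 0)"]
        lin[OF \<open>x \<in> S\<close>, of h "(1, 0)"]
      by (simp add: D1_def[abs_def])
    then show "\<exists>p q. has_partials (D1 F) x p q" using hp[OF sm1 \<open>x \<in> S\<close>] by blast
  qed
  have D2D1: "frechet_derivative (D2 F) (at x) (h, 0) = D2 (D1 F) x * h" if "x \<in> S" for x h
    using second_derivative_symmetric[OF assms(1) sm that, of "(h, 0)" "(0, 1)"] lin[OF that, of h "(0, 1)"]
    by (simp add: D2_def[abs_def])
  show comm: "D1 (D2 F) x = D2 (D1 F) x" if "x \<in> S" for x
    using D2D1[OF that, of 1] by (simp add: D1_def[of "D2 F"])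
  show "hol_smooth S (D2 F)"
    by (rule hol_smoothI[OF sm2]) (use D2D1 comm hp[OF sm2] in metis)
qed

section \<open>Killing fields of a pp-wave\<close>

definition pr :: "point \<Rightarrow> complex \<times> real" where
  "pr q = (fst q, fst (snd q))"

lemma pr_simps [simp]: "pr (z, u, v) = (z, u)"
  by (simp add: pr_def)

lemma bounded_linear_pr: "bounded_linear pr"
  unfolding pr_def[abs_def]
  by (intro bounded_linear_Pair bounded_linear_fst
      bounded_linear_compose[OF bounded_linear_fst bounded_linear_snd])

lemma has_derivative_pr:
  assumes "has_partials H (pr q) p1 p2"
  shows "((\<lambda>q. H (pr q)) has_derivative (\<lambda>v. p1 * fst v + p2 * of_real (fst (snd v)))) (at q)"
proof -
  have "(pr has_derivative pr) (at q)"
    by (rule bounded_linear_imp_has_derivative[OF bounded_linear_pr])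
  from has_derivative_compose[OF this assms[unfolded has_partials_def]] show ?thesis
    by (simp add: pr_def)
qed

lemma has_derivative_Re_pr:
  assumes "has_partials H (pr q) p1 p2"
  shows "((\<lambda>q. Re (H (pr q))) has_derivative (\<lambda>v. Re (p1 * fst v + p2 * of_real (fst (snd v))))) (at q)"
  using bounded_linear.has_derivative[OF bounded_linear_Re has_derivative_pr[OF assms]] .

lemma has_derivative_Im_pr:
  assumes "has_partials H (pr q) p1 p2"
  shows "((\<lambda>q. Im (H (pr q))) has_derivative (\<lambda>v. Im (p1 * fst v + p2 * of_real (fst (snd v))))) (at q)"
  using bounded_linear.has_derivative[OF bounded_linear_Im has_derivative_pr[OF assms]] .

lemma frechet_derivative_eqI:
  assumes "open V" "q \<in> V" "\<And>q. q \<in> V \<Longrightarrow> F q = G q" "(G has_derivative G') (at q)"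
  shows "frechet_derivative F (at q) v = G' v"
proof -
  have "(F has_derivative G') (at q)"
    by (rule has_derivative_transform_within_open[OF assms(4,1,2)]) (simp add: assms(3))
  from frechet_derivative_at[OF this] show ?thesis by metis
qed

text \<open>The metric depends on the point only through Re f in its du du component, so X
  differentiates nothing else.\<close>

lemma lie_derivative_pp_metric:
  assumes "has_partials (\<lambda>(z, u). f z u) (pr q) f1 f2"
  shows "lie_derivative X (pp_metric f) q Y W =
    - 4 * Re (f1 * fst (X q) + f2 * of_real (fst (snd (X q)))) * fst (snd Y) * fst (snd W)
    + pp_metric f q (frechet_derivative X (at q) Y) W + pp_metric f q Y (frechet_derivative X (at q) W)"
proof -
  define c where "c = 2 * Re (fst Y * cnj (fst W)) - (fst (snd Y) * snd (snd W) + snd (snd Y) * fst (snd W))"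
  define k where "k = - 4 * (fst (snd Y) * fst (snd W))"
  have pp: "(\<lambda>q. pp_metric f q Y W) = (\<lambda>q. c + k * Re ((\<lambda>(z, u). f z u) (pr q)))"
  proof
    fix q
    show "pp_metric f q Y W = c + k * Re ((\<lambda>(z, u). f z u) (pr q))"
      by (cases q; cases Y; cases W) (simp add: pp_metric_def c_def k_def)
  qed
  have "((\<lambda>q. c + k * Re ((\<lambda>(z, u). f z u) (pr q))) has_derivative
      (\<lambda>v. 0 + k * Re (f1 * fst v + f2 * of_real (fst (snd v))))) (at q)"
    by (intro has_derivative_add has_derivative_const has_derivative_mult_right
        has_derivative_Re_pr[OF assms])
  from fun_cong[OF frechet_derivative_at[OF this, symmetric]] have
    "frechet_derivative (\<lambda>q. pp_metric f q Y W) (at q) (X q) =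
      0 + k * Re (f1 * fst (X q) + f2 * of_real (fst (snd (X q))))"
    unfolding pp .
  then show ?thesis unfolding lie_derivative_def k_def by (simp add: algebra_simps)
qed

section \<open>The Killing equations in real components\<close>

locale killing_field =
  fixes S :: "(complex \<times> real) set" and f :: "complex \<Rightarrow> real \<Rightarrow> complex"
    and V :: "point set" and X :: "point \<Rightarrow> tangent"
  assumes open_S: "open S" and hol_f: "hol_smooth S (\<lambda>(z, u). f z u)"
    and f11_nz: "\<And>x. x \<in> S \<Longrightarrow> D1 (D1 (\<lambda>(z, u). f z u)) x \<noteq> 0"
    and open_V: "open V" and V_S: "\<And>q. q \<in> V \<Longrightarrow> pr q \<in> S"
    and smooth_X: "smooth_on V X"
    and killing: "\<And>q Y W. q \<in> V \<Longrightarrow> lie_derivative X (pp_metric f) q Y W = 0"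
begin

text \<open>The point comes last, so that \<open>pd v F\<close> is again a function and iterated
  derivatives are nested applications.\<close>

definition pd :: "tangent \<Rightarrow> (point \<Rightarrow> 'b::real_normed_vector) \<Rightarrow> point \<Rightarrow> 'b" where
  "pd v F q = frechet_derivative F (at q) v"

abbreviation "e1 \<equiv> (1, 0, 0) :: tangent"
abbreviation "e2 \<equiv> (\<i>, 0, 0) :: tangent"
abbreviation "eu \<equiv> (0, 1, 0) :: tangent"
abbreviation "ev \<equiv> (0, 0, 1) :: tangent"

definition "x1 q = Re (fst (X q))"
definition "x2 q = Im (fst (X q))"
definition "s q = fst (snd (X q))"
definition "t q = snd (snd (X q))"

abbreviation "\<phi> \<equiv> (\<lambda>(z, u). f z u)"

lemma smooth_comp: "smooth_on V x1" "smooth_on V x2" "smooth_on V s" "smooth_on V t"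
  unfolding x1_def[abs_def] x2_def[abs_def] s_def[abs_def] t_def[abs_def]
  by (intro smooth_on_bounded_linear[OF open_V _ smooth_X]
      bounded_linear_compose[OF bounded_linear_Re bounded_linear_fst]
      bounded_linear_compose[OF bounded_linear_Im bounded_linear_fst]
      bounded_linear_compose[OF bounded_linear_fst bounded_linear_snd]
      bounded_linear_compose[OF bounded_linear_snd bounded_linear_snd])+

lemma smooth_pd: "smooth_on V F \<Longrightarrow> smooth_on V (pd v F)"
  unfolding pd_def[abs_def] by (rule smooth_on_frechet_derivative)

lemma has_derivative_pd: "smooth_on V F \<Longrightarrow> q \<in> V \<Longrightarrow> (F has_derivative (\<lambda>v. pd v F q)) (at q)"
  unfolding pd_def by (rule smooth_on_has_derivative)

lemma pd_commute:
  fixes F :: "point \<Rightarrow> real"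
  shows "smooth_on V F \<Longrightarrow> q \<in> V \<Longrightarrow> pd v (pd w F) q = pd w (pd v F) q"
  unfolding pd_def[abs_def] using second_derivative_symmetric[OF open_V] by blast

lemma pd_eqI:
  assumes "q \<in> V" "\<And>q. q \<in> V \<Longrightarrow> F q = G q" "(G has_derivative G') (at q)"
  shows "pd v F q = G' v"
  unfolding pd_def by (rule frechet_derivative_eqI[OF open_V assms])

lemma pd_zero:
  assumes "q \<in> V" "\<And>q. q \<in> V \<Longrightarrow> F q = 0"
  shows "pd v F q = 0"
  using pd_eqI[OF assms has_derivative_const] .

lemma pd_scale:
  fixes F G :: "point \<Rightarrow> real"
  assumes "q \<in> V" "\<And>q. q \<in> V \<Longrightarrow> F q = c * G q" "smooth_on V G"
  shows "pd v F q = c * pd v G q"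
  by (rule pd_eqI[OF assms(1,2)])
    (auto intro!: derivative_eq_intros has_derivative_pd[OF assms(3,1)])

lemma f_partials:
  assumes "q \<in> V"
  shows "has_partials \<phi> (pr q) (D1 \<phi> (pr q)) (D2 \<phi> (pr q))"
    "has_partials (D1 \<phi>) (pr q) (D1 (D1 \<phi>) (pr q)) (D2 (D1 \<phi>) (pr q))"
    "has_partials (D2 \<phi>) (pr q) (D2 (D1 \<phi>) (pr q)) (D2 (D2 \<phi>) (pr q))"
  using hol_smooth_partials[OF open_S hol_f] hol_f V_S[OF assms] hol_smooth_has_partials
  by metis+

lemma killing_eqs:
  assumes "q \<in> V"
  shows "pd ev s q = 0" "pd e1 s q = 2 * pd ev x1 q" "pd e2 s q = 2 * pd ev x2 q"
    "pd e1 x1 q = 0" "pd e2 x2 q = 0" "pd e2 x1 q = - pd e1 x2 q" "pd ev t q = - pd eu s q"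
    "pd e1 t q = 2 * pd eu x1 q - 4 * Re (\<phi> (pr q)) * pd e1 s q"
    "pd e2 t q = 2 * pd eu x2 q - 4 * Re (\<phi> (pr q)) * pd e2 s q"
    "2 * Re (D1 \<phi> (pr q) * fst (X q) + D2 \<phi> (pr q) * of_real (s q)) + pd eu t q
      + 4 * Re (\<phi> (pr q)) * pd eu s q = 0"
proof -
  have dX: "(X has_derivative frechet_derivative X (at q)) (at q)"
    using smooth_on_has_derivative[OF smooth_X assms] .
  have comp: "pd v x1 q = Re (fst (frechet_derivative X (at q) v))"
    "pd v x2 q = Im (fst (frechet_derivative X (at q) v))"
    "pd v s q = fst (snd (frechet_derivative X (at q) v))"
    "pd v t q = snd (snd (frechet_derivative X (at q) v))" for v
    unfolding pd_def x1_def[abs_def] x2_def[abs_def] s_def[abs_def] t_def[abs_def]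
    using assms by (auto intro!: frechet_derivative_eqI[OF open_V] has_derivative_Re has_derivative_Im
        has_derivative_fst has_derivative_snd dX)
  have K: "- 4 * Re (D1 \<phi> (pr q) * fst (X q) + D2 \<phi> (pr q) * of_real (s q)) * yu * wu
      + (2 * Re (Complex (pd (y, yu, yv) x1 q) (pd (y, yu, yv) x2 q) * cnj w)
        - (pd (y, yu, yv) s q * wv + pd (y, yu, yv) t q * wu)
        - 4 * Re (\<phi> (pr q)) * pd (y, yu, yv) s q * wu)
      + (2 * Re (y * cnj (Complex (pd (w, wu, wv) x1 q) (pd (w, wu, wv) x2 q)))
        - (yu * pd (w, wu, wv) t q + yv * pd (w, wu, wv) s q)
        - 4 * Re (\<phi> (pr q)) * yu * pd (w, wu, wv) s q) = 0" for y yu yv w wu wv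
  proof -
    have pp: "pp_metric f q Y W = 2 * Re (fst Y * cnj (fst W)) - (fst (snd Y) * snd (snd W)
      + snd (snd Y) * fst (snd W)) - 4 * Re (\<phi> (pr q)) * fst (snd Y) * fst (snd W)" for Y W
      by (cases q; cases Y; cases W) (simp add: pp_metric_def)
    show ?thesis
      using killing[OF assms, of "(y, yu, yv)" "(w, wu, wv)"]
      unfolding lie_derivative_pp_metric[OF f_partials(1)[OF assms]] pp comp
      by (simp add: s_def)
  qed
  \<comment> \<open>The instantiation order is yu, wu, y, yv, w, wv, the order of occurrence in
    \<open>K\<close>; the ten choices are the ten pairs of coordinate vectors.\<close>
  show "pd ev s q = 0" using K[of 0 0 0 1 0 1] by simp
  show "pd e1 s q = 2 * pd ev x1 q" using K[of 0 0 1 0 0 1] by simp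
  show "pd e2 s q = 2 * pd ev x2 q" using K[of 0 0 \<i> 0 0 1] by simp
  show "pd e1 x1 q = 0" using K[of 0 0 1 0 1 0] by simp
  show "pd e2 x2 q = 0" using K[of 0 0 \<i> 0 \<i> 0] by simp
  show "pd e2 x1 q = - pd e1 x2 q" using K[of 0 0 1 0 \<i> 0] by simp
  show t: "pd ev t q = - pd eu s q" using K[of 0 1 0 1 0 0] \<open>pd ev s q = 0\<close> by simp
  show "pd e1 t q = 2 * pd eu x1 q - 4 * Re (\<phi> (pr q)) * pd e1 s q" using K[of 0 1 1 0 0 0] by simp
  show "pd e2 t q = 2 * pd eu x2 q - 4 * Re (\<phi> (pr q)) * pd e2 s q" using K[of 0 1 \<i> 0 0 0] by simp
  show "2 * Re (D1 \<phi> (pr q) * fst (X q) + D2 \<phi> (pr q) * of_real (s q)) + pd eu t q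
      + 4 * Re (\<phi> (pr q)) * pd eu s q = 0" using K[of 1 1 0 0 0 0] by simp
qed

lemma pd_cong:
  assumes "q \<in> V" "\<And>q. q \<in> V \<Longrightarrow> F q = G q" "smooth_on V G"
  shows "pd v F q = pd v G q"
  by (rule pd_eqI[OF assms(1,2) has_derivative_pd[OF assms(3,1)]])

lemma pd_const: "pd v (\<lambda>q. c) q = 0"
  unfolding pd_def by (simp add: frechet_derivative_const)

lemma pd_rules:
  fixes F G :: "point \<Rightarrow> real"
  assumes "q \<in> V" "smooth_on V F" "smooth_on V G"
  shows "pd v (\<lambda>q. F q + G q) q = pd v F q + pd v G q"
    "pd v (\<lambda>q. F q - G q) q = pd v F q - pd v G q"
    "pd v (\<lambda>q. F q * G q) q = F q * pd v G q + pd v F q * G q"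
  using pd_eqI[OF assms(1) refl has_derivative_add[OF has_derivative_pd has_derivative_pd]]
    pd_eqI[OF assms(1) refl has_derivative_diff[OF has_derivative_pd has_derivative_pd]]
    pd_eqI[OF assms(1) refl has_derivative_mult[OF has_derivative_pd has_derivative_pd]] assms
  by blast+

lemmas smooth_rules = smooth_comp smooth_pd smooth_on_add[OF open_V] smooth_on_diff[OF open_V]
  smooth_on_mult[OF open_V] smooth_on_const

text \<open>With \<zeta> = x + i y, \<open>F1\<close>, \<open>F2\<close> and \<open>F3\<close> are
  the derivatives of \<open>F0\<close> by x, y and u; hence the sign in \<open>F2\<close>.\<close>

definition "F0 q = Re (\<phi> (pr q))"
definition "F1 q = Re (D1 \<phi> (pr q))"
definition "F2 q = - Im (D1 \<phi> (pr q))"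
definition "F3 q = Re (D2 \<phi> (pr q))"

lemma smooth_pr:
  assumes "hol_smooth S H"
  shows "smooth_on V (\<lambda>q. Re (H (pr q)))" "smooth_on V (\<lambda>q. Im (H (pr q)))"
  using smooth_on_linear_comp[OF hol_smooth_smooth_on[OF assms] open_S open_V bounded_linear_pr V_S]
  by (auto intro: smooth_on_bounded_linear[OF open_V bounded_linear_Re]
      smooth_on_bounded_linear[OF open_V bounded_linear_Im])

lemma smooth_F: "smooth_on V F0" "smooth_on V F1" "smooth_on V F2" "smooth_on V F3"
  unfolding F0_def[abs_def] F1_def[abs_def] F2_def[abs_def] F3_def[abs_def]
  using smooth_pr[OF hol_f] smooth_pr[OF hol_smooth_partials(1)[OF open_S hol_f]]
    smooth_pr[OF hol_smooth_partials(2)[OF open_S hol_f]] smooth_on_minus[OF open_V] by blast+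

lemma pd_F:
  assumes "q \<in> V"
  shows "pd v F0 q = Re (D1 \<phi> (pr q) * fst v + D2 \<phi> (pr q) * of_real (fst (snd v)))"
    "pd v F1 q = Re (D1 (D1 \<phi>) (pr q) * fst v + D2 (D1 \<phi>) (pr q) * of_real (fst (snd v)))"
    "pd v F2 q = - Im (D1 (D1 \<phi>) (pr q) * fst v + D2 (D1 \<phi>) (pr q) * of_real (fst (snd v)))"
    "pd v F3 q = Re (D2 (D1 \<phi>) (pr q) * fst v + D2 (D2 \<phi>) (pr q) * of_real (fst (snd v)))"
  unfolding F0_def[abs_def] F1_def[abs_def] F2_def[abs_def] F3_def[abs_def]
  using pd_eqI[OF assms refl has_derivative_Re_pr[OF f_partials(1)[OF assms]]]
    pd_eqI[OF assms refl has_derivative_Re_pr[OF f_partials(2)[OF assms]]]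
    pd_eqI[OF assms refl has_derivative_minus[OF has_derivative_Im_pr[OF f_partials(2)[OF assms]]]]
    pd_eqI[OF assms refl has_derivative_Re_pr[OF f_partials(3)[OF assms]]]
  by simp_all

lemma killing_eqs':
  assumes "q \<in> V"
  shows "pd e1 t q = 2 * pd eu x1 q - 4 * (F0 q * pd e1 s q)"
    "pd e2 t q = 2 * pd eu x2 q - 4 * (F0 q * pd e2 s q)"
    "pd eu t q = (- 2) * (F1 q * x1 q + F2 q * x2 q + F3 q * s q) - 4 * (F0 q * pd eu s q)"
  using killing_eqs(8,9,10)[OF assms] by (simp_all add: F0_def F1_def F2_def F3_def x1_def x2_def)

section \<open>Prolongation: second derivatives of the Killing equations\<close>

text \<open>\<open>pd e1 x2\<close> is the rate at which X rotates the \<zeta> plane. Its v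
  derivative is, up to the factor 2, the mixed second derivative of s with one sign in one order and
  with the opposite sign in the other.\<close>

lemma rotation_const_space:
  assumes "q \<in> V"
  shows "pd ev (pd e1 x2) q = 0" "pd e1 (pd e1 x2) q = 0" "pd e2 (pd e1 x2) q = 0"
proof -
  note sm = smooth_comp smooth_pd
  have s: "pd v (pd e1 s) q = 2 * pd v (pd ev x1) q" "pd v (pd e2 s) q = 2 * pd v (pd ev x2) q" for v
    by (rule pd_scale[OF assms]; simp add: killing_eqs sm)+
  have "pd e2 (pd ev x1) q = pd ev (pd e2 x1) q" "pd e1 (pd ev x2) q = pd ev (pd e1 x2) q"
    "pd e2 (pd e1 s) q = pd e1 (pd e2 s) q"
    by (rule pd_commute[OF _ assms], simp add: sm)+
  moreover have r: "pd v (pd e2 x1) q = - 1 * pd v (pd e1 x2) q" for v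
    by (rule pd_scale[OF assms]) (simp_all add: killing_eqs sm)
  ultimately show "pd ev (pd e1 x2) q = 0" using s[of e2] s[of e1] by simp
  have "pd e1 (pd e2 x1) q = pd e2 (pd e1 x1) q"
    by (rule pd_commute[OF _ assms], simp add: sm)
  also have "\<dots> = 0" by (rule pd_zero[OF assms killing_eqs(4)])
  finally show "pd e1 (pd e1 x2) q = 0" using r[of e1] by simp
  have "pd e2 (pd e1 x2) q = pd e1 (pd e2 x2) q"
    by (rule pd_commute[OF _ assms], simp add: sm)
  also have "\<dots> = 0" by (rule pd_zero[OF assms killing_eqs(5)])
  finally show "pd e2 (pd e1 x2) q = 0" .
qed

lemma grad_s_const_space:
  assumes "q \<in> V"
  shows "pd e1 (pd e1 s) q = 0" "pd e2 (pd e1 s) q = 0" "pd ev (pd e1 s) q = 0"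
    "pd e1 (pd e2 s) q = 0" "pd e2 (pd e2 s) q = 0" "pd ev (pd e2 s) q = 0"
proof -
  note sm = smooth_comp smooth_pd
  have s: "pd v (pd e1 s) q = 2 * pd v (pd ev x1) q" "pd v (pd e2 s) q = 2 * pd v (pd ev x2) q" for v
    by (rule pd_scale[OF assms]; simp add: killing_eqs sm)+
  have c: "pd v (pd ev x1) q = pd ev (pd v x1) q" "pd v (pd ev x2) q = pd ev (pd v x2) q" for v
    by (rule pd_commute[OF _ assms], simp add: sm)+
  have z: "pd v (pd e1 x1) q = 0" "pd v (pd e2 x2) q = 0" "pd v (pd ev s) q = 0" for v
    by (rule pd_zero[OF assms], simp add: killing_eqs)+
  show "pd e1 (pd e1 s) q = 0" "pd e2 (pd e2 s) q = 0"
    unfolding s c z by simp_all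
  show "pd e1 (pd e2 s) q = 0" unfolding s c rotation_const_space(1)[OF assms] by simp
  then show "pd e2 (pd e1 s) q = 0" using pd_commute[OF smooth_comp(3) assms, of e2 e1] by simp
  show "pd ev (pd e1 s) q = 0" "pd ev (pd e2 s) q = 0"
    using pd_commute[OF smooth_comp(3) assms, of ev e1] pd_commute[OF smooth_comp(3) assms, of ev e2] z(3)
    by simp_all
qed

text \<open>Differentiating t by v and a \<zeta> direction in the two orders gives the same mixed
  derivative of s with opposite signs.\<close>

lemma grad_s_const_u:
  assumes "q \<in> V"
  shows "pd eu (pd e1 s) q = 0" "pd eu (pd e2 s) q = 0"
proof -
  have *: "pd eu (pd v s) q = 0"
    if y: "smooth_on V y" and t: "\<And>q. q \<in> V \<Longrightarrow> pd v t q = 2 * pd eu y q - 4 * (F0 q * pd v s q)"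
      and s: "\<And>q. q \<in> V \<Longrightarrow> pd v s q = 2 * pd ev y q" and sv: "pd ev (pd v s) q = 0" for v y
  proof -
    have "pd ev (pd v t) q = pd v (pd ev t) q"
      by (rule pd_commute[OF smooth_comp(4) assms])
    also have "\<dots> = - 1 * pd v (pd eu s) q"
      by (rule pd_scale[OF assms]) (simp_all add: killing_eqs smooth_rules)
    finally have 1: "pd ev (pd v t) q = - pd eu (pd v s) q"
      using pd_commute[OF smooth_comp(3) assms, of v eu] by simp
    have "pd ev (pd v t) q = pd ev (\<lambda>q. 2 * pd eu y q - 4 * (F0 q * pd v s q)) q"
      by (rule pd_cong[OF assms t]) (simp_all add: smooth_rules smooth_F y)
    also have "\<dots> = 2 * pd ev (pd eu y) q - 4 * (F0 q * pd ev (pd v s) q + pd ev F0 q * pd v s q)"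
      using assms by (simp add: pd_rules pd_const smooth_rules smooth_F y)
    also have "\<dots> = 2 * pd ev (pd eu y) q"
      using sv assms by (simp add: pd_F)
    also have "pd ev (pd eu y) q = pd eu (pd ev y) q"
      by (rule pd_commute[OF y assms])
    also have "2 * pd eu (pd ev y) q = pd eu (pd v s) q"
      by (rule pd_scale[OF assms s, symmetric]) (simp_all add: smooth_rules y)
    finally show ?thesis using 1 by simp
  qed
  show "pd eu (pd e1 s) q = 0" "pd eu (pd e2 s) q = 0"
    using *[OF smooth_comp(1) killing_eqs'(1) killing_eqs(2) grad_s_const_space(3)[OF assms]]
      *[OF smooth_comp(2) killing_eqs'(2) killing_eqs(3) grad_s_const_space(6)[OF assms]] by auto
qed

text \<open>Integrability of the two \<zeta> derivatives of t: the u derivative of the antisymmetric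
  gradient of (x1, x2) must balance the terms coming from the gradient of s.\<close>

lemma rotation_du:
  assumes "q \<in> V"
  shows "pd eu (pd e1 x2) q = F1 q * pd e2 s q - F2 q * pd e1 s q"
proof -
  have *: "pd w (pd v t) q = 2 * pd w (pd eu y) q - 4 * (F0 q * pd w (pd v s) q + pd w F0 q * pd v s q)"
    if y: "smooth_on V y" and t: "\<And>q. q \<in> V \<Longrightarrow> pd v t q = 2 * pd eu y q - 4 * (F0 q * pd v s q)"
    for v w y
  proof -
    have "pd w (pd v t) q = pd w (\<lambda>q. 2 * pd eu y q - 4 * (F0 q * pd v s q)) q"
      by (rule pd_cong[OF assms t]) (simp_all add: smooth_rules smooth_F y)
    then show ?thesis
      using assms by (simp add: pd_rules pd_const smooth_rules smooth_F y)
  qed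
  have "pd e2 (pd eu x1) q = pd eu (pd e2 x1) q" "pd e1 (pd eu x2) q = pd eu (pd e1 x2) q"
    "pd e1 (pd e2 t) q = pd e2 (pd e1 t) q"
    by (rule pd_commute[OF _ assms], simp add: smooth_rules)+
  moreover have "pd eu (pd e2 x1) q = - 1 * pd eu (pd e1 x2) q"
    by (rule pd_scale[OF assms]) (simp_all add: killing_eqs smooth_rules)
  ultimately show ?thesis
    using *[OF smooth_comp(1) killing_eqs'(1), of e2] *[OF smooth_comp(2) killing_eqs'(2), of e1]
      grad_s_const_space[OF assms] assms by (simp add: pd_F F1_def F2_def algebra_simps)
qed

text \<open>Differentiating \<open>rotation_du\<close> along \<open>e1\<close> and \<open>e2\<close>
  leaves a homogeneous linear system for the gradient of s, because the rotation rate and that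
  gradient are constant in \<zeta>. Its determinant is, up to sign, |f_\<zeta>\<zeta>|^2.\<close>

lemma grad_s_zero:
  assumes "q \<in> V"
  shows "pd e1 s q = 0" "pd e2 s q = 0"
proof -
  define c where "c = D1 (D1 \<phi>) (pr q)"
  have *: "pd eu (pd w (pd e1 x2)) q = F1 q * pd w (pd e2 s) q + pd w F1 q * pd e2 s q
      - (F2 q * pd w (pd e1 s) q + pd w F2 q * pd e1 s q)" for w
  proof -
    have "pd eu (pd w (pd e1 x2)) q = pd w (pd eu (pd e1 x2)) q"
      by (rule pd_commute[OF _ assms]) (simp add: smooth_rules)
    also have "\<dots> = pd w (\<lambda>q. F1 q * pd e2 s q - F2 q * pd e1 s q) q"
      by (rule pd_cong[OF assms rotation_du]) (simp_all add: smooth_rules smooth_F)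
    finally show ?thesis
      using assms by (simp add: pd_rules pd_const smooth_rules smooth_F)
  qed
  have "pd eu (pd e1 (pd e1 x2)) q = 0" "pd eu (pd e2 (pd e1 x2)) q = 0"
    by (rule pd_zero[OF assms], simp add: rotation_const_space)+
  then have 1: "Re c * pd e2 s q + Im c * pd e1 s q = 0" and 2: "Re c * pd e1 s q - Im c * pd e2 s q = 0"
    using *[of e1] *[of e2] grad_s_const_space[OF assms] assms
    by (simp_all add: pd_F flip: c_def)
  have "c \<noteq> 0" using f11_nz[OF V_S[OF assms]] by (simp add: c_def)
  then have nz: "Re c * Re c + Im c * Im c \<noteq> 0"
    by (simp add: complex_eq_iff sum_squares_eq_zero_iff)
  have "(Re c * Re c + Im c * Im c) * pd e1 s q = Re c * (Re c * pd e1 s q - Im c * pd e2 s q)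
      + Im c * (Re c * pd e2 s q + Im c * pd e1 s q)"
    "(Re c * Re c + Im c * Im c) * pd e2 s q = Re c * (Re c * pd e2 s q + Im c * pd e1 s q)
      - Im c * (Re c * pd e1 s q - Im c * pd e2 s q)"
    by (simp_all add: algebra_simps)
  then show "pd e1 s q = 0" "pd e2 s q = 0" using nz unfolding 1 2 by auto
qed

lemma x_dv: assumes "q \<in> V" shows "pd ev x1 q = 0" "pd ev x2 q = 0"
  using killing_eqs(2,3)[OF assms] grad_s_zero[OF assms] by simp_all

lemma pd_pd_eu_t:
  assumes "q \<in> V"
  shows "pd w (pd eu t) q = (- 2) * (F1 q * pd w x1 q + pd w F1 q * x1 q + (F2 q * pd w x2 q + pd w F2 q * x2 q)
      + (F3 q * pd w s q + pd w F3 q * s q)) - 4 * (F0 q * pd w (pd eu s) q + pd w F0 q * pd eu s q)"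
proof -
  define c :: real where "c = - 2"
  have "pd w (pd eu t) q = pd w (\<lambda>q. c * (F1 q * x1 q + F2 q * x2 q + F3 q * s q) - 4 * (F0 q * pd eu s q)) q"
    by (rule pd_cong[OF assms]) (simp_all add: killing_eqs'(3) c_def[symmetric] smooth_rules smooth_F)
  also have "\<dots> = c * (F1 q * pd w x1 q + pd w F1 q * x1 q + (F2 q * pd w x2 q + pd w F2 q * x2 q)
      + (F3 q * pd w s q + pd w F3 q * s q)) - 4 * (F0 q * pd w (pd eu s) q + pd w F0 q * pd eu s q)"
    using assms by (simp add: pd_rules pd_const smooth_rules smooth_F)
  finally show ?thesis unfolding c_def .
qed

lemma pd_basis:
  assumes "q \<in> V" "smooth_on V F"
  shows "pd v F q = Re (fst v) *\<^sub>R pd e1 F q + Im (fst v) *\<^sub>R pd e2 F q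
    + fst (snd v) *\<^sub>R pd eu F q + snd (snd v) *\<^sub>R pd ev F q"
proof -
  have lin: "linear (\<lambda>v. pd v F q)"
    by (rule has_derivative_linear[OF has_derivative_pd[OF assms(2,1)]])
  have "v = Re (fst v) *\<^sub>R e1 + Im (fst v) *\<^sub>R e2 + fst (snd v) *\<^sub>R eu + snd (snd v) *\<^sub>R ev"
    by (cases v) (simp add: complex_eq_iff)
  then have "pd v F q = pd (Re (fst v) *\<^sub>R e1 + Im (fst v) *\<^sub>R e2 + fst (snd v) *\<^sub>R eu
      + snd (snd v) *\<^sub>R ev) F q"
    by simp
  then show ?thesis
    unfolding linear_add[OF lin] linear_scale[OF lin] .
qed

lemma pd_const_on:
  fixes F :: "point \<Rightarrow> real"
  assumes "convex V" "smooth_on V F" "\<And>q v. q \<in> V \<Longrightarrow> pd v F q = 0"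
  shows "\<exists>c. \<forall>q\<in>V. F q = c"
  using has_derivative_pd[OF assms(2)] assms(3)
  by (intro has_derivative_zero_constant[OF assms(1)]) (simp add: has_derivative_at_withinI)

lemma rotation_const:
  assumes "q \<in> V"
  shows "pd v (pd e1 x2) q = 0"
  using pd_basis[OF assms smooth_pd[OF smooth_comp(2)], of v e1] rotation_const_space[OF assms]
    rotation_du[OF assms] grad_s_zero[OF assms] by simp

text \<open>The v derivative of t is - s_u, whereas every other term of the uu equation is
  independent of v; comparing the mixed derivatives of t gives s_uu = 0.\<close>

lemma s_du_const:
  assumes "q \<in> V"
  shows "pd v (pd eu s) q = 0"
proof -
  have 0: "pd e1 (pd eu s) q = 0" "pd e2 (pd eu s) q = 0" "pd ev (pd eu s) q = 0"
    using pd_commute[OF smooth_comp(3) assms, of e1 eu] pd_commute[OF smooth_comp(3) assms, of e2 eu]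
      pd_commute[OF smooth_comp(3) assms, of ev eu] pd_zero[OF assms killing_eqs(1)]
      grad_s_const_u[OF assms] by simp_all
  have "pd ev (pd eu t) q = pd eu (pd ev t) q"
    by (rule pd_commute[OF smooth_comp(4) assms])
  also have "\<dots> = - 1 * pd eu (pd eu s) q"
    by (rule pd_scale[OF assms]) (simp_all add: killing_eqs smooth_rules)
  finally have 1: "pd eu (pd eu s) q = 0"
    using pd_pd_eu_t[OF assms, of ev] x_dv[OF assms] killing_eqs(1)[OF assms] 0 assms by (simp add: pd_F)
  show ?thesis
    using pd_basis[OF assms smooth_pd[OF smooth_comp(3)], of v eu] 0 1 by simp
qed

section \<open>Integrated form with one complex component along \<zeta>\<close>

definition "xc q = fst (X q)"

lemma smooth_xc: "smooth_on V xc"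
  unfolding xc_def[abs_def] by (rule smooth_on_bounded_linear[OF open_V bounded_linear_fst smooth_X])

lemma pd_Re_Im:
  assumes "q \<in> V" "smooth_on V F"
  shows "pd v (\<lambda>q. Re (F q)) q = Re (pd v F q)" "pd v (\<lambda>q. Im (F q)) q = Im (pd v F q)"
  using pd_eqI[OF assms(1) refl has_derivative_Re[OF has_derivative_pd[OF assms(2,1)]]]
    pd_eqI[OF assms(1) refl has_derivative_Im[OF has_derivative_pd[OF assms(2,1)]]] by simp_all

lemma pd_xc:
  assumes "q \<in> V"
  shows "pd v xc q = Complex (pd v x1 q) (pd v x2 q)"
  using pd_Re_Im[OF assms smooth_xc] by (simp add: complex_eq_iff xc_def x1_def[abs_def] x2_def[abs_def])

lemma pd_pd_xc:
  assumes "q \<in> V"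
  shows "pd v (pd w xc) q = Complex (pd v (pd w x1) q) (pd v (pd w x2) q)"
proof -
  have "pd v (\<lambda>q. Re (pd w xc q)) q = pd v (pd w x1) q" "pd v (\<lambda>q. Im (pd w xc q)) q = pd v (pd w x2) q"
    by (rule pd_cong[OF assms]; simp add: pd_xc smooth_rules)+
  then show ?thesis
    using pd_Re_Im[OF assms smooth_pd[OF smooth_xc]] by (simp add: complex_eq_iff)
qed

lemma pd_pd_pd_xc:
  assumes "q \<in> V"
  shows "pd v (pd w (pd y xc)) q = Complex (pd v (pd w (pd y x1)) q) (pd v (pd w (pd y x2)) q)"
proof -
  have "pd v (\<lambda>q. Re (pd w (pd y xc) q)) q = pd v (pd w (pd y x1)) q"
    "pd v (\<lambda>q. Im (pd w (pd y xc) q)) q = pd v (pd w (pd y x2)) q"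
    by (rule pd_cong[OF assms]; simp add: pd_pd_xc smooth_rules)+
  then show ?thesis
    using pd_Re_Im[OF assms smooth_pd[OF smooth_pd[OF smooth_xc]]] by (simp add: complex_eq_iff)
qed

text \<open>The \<zeta> gradient of x is the constant rotation and its v derivative is zero, so
  differentiating by u first leaves nothing.\<close>

lemma x_du_const_space:
  assumes "q \<in> V" "v \<in> {e1, e2, ev}" "y \<in> {x1, x2}"
  shows "pd v (pd eu y) q = 0" "pd v (pd eu (pd eu y)) q = 0"
proof -
  have y: "smooth_on V y" using assms(3) smooth_comp by auto
  have 0: "pd eu (pd v y) q = 0" if "q \<in> V" for q
  proof -
    have "pd eu (pd e2 x1) q = - 1 * pd eu (pd e1 x2) q"
      by (rule pd_scale[OF that]) (simp_all add: killing_eqs smooth_rules)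
    then show ?thesis
      using assms(2,3) rotation_const[OF that, of eu] pd_zero[where v = eu, OF that killing_eqs(4)]
        pd_zero[where v = eu, OF that killing_eqs(5)] pd_zero[where v = eu, OF that x_dv(1)]
        pd_zero[where v = eu, OF that x_dv(2)] by auto
  qed
  show *: "pd v (pd eu y) q = 0" using 0[OF assms(1)] pd_commute[OF y assms(1), of v eu] by simp
  have "pd v (pd eu (pd eu y)) q = pd eu (pd v (pd eu y)) q"
    by (rule pd_commute[OF smooth_pd[OF y] assms(1)])
  also have "\<dots> = 0"
    using 0 pd_commute[OF y, of _ v eu] by (intro pd_zero[OF assms(1)]) simp
  finally show "pd v (pd eu (pd eu y)) q = 0" .
qed

text \<open>The uu equation differentiated along \<zeta>. Since the \<zeta> gradient of t is 2 x_u,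
  the mixed derivatives of t turn into x_uu; passing from real gradients to one complex equation
  conjugates it.\<close>

lemma killing_f1:
  assumes "q \<in> V"
  shows "D1 (D1 \<phi>) (pr q) * xc q + (\<i> * of_real (pd e1 x2 q) + 2 * of_real (pd eu s q)) * D1 \<phi> (pr q)
    + D2 (D1 \<phi>) (pr q) * of_real (s q) + cnj (pd eu (pd eu xc) q) = 0"
proof -
  have *: "pd w (pd eu t) q = 2 * pd eu (pd eu y) q"
    if "smooth_on V y" "\<And>q. q \<in> V \<Longrightarrow> pd w t q = 2 * pd eu y q" for w y
  proof -
    have "pd w (pd eu t) q = pd eu (pd w t) q"
      by (rule pd_commute[OF smooth_comp(4) assms])
    also have "\<dots> = 2 * pd eu (pd eu y) q"
      by (rule pd_scale[OF assms that(2)]) (simp_all add: that smooth_rules)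
    finally show ?thesis .
  qed
  have "pd e1 (pd eu t) q = 2 * pd eu (pd eu x1) q" "pd e2 (pd eu t) q = 2 * pd eu (pd eu x2) q"
    by (rule *; simp add: smooth_comp killing_eqs'(1,2) grad_s_zero)+
  then show ?thesis
    using pd_pd_eu_t[OF assms, of e1] pd_pd_eu_t[OF assms, of e2] grad_s_zero[OF assms]
      killing_eqs(4-6)[OF assms] s_du_const[OF assms] assms
    by (simp add: complex_eq_iff pd_F pd_pd_xc xc_def x1_def x2_def F1_def F2_def algebra_simps)
qed

text \<open>Convexity turns vanishing derivatives into constants. The last equation says X
  f_\<zeta>\<zeta> = - 2 (\<sigma> + i \<theta>) f_\<zeta>\<zeta> and is what determines x from s,
  \<sigma> and \<theta>.\<close>

lemma killing_structure:
  assumes "convex V"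
  obtains \<theta> \<sigma> :: real where
    "\<And>q. q \<in> V \<Longrightarrow> (xc has_derivative
      (\<lambda>v. \<i> * of_real \<theta> * fst v + pd eu xc q * of_real (fst (snd v)))) (at q)"
    "\<And>q. q \<in> V \<Longrightarrow> (pd eu xc has_derivative
      (\<lambda>v. pd eu (pd eu xc) q * of_real (fst (snd v)))) (at q)"
    "\<And>q. q \<in> V \<Longrightarrow> (s has_derivative (\<lambda>v. \<sigma> * fst (snd v))) (at q)"
    "\<And>q. q \<in> V \<Longrightarrow> D1 (D1 \<phi>) (pr q) * xc q + (\<i> * of_real \<theta> + 2 * of_real \<sigma>) * D1 \<phi> (pr q)
      + D2 (D1 \<phi>) (pr q) * of_real (s q) + cnj (pd eu (pd eu xc) q) = 0"
    "\<And>q. q \<in> V \<Longrightarrow> D1 (D1 (D1 \<phi>)) (pr q) * xc q + 2 * (\<i> * of_real \<theta> + of_real \<sigma>) * D1 (D1 \<phi>) (pr q)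
      + D2 (D1 (D1 \<phi>)) (pr q) * of_real (s q) = 0"
proof -
  obtain \<theta> where \<theta>: "\<And>q. q \<in> V \<Longrightarrow> pd e1 x2 q = \<theta>"
    using pd_const_on[OF assms smooth_pd[OF smooth_comp(2)] rotation_const] by blast
  obtain \<sigma> where \<sigma>: "\<And>q. q \<in> V \<Longrightarrow> pd eu s q = \<sigma>"
    using pd_const_on[OF assms smooth_pd[OF smooth_comp(3)] s_du_const] by blast
  have x: "(xc has_derivative (\<lambda>v. \<i> * of_real \<theta> * fst v + pd eu xc q * of_real (fst (snd v)))) (at q)"
    if "q \<in> V" for q
  proof -
    have "(\<lambda>v. pd v xc q) = (\<lambda>v. \<i> * of_real \<theta> * fst v + pd eu xc q * of_real (fst (snd v)))"
    proof
      fix v show "pd v xc q = \<i> * of_real \<theta> * fst v + pd eu xc q * of_real (fst (snd v))"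
      using pd_basis[OF that smooth_comp(1), of v] pd_basis[OF that smooth_comp(2), of v]
        killing_eqs(4-6)[OF that] x_dv[OF that] \<theta>[OF that] that
        by (simp add: complex_eq_iff pd_xc)
    qed
    then show ?thesis using has_derivative_pd[OF smooth_xc that] by (simp only:)
  qed
  have xu: "(F has_derivative (\<lambda>v. pd eu F q * of_real (fst (snd v)))) (at q)"
    if "q \<in> V" "smooth_on V F" "\<And>v. v \<in> {e1, e2, ev} \<Longrightarrow> pd v F q = 0" for q and F :: "point \<Rightarrow> complex"
  proof -
    have "(\<lambda>v. pd v F q) = (\<lambda>v. pd eu F q * of_real (fst (snd v)))"
    proof
      fix v show "pd v F q = pd eu F q * of_real (fst (snd v))"
        using pd_basis[OF that(1,2), of v] that(3) by (simp add: scaleR_conv_of_real)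
    qed
    then show ?thesis using has_derivative_pd[OF that(2,1)] by (simp only:)
  qed
  have star: "D1 (D1 \<phi>) (pr q) * xc q + (\<i> * of_real \<theta> + 2 * of_real \<sigma>) * D1 \<phi> (pr q)
      + D2 (D1 \<phi>) (pr q) * of_real (s q) + cnj (pd eu (pd eu xc) q) = 0" if "q \<in> V" for q
    using killing_f1[OF that] \<theta>[OF that] \<sigma>[OF that] by simp
  have s: "(s has_derivative (\<lambda>v. \<sigma> * fst (snd v))) (at q)" if "q \<in> V" for q
  proof -
    have "pd v s q = \<sigma> * fst (snd v)" for v
      using pd_basis[OF that smooth_comp(3), of v] grad_s_zero[OF that] killing_eqs(1)[OF that] \<sigma>[OF that]
      by simp
    then show ?thesis using has_derivative_pd[OF smooth_comp(3) that] by simp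
  qed
  have xuu: "(pd eu (pd eu xc) has_derivative (\<lambda>v. pd eu (pd eu (pd eu xc)) q * of_real (fst (snd v)))) (at q)"
    if "q \<in> V" for q
    using that x_du_const_space(2)[OF that] by (intro xu) (auto simp: pd_pd_pd_xc smooth_xc smooth_rules complex_eq_iff)
  note hp = hol_smooth_has_partials[OF _ V_S]
    and h1 = hol_smooth_partials(1)[OF open_S hol_f]
  \<comment> \<open>The derivative of \<open>star\<close> along \<open>e1\<close>; the term with
    x_uu drops out because it varies with u alone.\<close>
  have star': "D1 (D1 (D1 \<phi>)) (pr q) * xc q + 2 * (\<i> * of_real \<theta> + of_real \<sigma>) * D1 (D1 \<phi>) (pr q)
      + D2 (D1 (D1 \<phi>)) (pr q) * of_real (s q) = 0" if "q \<in> V" for q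
  proof -
    have comm: "D1 (D2 (D1 \<phi>)) (pr q) = D2 (D1 (D1 \<phi>)) (pr q)"
      by (rule hol_smooth_partials(3)[OF open_S h1 V_S[OF that]])
    have zero: "pd e1 (\<lambda>q. D1 (D1 \<phi>) (pr q) * xc q + (\<i> * of_real \<theta> + 2 * of_real \<sigma>) * D1 \<phi> (pr q)
      + D2 (D1 \<phi>) (pr q) * of_real (s q) + cnj (pd eu (pd eu xc) q)) q = 0"
      by (rule pd_zero[OF that star])
    have "((\<lambda>q. D1 (D1 \<phi>) (pr q) * xc q + (\<i> * of_real \<theta> + 2 * of_real \<sigma>) * D1 \<phi> (pr q)
      + D2 (D1 \<phi>) (pr q) * of_real (s q) + cnj (pd eu (pd eu xc) q)) has_derivative
      (\<lambda>v. (D1 (D1 \<phi>) (pr q) * (\<i> * of_real \<theta> * fst v + pd eu xc q * of_real (fst (snd v)))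
          + (D1 (D1 (D1 \<phi>)) (pr q) * fst v + D2 (D1 (D1 \<phi>)) (pr q) * of_real (fst (snd v))) * xc q)
        + (\<i> * of_real \<theta> + 2 * of_real \<sigma>) * (D1 (D1 \<phi>) (pr q) * fst v + D2 (D1 \<phi>) (pr q) * of_real (fst (snd v)))
        + (D2 (D1 \<phi>) (pr q) * of_real (\<sigma> * fst (snd v))
          + (D1 (D2 (D1 \<phi>)) (pr q) * fst v + D2 (D2 (D1 \<phi>)) (pr q) * of_real (fst (snd v))) * of_real (s q))
        + cnj (pd eu (pd eu (pd eu xc)) q * of_real (fst (snd v))))) (at q)"
      by (intro has_derivative_add has_derivative_mult has_derivative_mult_right has_derivative_cnj
          has_derivative_of_real s x xuu that has_derivative_pr hp hol_smooth_partials[OF open_S] hol_f)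
    from pd_eqI[OF that refl this, of e1]
    have "D1 (D1 \<phi>) (pr q) * (\<i> * of_real \<theta>) + D1 (D1 (D1 \<phi>)) (pr q) * xc q
        + (\<i> * of_real \<theta> + 2 * of_real \<sigma>) * D1 (D1 \<phi>) (pr q)
        + D1 (D2 (D1 \<phi>)) (pr q) * of_real (s q) = 0"
      unfolding zero by simp
    then show ?thesis unfolding comm by (simp add: algebra_simps)
  qed
  have xu': "(pd eu xc has_derivative (\<lambda>v. pd eu (pd eu xc) q * of_real (fst (snd v)))) (at q)"
    if "q \<in> V" for q
    using that x_du_const_space(1)[OF that] by (intro xu) (auto simp: pd_pd_xc smooth_xc smooth_rules complex_eq_iff)
  show ?thesis by (rule that[OF x xu' s star star'])
qed

lemma killing_vertical:
  assumes "convex V" "\<And>q. q \<in> V \<Longrightarrow> fst (X q) = 0" "\<And>q. q \<in> V \<Longrightarrow> s q = 0"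
  shows "\<exists>c. \<forall>q\<in>V. X q = (0, 0, c)"
proof -
  have 0: "pd v x1 q = 0" "pd v x2 q = 0" "pd v s q = 0" if "q \<in> V" for v q
    by (rule pd_zero[OF that], simp add: x1_def x2_def assms)+
  have "pd v t q = 0" if "q \<in> V" for v q
    using pd_basis[OF that smooth_comp(4), of v] 0[OF that] killing_eqs'[OF that] killing_eqs(7)[OF that]
      assms that by (simp add: x1_def x2_def)
  then obtain c where "\<forall>q\<in>V. t q = c"
    using pd_const_on[OF assms(1) smooth_comp(4)] by blast
  then show ?thesis
    using assms(2,3) by (intro exI[of _ c]) (auto simp: s_def t_def prod_eq_iff)
qed

end

section \<open>One-forms in terms of \<open>da\<close>, \<open>da*\<close> and \<open>du\<close>\<close>

text \<open>The form \<open>da = (d\<zeta> - Z\<^sub>u du) / Z\<^sub>a\<close>, with \<open>e\<close> and \<open>w\<close> the values of \<open>Z\<^sub>a\<close> and \<open>Z\<^sub>u\<close>.\<close>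

definition da :: "complex \<Rightarrow> complex \<Rightarrow> tangent \<Rightarrow> complex" where
  "da e w v = (fst v - w * of_real (fst (snd v))) / e"

text \<open>A dv component is not provided for, because all functions differentiated here are
  independent of v.\<close>

definition coform :: "complex \<Rightarrow> complex \<Rightarrow> complex \<Rightarrow> complex \<Rightarrow> complex \<Rightarrow> form" where
  "coform e w p1 p2 p3 = (\<lambda>v. p1 * da e w v + p2 * cnj (da e w v) + p3 * of_real (fst (snd v)))"

definition has_coform ::
  "complex \<Rightarrow> complex \<Rightarrow> (point \<Rightarrow> complex) \<Rightarrow> point \<Rightarrow> complex \<Rightarrow> complex \<Rightarrow> complex \<Rightarrow> bool" where
  "has_coform e w Q q p1 p2 p3 \<longleftrightarrow> (Q has_derivative coform e w p1 p2 p3) (at q)"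

lemma has_coform_ext_d: "has_coform e w Q q p1 p2 p3 \<Longrightarrow> ext_d Q q = coform e w p1 p2 p3"
  unfolding has_coform_def by (metis frechet_derivative_at)

lemma has_coform_eq:
  "has_coform e w Q q p1 p2 p3 \<Longrightarrow> p1 = r1 \<Longrightarrow> p2 = r2 \<Longrightarrow> p3 = r3 \<Longrightarrow> has_coform e w Q q r1 r2 r3"
  by simp

lemma has_coform_cong:
  assumes "has_coform e w F q p1 p2 p3" "open V" "q \<in> V" "\<And>q. q \<in> V \<Longrightarrow> F q = G q"
  shows "has_coform e w G q p1 p2 p3"
  using has_derivative_transform_within_open[OF assms(1)[unfolded has_coform_def] assms(2,3)] assms(4)
  unfolding has_coform_def by blast

text \<open>Substitute d\<zeta> = e da + w du; holomorphy in \<zeta> leaves no component along the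
  conjugate of da.\<close>

lemma has_coform_pr:
  assumes "has_partials H (pr q) h1 h2" "e \<noteq> 0"
  shows "has_coform e w (\<lambda>q. H (pr q)) q (e * h1) 0 (h2 + w * h1)"
proof -
  have "coform e w (e * h1) 0 (h2 + w * h1) = (\<lambda>v. h1 * fst v + h2 * of_real (fst (snd v)))"
    using assms(2) by (auto simp: coform_def da_def field_simps)
  then show ?thesis
    using has_derivative_pr[OF assms(1)] unfolding has_coform_def by simp
qed

lemma has_coform_cnj:
  assumes "has_coform e w F q p1 p2 p3"
  shows "has_coform e w (\<lambda>q. cnj (F q)) q (cnj p2) (cnj p1) (cnj p3)"
proof -
  have "coform e w (cnj p2) (cnj p1) (cnj p3) = (\<lambda>v. cnj (coform e w p1 p2 p3 v))"
    by (auto simp: coform_def)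
  then show ?thesis
    using has_derivative_cnj[OF assms[unfolded has_coform_def]] unfolding has_coform_def by simp
qed

lemma has_coform_add:
  assumes "has_coform e w F q p1 p2 p3" "has_coform e w G q r1 r2 r3"
  shows "has_coform e w (\<lambda>q. F q + G q) q (p1 + r1) (p2 + r2) (p3 + r3)"
proof -
  have "coform e w (p1 + r1) (p2 + r2) (p3 + r3) = (\<lambda>v. coform e w p1 p2 p3 v + coform e w r1 r2 r3 v)"
    by (auto simp: coform_def algebra_simps)
  then show ?thesis
    using has_derivative_add[OF assms[unfolded has_coform_def]] unfolding has_coform_def by simp
qed

lemma has_coform_diff:
  assumes "has_coform e w F q p1 p2 p3" "has_coform e w G q r1 r2 r3"
  shows "has_coform e w (\<lambda>q. F q - G q) q (p1 - r1) (p2 - r2) (p3 - r3)"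
proof -
  have "coform e w (p1 - r1) (p2 - r2) (p3 - r3) = (\<lambda>v. coform e w p1 p2 p3 v - coform e w r1 r2 r3 v)"
    by (auto simp: coform_def algebra_simps)
  then show ?thesis
    using has_derivative_diff[OF assms[unfolded has_coform_def]] unfolding has_coform_def by simp
qed

lemma has_coform_mult:
  assumes "has_coform e w F q p1 p2 p3" "has_coform e w G q r1 r2 r3"
  shows "has_coform e w (\<lambda>q. F q * G q) q (F q * r1 + p1 * G q) (F q * r2 + p2 * G q) (F q * r3 + p3 * G q)"
proof -
  have "coform e w (F q * r1 + p1 * G q) (F q * r2 + p2 * G q) (F q * r3 + p3 * G q) =
      (\<lambda>v. F q * coform e w r1 r2 r3 v + coform e w p1 p2 p3 v * G q)"
    by (auto simp: coform_def algebra_simps)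
  then show ?thesis
    using has_derivative_mult[OF assms[unfolded has_coform_def]] unfolding has_coform_def by simp
qed

lemma has_coform_const: "has_coform e w (\<lambda>q. c) q 0 0 0"
proof -
  have "coform e w 0 0 0 = (\<lambda>v. 0)" by (auto simp: coform_def)
  then show ?thesis unfolding has_coform_def by simp
qed

lemma has_coform_cmult:
  assumes "has_coform e w F q p1 p2 p3"
  shows "has_coform e w (\<lambda>q. c * F q) q (c * p1) (c * p2) (c * p3)"
  using has_coform_mult[OF has_coform_const assms] by simp

lemma has_coform_exp:
  assumes "has_coform e w F q p1 p2 p3"
  shows "has_coform e w (\<lambda>q. exp (F q)) q (exp (F q) * p1) (exp (F q) * p2) (exp (F q) * p3)"
proof -
  have "(exp has_derivative (\<lambda>h. exp (F q) * h)) (at (F q))"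
    using DERIV_exp[of "F q"] by (simp add: has_field_derivative_def)
  from has_derivative_compose[OF assms[unfolded has_coform_def] this]
  have "((\<lambda>q. exp (F q)) has_derivative (\<lambda>v. exp (F q) * coform e w p1 p2 p3 v)) (at q)" .
  moreover have "coform e w (exp (F q) * p1) (exp (F q) * p2) (exp (F q) * p3) =
      (\<lambda>v. exp (F q) * coform e w p1 p2 p3 v)"
    by (auto simp: coform_def algebra_simps)
  ultimately show ?thesis unfolding has_coform_def by simp
qed

text \<open>The second vector is the derivative by u at fixed a, up to a vertical part k that
  coforms do not see; \<Delta> is proportional to such a vector.\<close>

lemma coform_frame:
  assumes "e \<noteq> 0"
  shows "coform e w p1 p2 p3 (e * h, 0, 0) = p1 * h + p2 * cnj h"
    "coform e w p1 p2 p3 (w, 1, k) = p3"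
  using assms by (simp_all add: coform_def da_def)

text \<open>The three basic forms are independent, so all 2 by 2 minors must vanish. Real vectors
  only reveal p1 + p2 and i (p1 - p2), from which the minors are recombined.\<close>

lemma wedge2_coform_iff:
  assumes "e \<noteq> 0"
  shows "wedge2 (coform e w p1 p2 p3) (coform e w r1 r2 r3) = (\<lambda>X Y. 0) \<longleftrightarrow>
    p1 * r2 = p2 * r1 \<and> p1 * r3 = p3 * r1 \<and> p2 * r3 = p3 * r2" (is "?W = _ \<longleftrightarrow> _")
proof
  assume *: "?W = (\<lambda>X Y. 0)"
  note fr = coform_frame[OF assms]
  have W: "?W X Y = 0" for X Y by (simp add: *)
  have 1: "(p1 + p2) * (\<i> * r1 - \<i> * r2) - (\<i> * p1 - \<i> * p2) * (r1 + r2) = 0"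
    using W[of "(e * 1, 0, 0)" "(e * \<i>, 0, 0)"] unfolding wedge2_def fr by (simp add: algebra_simps)
  have 2: "(p1 + p2) * r3 - p3 * (r1 + r2) = 0"
    using W[of "(e * 1, 0, 0)" "(w, 1, 0)"] unfolding wedge2_def fr by (simp add: algebra_simps)
  have 3: "(\<i> * p1 - \<i> * p2) * r3 - p3 * (\<i> * r1 - \<i> * r2) = 0"
    using W[of "(e * \<i>, 0, 0)" "(w, 1, 0)"] unfolding wedge2_def fr by (simp add: algebra_simps)
  have "\<i> * 2 * (p2 * r1 - p1 * r2) = 0" using 1 by (simp add: algebra_simps)
  moreover have "\<i> * ((p1 - p2) * r3 - p3 * (r1 - r2)) = 0" using 3 by (simp add: algebra_simps)
  ultimately show "p1 * r2 = p2 * r1 \<and> p1 * r3 = p3 * r1 \<and> p2 * r3 = p3 * r2"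
    using 2 by (auto simp: algebra_simps) (simp_all add: complex_eq_iff)
next
  assume *: "p1 * r2 = p2 * r1 \<and> p1 * r3 = p3 * r1 \<and> p2 * r3 = p3 * r2"
  have "?W X Y = (p1 * r2 - p2 * r1) * (da e w X * cnj (da e w Y) - da e w Y * cnj (da e w X))
      + (p1 * r3 - p3 * r1) * (da e w X * of_real (fst (snd Y)) - da e w Y * of_real (fst (snd X)))
      + (p2 * r3 - p3 * r2) * (cnj (da e w X) * of_real (fst (snd Y)) - cnj (da e w Y) * of_real (fst (snd X)))"
    for X Y
    unfolding wedge2_def coform_def by (simp add: algebra_simps)
  with * show "?W = (\<lambda>X Y. 0)" by (intro ext) simp
qed

definition det3 :: "'a::comm_ring_1 \<Rightarrow> 'a \<Rightarrow> 'a \<Rightarrow> 'a \<Rightarrow> 'a \<Rightarrow> 'a \<Rightarrow> 'a \<Rightarrow> 'a \<Rightarrow> 'a \<Rightarrow> 'a" where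
  "det3 a1 a2 a3 b1 b2 b3 c1 c2 c3 =
     a1 * (b2 * c3 - b3 * c2) - a2 * (b1 * c3 - b3 * c1) + a3 * (b1 * c2 - b2 * c1)"

text \<open>Strips the exponential prefactors and the multiples of d\<alpha> from the rows of a
  wedge condition.\<close>

lemma det3_combine:
  "det3 (k * a1) (k * a2) (k * a3)
     (l * (b1 + r * a1)) (l * (b2 + r * a2)) (l * (b3 + r * a3))
     (m * (c1 + t * a1)) (m * (c2 + t * a2)) (m * (c3 + t * a3)) =
   k * l * m * det3 a1 a2 a3 b1 b2 b3 c1 c2 c3"
  unfolding det3_def by (simp add: algebra_simps)

lemma wedge3_coform_iff:
  assumes "e \<noteq> 0"
  shows "wedge3 (coform e w a1 a2 a3) (coform e w b1 b2 b3) (coform e w c1 c2 c3) = (\<lambda>X Y W. 0) \<longleftrightarrow>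
    det3 a1 a2 a3 b1 b2 b3 c1 c2 c3 = 0" (is "?W = _ \<longleftrightarrow> _")
proof -
  have gen: "wedge3 (coform e w a1 a2 a3) (coform e w b1 b2 b3) (coform e w c1 c2 c3) X Y W =
    det3 a1 a2 a3 b1 b2 b3 c1 c2 c3 *
    det3 (da e w X) (cnj (da e w X)) (of_real (fst (snd X)))
      (da e w Y) (cnj (da e w Y)) (of_real (fst (snd Y)))
      (da e w W) (cnj (da e w W)) (of_real (fst (snd W)))" for X Y W
    unfolding wedge3_def wedge2_def coform_def det3_def by (simp add: algebra_simps)
  have "da e w (e, 0, 0) = 1" "da e w (e * \<i>, 0, 0) = \<i>" "da e w (w, 1, 0) = 0"
    using assms by (simp_all add: da_def)
  \<comment> \<open>On these vectors the second determinant has the rows (1, 1, 0), (i, - i, 0) and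
    (0, 0, 1), hence the value - 2 i.\<close>
  then have "?W (e, 0, 0) (e * \<i>, 0, 0) (w, 1, 0) = det3 a1 a2 a3 b1 b2 b3 c1 c2 c3 * (- 2 * \<i>)"
    unfolding gen by (simp add: det3_def[of 1])
  then have "det3 a1 a2 a3 b1 b2 b3 c1 c2 c3 = 0" if "?W = (\<lambda>X Y W. 0)"
    using that by simp
  moreover have "?W = (\<lambda>X Y W. 0)" if "det3 a1 a2 a3 b1 b2 b3 c1 c2 c3 = 0"
    by (intro ext) (simp add: gen that)
  ultimately show ?thesis by blast
qed

text \<open>The means of differentiating an identity: two expressions for one function have equal
  coefficients.\<close>

lemma has_coform_unique:
  assumes "has_coform e w F q p1 p2 p3" "has_coform e w F q r1 r2 r3" "e \<noteq> 0"
  shows "p1 = r1" "p2 = r2" "p3 = r3"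
proof -
  have *: "coform e w p1 p2 p3 v = coform e w r1 r2 r3 v" for v
    using has_coform_ext_d[OF assms(1)] has_coform_ext_d[OF assms(2)] by simp
  note fr = coform_frame[OF assms(3), of w]
  show "p3 = r3" using *[of "(w, 1, 0)"] unfolding fr .
  have 1: "p1 + p2 = r1 + r2" using *[of "(e * 1, 0, 0)"] unfolding fr by simp
  have "\<i> * (p1 - p2) = \<i> * (r1 - r2)"
    using *[of "(e * \<i>, 0, 0)"] unfolding fr by (simp add: algebra_simps)
  then have 2: "p1 - p2 = r1 - r2" by simp
  have "2 * p1 = (p1 + p2) + (p1 - p2)" "2 * p2 = (p1 + p2) - (p1 - p2)" by simp_all
  then show "p1 = r1" "p2 = r2" unfolding 1 2 by simp_all
qed

section \<open>Consequences of the hypotheses on \<open>\<alpha>\<close>, \<open>\<mu>\<close> and \<open>\<nu>\<close>\<close>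

locale wave_data =
  fixes S :: "(complex \<times> real) set" and \<phi> A :: "complex \<times> real \<Rightarrow> complex"
  assumes open_S: "open S" and hol_\<phi>: "hol_smooth S \<phi>" and hol_A: "hol_smooth S A"
    and exp_A: "\<And>x. x \<in> S \<Longrightarrow> exp (4 * A x) = D1 (D1 \<phi>) x"
    and A1_nz: "\<And>x. x \<in> S \<Longrightarrow> D1 A x \<noteq> 0"
begin

definition "e x = 1 / D1 A x"
definition "w x = - D2 A x / D1 A x"
definition "M = D1 w"
definition "C x = 1 + D1 e x"

abbreviation "f1 \<equiv> D1 \<phi>"
abbreviation "f11 \<equiv> D1 (D1 \<phi>)"
abbreviation "f12 \<equiv> D2 (D1 \<phi>)"

lemma e_nz: "x \<in> S \<Longrightarrow> e x \<noteq> 0"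
  using A1_nz by (simp add: e_def)

lemma f11_nz: "x \<in> S \<Longrightarrow> f11 x \<noteq> 0"
  using exp_A by (metis exp_not_eq_zero)

lemmas hol_partials = hol_smooth_partials(1,2)[OF open_S]
lemmas partials_commute = hol_smooth_partials(3)[OF open_S]
lemmas hp = hol_smooth_has_partials

lemma hol_e: "hol_smooth S e"
  unfolding e_def[abs_def]
  by (intro hol_smooth_divide[OF open_S] hol_smooth_const hol_partials hol_A A1_nz)

lemma hol_w: "hol_smooth S w"
  unfolding w_def[abs_def]
  by (intro hol_smooth_divide[OF open_S] hol_smooth_minus[OF open_S] hol_partials hol_A A1_nz)

lemma hol_M: "hol_smooth S M"
  unfolding M_def by (intro hol_partials hol_w)

lemma hol_C: "hol_smooth S C"
  unfolding C_def[abs_def] by (intro hol_smooth_add[OF open_S] hol_smooth_const hol_partials hol_e)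

lemma A_partials:
  assumes "x \<in> S"
  shows "has_partials A x (1 / e x) (- w x / e x)"
  using hp[OF hol_A assms] A1_nz[OF assms] by (simp add: e_def w_def)

text \<open>The u derivative is fixed by equality of the mixed derivatives of A, where A_\<zeta> = 1
  / e and A_u = - w / e.\<close>

lemma e_partials:
  assumes "x \<in> S"
  shows "has_partials e x (C x - 1) (M x * e x - w x * (C x - 1))"
proof -
  have "has_partials (D1 A) x ((0 * e x - 1 * D1 e x) / (e x * e x)) ((0 * e x - 1 * D2 e x) / (e x * e x))"
    by (rule has_partials_cong[OF has_partials_divide[OF has_partials_const hp[OF hol_e assms]
            e_nz[OF assms]] open_S assms])
      (simp add: e_def)
  moreover have "has_partials (D2 A) x ((- D1 w x * e x - - w x * D1 e x) / (e x * e x))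
      ((- D2 w x * e x - - w x * D2 e x) / (e x * e x))"
    by (rule has_partials_cong[OF has_partials_divide[OF has_partials_minus[OF hp[OF hol_w assms]]
            hp[OF hol_e assms] e_nz[OF assms]] open_S assms])
      (simp add: e_def w_def A1_nz)
  ultimately have "(- D1 w x * e x - - w x * D1 e x) / (e x * e x) = (0 * e x - 1 * D2 e x) / (e x * e x)"
    using has_partials_D partials_commute[OF hol_A assms] by metis
  then have "- D1 w x * e x - - w x * D1 e x = 0 * e x - 1 * D2 e x"
    using e_nz[OF assms] by (metis divide_cancel_right mult_eq_0_iff)
  then have "D2 e x = M x * e x - w x * (C x - 1)"
    by (simp add: M_def C_def algebra_simps)
  then show ?thesis
    using hp[OF hol_e assms] by (simp add: C_def)
qed

lemma f11_partials:
  assumes "x \<in> S"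
  shows "has_partials f11 x (4 * f11 x / e x) (- 4 * f11 x * w x / e x)"
proof -
  have "has_partials (\<lambda>x. exp (4 * A x)) x (exp (4 * A x) * (0 * A x + 4 * (1 / e x)))
      (exp (4 * A x) * (0 * A x + 4 * (- w x / e x)))"
    by (intro has_partials_exp has_partials_mult has_partials_const A_partials assms)
  from has_partials_cong[OF this open_S assms exp_A] show ?thesis
    unfolding exp_A[OF assms] by (rule has_partials_eq) (simp_all add: algebra_simps)
qed

abbreviation cf :: "(point \<Rightarrow> complex) \<Rightarrow> point \<Rightarrow> complex \<Rightarrow> complex \<Rightarrow> complex \<Rightarrow> bool" where
  "cf Q q \<equiv> has_coform (e (pr q)) (w (pr q)) Q q"

text \<open>The spin coefficients without Z and L. In \<open>Nu\<close>, Z_uu at fixed a has become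
  D2 w + w M, since w also varies through \<zeta> = Z(a, u).\<close>

definition "Al q = exp (A (pr q) - cnj (A (pr q))) * cnj (D1 A (pr q))"
definition "Mu q = exp (- A (pr q) - cnj (A (pr q))) * M (pr q)"
definition "Nu q = exp (- A (pr q) - 3 * cnj (A (pr q))) * (D2 w (pr q) + w (pr q) * M (pr q) + cnj (f1 (pr q)))"

lemma cf_hol:
  assumes "pr q \<in> S" "has_partials H (pr q) h1 h2" "r1 = e (pr q) * h1" "r3 = h2 + w (pr q) * h1"
  shows "cf (\<lambda>q. H (pr q)) q r1 0 r3"
  unfolding assms(3,4) by (rule has_coform_pr[OF assms(2) e_nz[OF assms(1)]])

lemma cf_A: "pr q \<in> S \<Longrightarrow> cf (\<lambda>q. A (pr q)) q 1 0 0"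
  by (rule cf_hol[OF _ A_partials]) (use e_nz in auto)

lemma cf_cnj_A: "pr q \<in> S \<Longrightarrow> cf (\<lambda>q. cnj (A (pr q))) q 0 1 0"
  using has_coform_cnj[OF cf_A] by simp

lemma cf_exp:
  assumes "pr q \<in> S"
  shows "cf (\<lambda>q. exp (c1 * A (pr q) + c2 * cnj (A (pr q)))) q
    (exp (c1 * A (pr q) + c2 * cnj (A (pr q))) * c1) (exp (c1 * A (pr q) + c2 * cnj (A (pr q))) * c2) 0"
  using has_coform_exp[OF has_coform_add[OF has_coform_cmult[OF cf_A[OF assms]]
        has_coform_cmult[OF cf_cnj_A[OF assms]]], of c1 c2] by simp

lemma cf_Al:
  assumes "pr q \<in> S"
  shows "cf Al q (Al q) (- Al q * cnj (C (pr q))) (- Al q * cnj (M (pr q)))"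
proof -
  define x where "x = pr q"
  have x: "x \<in> S" using assms by (simp add: x_def)
  have D: "D1 A x = 1 / e x" by (simp add: e_def)
  have "has_partials (D1 A) x ((0 * e x - 1 * (C x - 1)) / (e x * e x))
      ((0 * e x - 1 * (M x * e x - w x * (C x - 1))) / (e x * e x))"
    by (rule has_partials_cong[OF has_partials_divide[OF has_partials_const e_partials[OF x]
            e_nz[OF x]] open_S x])
      (simp add: e_def)
  then have "cf (\<lambda>q. D1 A (pr q)) q (- (C x - 1) / e x) 0 (- M x / e x)"
    unfolding x_def
    by (rule cf_hol[OF assms]) (use e_nz[OF assms] in \<open>simp_all add: field_simps\<close>)
  from has_coform_mult[OF cf_exp[OF assms, of 1 "- 1"] has_coform_cnj[OF this]]
  have "cf Al q (exp (A x - cnj (A x)) * cnj (D1 A x))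
      (exp (A x - cnj (A x)) * cnj (- (C x - 1) / e x) - exp (A x - cnj (A x)) * cnj (D1 A x))
      (exp (A x - cnj (A x)) * cnj (- M x / e x))"
    by (simp add: Al_def[abs_def] x_def)
  then show ?thesis
    by (rule has_coform_eq) (simp_all add: Al_def D algebra_simps diff_divide_distrib add_divide_distrib flip: x_def)
qed

lemma cf_Mu:
  assumes "pr q \<in> S"
  shows "cf Mu q (exp (- A (pr q) - cnj (A (pr q))) * (e (pr q) * D1 M (pr q)) - Mu q) (- Mu q)
    (exp (- A (pr q) - cnj (A (pr q))) * (D2 M (pr q) + w (pr q) * D1 M (pr q)))"
proof -
  have "cf (\<lambda>q. M (pr q)) q (e (pr q) * D1 M (pr q)) 0 (D2 M (pr q) + w (pr q) * D1 M (pr q))"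
    by (rule cf_hol[OF assms hp[OF hol_M assms]]) simp_all
  from has_coform_mult[OF cf_exp[OF assms, of "- 1" "- 1"] this] show ?thesis
    by (simp add: Mu_def[abs_def])
qed

end

section \<open>Consequences for C and M\<close>

locale wave_invariants = wave_data +
  fixes U :: "point set"
  assumes S_eq: "S = pr ` U"
    and wedge_Al: "\<And>q. q \<in> U \<Longrightarrow> wedge2 (ext_d Al q) (ext_d (\<lambda>q. cnj (Al q)) q) = (\<lambda>X Y. 0)"
    and wedge_Mu: "\<And>q. q \<in> U \<Longrightarrow> wedge2 (ext_d Al q) (ext_d Mu q) = (\<lambda>X Y. 0)"
    and wedge_Nu: "\<And>q. q \<in> U \<Longrightarrow> wedge2 (ext_d Al q) (ext_d Nu q) \<noteq> (\<lambda>X Y. 0)"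
begin

lemma Al_nz: "pr q \<in> S \<Longrightarrow> Al q \<noteq> 0"
  using A1_nz by (simp add: Al_def)

text \<open>Up to nonzero factors the differentials of \<alpha> and its conjugate have the
  coefficients (1, - cnj C, - cnj M) and (- C, 1, - M). The equations are two of their
  minors.\<close>

lemma CC_MC:
  assumes "x \<in> S"
  shows "C x * cnj (C x) = 1" "M x + C x * cnj (M x) = 0"
proof -
  obtain q where qU: "q \<in> U" and q: "pr q = x" using assms S_eq by blast
  then have qS: "pr q \<in> S" using assms by simp
  have "wedge2 (ext_d Al q) (ext_d (\<lambda>q. cnj (Al q)) q) = (\<lambda>X Y. 0)"
    by (rule wedge_Al[OF qU])
  then have *: "Al q * cnj (Al q) = (- Al q * cnj (C x)) * cnj (- Al q * cnj (C x)) \<and>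
      Al q * cnj (- Al q * cnj (M x)) = (- Al q * cnj (M x)) * cnj (- Al q * cnj (C x))"
    unfolding has_coform_ext_d[OF cf_Al[OF qS]] has_coform_ext_d[OF has_coform_cnj[OF cf_Al[OF qS]]]
      q wedge2_coform_iff[OF e_nz[OF assms]] by blast
  define k where "k = Al q * cnj (Al q)"
  have "k \<noteq> 0" using Al_nz[OF qS] by (simp add: k_def)
  have "k * (C x * cnj (C x) - 1) =
      (- Al q * cnj (C x)) * cnj (- Al q * cnj (C x)) - Al q * cnj (Al q)"
    "k * (M x + C x * cnj (M x)) =
      (- Al q * cnj (M x)) * cnj (- Al q * cnj (C x)) - Al q * cnj (- Al q * cnj (M x))"
    unfolding k_def by (simp_all add: algebra_simps)
  then have "k * (C x * cnj (C x) - 1) = 0" "k * (M x + C x * cnj (M x)) = 0"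
    using * by (metis right_minus_eq)+
  then show "C x * cnj (C x) = 1" "M x + C x * cnj (M x) = 0"
    using \<open>k \<noteq> 0\<close> by auto
qed

lemma open_pr: "open (pr -` S)"
  using open_S bounded_linear_pr by (intro open_vimage linear_continuous_on)

text \<open>Compare the da coefficients after differentiating \<open>CC_MC\<close>: conjugates of
  holomorphic functions contribute none, so only C_\<zeta>, and then M_\<zeta>, survive.\<close>

lemma C_M_partials_1:
  assumes "x \<in> S"
  shows "D1 C x = 0" "D1 M x = 0"
proof -
  obtain q where qU: "q \<in> U" and q: "pr q = x" using assms S_eq by blast
  then have qS: "pr q \<in> S" using assms by simp
  note hC = has_coform_pr[OF hp[OF hol_C qS] e_nz[OF qS], where w = "w (pr q)"]
  note hM = has_coform_pr[OF hp[OF hol_M qS] e_nz[OF qS], where w = "w (pr q)"]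
  have "cf (\<lambda>q. C (pr q) * cnj (C (pr q))) q 0 0 0"
    by (rule has_coform_cong[OF has_coform_const[of _ _ 1] open_pr]) (use CC_MC qS in auto)
  from has_coform_unique(1)[OF has_coform_mult[OF hC has_coform_cnj[OF hC]] this e_nz[OF qS]]
  have "e x * D1 C x * cnj (C x) = 0" by (simp add: q)
  then show C1: "D1 C x = 0" using CC_MC(1)[OF assms] e_nz[OF assms] by auto
  have "cf (\<lambda>q. M (pr q) + C (pr q) * cnj (M (pr q))) q 0 0 0"
    by (rule has_coform_cong[OF has_coform_const[of _ _ 0] open_pr]) (use CC_MC qS in auto)
  from has_coform_unique(1)[OF has_coform_add[OF hM has_coform_mult[OF hC has_coform_cnj[OF hM]]]
      this e_nz[OF qS]]
  show "D1 M x = 0" using C1 e_nz[OF assms] by (simp add: q)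
qed

text \<open>C_u is the \<zeta> derivative of e_u = M e - w (C - 1), and there the two terms M (C -
  1) cancel because w_\<zeta> = M.\<close>

lemma C_partials:
  assumes "x \<in> S"
  shows "has_partials C x 0 0"
proof -
  have "has_partials (\<lambda>x. 1 + D1 e x) x (0 + D1 (D1 e) x) (0 + D2 (D1 e) x)"
    by (intro has_partials_add has_partials_const hp[OF hol_partials(1)[OF hol_e] assms])
  then have "has_partials C x (0 + D1 (D1 e) x) (0 + D2 (D1 e) x)"
    unfolding C_def[abs_def] .
  from has_partials_D(2)[OF this] have 1: "D2 C x = D1 (D2 e) x"
    using partials_commute[OF hol_e assms] by simp
  have "has_partials (\<lambda>x. M x * e x - w x * (C x - 1)) x
     ((D1 M x * e x + M x * (C x - 1)) - (D1 w x * (C x - 1) + w x * (D1 C x - 0)))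
     ((D2 M x * e x + M x * (M x * e x - w x * (C x - 1))) - (D2 w x * (C x - 1) + w x * (D2 C x - 0)))"
    by (intro has_partials_diff has_partials_mult has_partials_const e_partials[OF assms]
        hp[OF hol_M assms] hp[OF hol_w assms] hp[OF hol_C assms])
  then have "has_partials (D2 e) x
     ((D1 M x * e x + M x * (C x - 1)) - (D1 w x * (C x - 1) + w x * (D1 C x - 0)))
     ((D2 M x * e x + M x * (M x * e x - w x * (C x - 1))) - (D2 w x * (C x - 1) + w x * (D2 C x - 0)))"
    by (rule has_partials_cong[OF _ open_S assms]) (use e_partials has_partials_D(2) in metis)
  from has_partials_D(1)[OF this] have "D1 (D2 e) x = 0"
    by (simp add: C_M_partials_1[OF assms] M_def[symmetric])
  then show ?thesis
    using 1 hp[OF hol_C assms] C_M_partials_1[OF assms] by simp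
qed

text \<open>Up to a nonzero factor d\<mu> now has the coefficients (- M, - M, M_u). Its minors with
  d\<alpha> give (cnj C + 1) M = 0 and M_u = M cnj M; so M = 0 or C = - 1, and in either case
  \<open>CC_MC\<close> makes M real.\<close>

lemma M_facts:
  assumes "x \<in> S"
  shows "cnj (M x) = M x" "C x * M x = - M x" "cnj (C x) * M x = - M x"
    "has_partials M x 0 (M x * M x)"
proof -
  obtain q where qU: "q \<in> U" and q: "pr q = x" using assms S_eq by blast
  then have qS: "pr q \<in> S" using assms by simp
  define E where "E = exp (- A x - cnj (A x))"
  have "E \<noteq> 0" by (simp add: E_def)
  have Mu: "Mu q = E * M x" by (simp add: Mu_def E_def q)
  have "wedge2 (ext_d Al q) (ext_d Mu q) = (\<lambda>X Y. 0)"
    by (rule wedge_Mu[OF qU])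
  then have *: "Al q * (- (E * M x)) = (- Al q * cnj (C x)) * (- (E * M x)) \<and>
      Al q * (E * D2 M x) = (- Al q * cnj (M x)) * (- (E * M x))"
    unfolding has_coform_ext_d[OF cf_Al[OF qS]] has_coform_ext_d[OF cf_Mu[OF qS]]
      q Mu C_M_partials_1[OF assms] E_def[symmetric] wedge2_coform_iff[OF e_nz[OF assms]] by auto
  define k where "k = Al q * E"
  have "k \<noteq> 0" using Al_nz[OF qS] \<open>E \<noteq> 0\<close> by (simp add: k_def)
  have "k * ((cnj (C x) + 1) * M x) = (- Al q * cnj (C x)) * (- (E * M x)) - Al q * (- (E * M x))"
    "k * (D2 M x - cnj (M x) * M x) = Al q * (E * D2 M x) - (- Al q * cnj (M x)) * (- (E * M x))"
    unfolding k_def by (simp_all add: algebra_simps)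
  then have "k * ((cnj (C x) + 1) * M x) = 0" "k * (D2 M x - cnj (M x) * M x) = 0"
    using * by (metis right_minus_eq)+
  then have 1: "(cnj (C x) + 1) * M x = 0" and 2: "D2 M x = cnj (M x) * M x"
    using \<open>k \<noteq> 0\<close> by auto
  have "M x = 0 \<or> C x = - 1"
  proof (cases "M x = 0")
    case False
    then have "cnj (C x) = - 1" using 1 by (simp add: eq_neg_iff_add_eq_0)
    then have "C x = cnj (- 1)" by (metis complex_cnj_cnj)
    then show ?thesis by simp
  qed simp
  then show "cnj (M x) = M x" "C x * M x = - M x" "cnj (C x) * M x = - M x"
    using CC_MC(2)[OF assms] by auto
  then show "has_partials M x 0 (M x * M x)"
    using 2 hp[OF hol_M assms] C_M_partials_1[OF assms] by simp
qed

lemma C3_nz: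
  assumes "x \<in> S"
  shows "C x + 3 \<noteq> 0" "cnj (C x) + 3 \<noteq> 0"
proof -
  have "cmod (C x) = 1"
    using CC_MC(1)[OF assms] by (metis complex_mod_mult_cnj complex_mod_cnj norm_one power2_eq_1_iff
        norm_ge_zero abs_of_nonneg abs_minus_cancel)
  then have "C x \<noteq> - 3" by auto
  then show "C x + 3 \<noteq> 0" by (simp add: eq_neg_iff_add_eq_0)
  then show "cnj (C x) + 3 \<noteq> 0"
    by (metis complex_cnj_add complex_cnj_numeral complex_cnj_zero_iff)
qed

text \<open>The term \<open>M\<^sup>2 e\<close> in \<open>P\<close> and the term \<open>K\<close> in \<open>R\<close> are chosen such that \<open>P\<^sub>\<zeta> = R\<^sub>\<zeta> = 0\<close>, and they change
  \<open>e\<^bsup>a+3a*\<^esup> \<nu> = Z\<^sub>u\<^sub>u + (f\<^sub>\<zeta>)*\<close> into \<open>g = P + R*\<close> only by \<open>e\<^bsup>a+3a*\<^esup>\<close> times a function of \<open>\<alpha>\<close>.\<close>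

definition "K x = f11 x * e x / (C x + 3)"
definition "P x = D2 w x + w x * M x + M x * M x * e x"
definition "R x = f1 x - K x"
definition "g x = P x + cnj (R x)"
definition "G x = D2 P x + cnj (D2 R x)"
definition "G' x = D2 (D2 P) x + cnj (D2 (D2 R) x)"
definition "\<rho> x = 3 * (M x * M x * e x) - cnj (K x)"

lemma w_partials: "x \<in> S \<Longrightarrow> has_partials w x (M x) (D2 w x)"
  using hp[OF hol_w] by (simp add: M_def)

lemma D2w_partials: "x \<in> S \<Longrightarrow> has_partials (D2 w) x (M x * M x) (D2 (D2 w) x)"
  using hp[OF hol_partials(2)[OF hol_w]] partials_commute[OF hol_w]
    has_partials_D(2)[OF M_facts(4)] by (simp add: M_def)

lemma hol_K: "hol_smooth S K"
  unfolding K_def[abs_def]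
  by (intro hol_smooth_divide[OF open_S] hol_smooth_mult[OF open_S] hol_smooth_add[OF open_S]
      hol_smooth_const hol_partials hol_\<phi> hol_e hol_C C3_nz)

text \<open>From f_\<zeta>\<zeta> = exp (4 a) and e_\<zeta> = C - 1 the product f_\<zeta>\<zeta> e
  has \<zeta> derivative (C + 3) f_\<zeta>\<zeta>. Dividing by C + 3, whose derivatives vanish,
  makes K a \<zeta> antiderivative of f_\<zeta>\<zeta>; this is the origin of the
  denominator.\<close>

lemma K_partials:
  assumes "x \<in> S"
  shows "has_partials K x (f11 x) (K x * M x - f11 x * w x)"
proof -
  have D: "has_partials K x
     (((4 * f11 x / e x * e x + f11 x * (C x - 1)) * (C x + 3) - f11 x * e x * (0 + 0)) / ((C x + 3) * (C x + 3)))
     ((((- 4 * f11 x * w x / e x) * e x + f11 x * (M x * e x - w x * (C x - 1))) * (C x + 3)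
       - f11 x * e x * (0 + 0)) / ((C x + 3) * (C x + 3)))"
    unfolding K_def[abs_def]
    by (intro has_partials_divide has_partials_mult has_partials_add has_partials_const f11_partials
        e_partials C_partials C3_nz assms)
  have num: "4 * f11 x / e x * e x + f11 x * (C x - 1) = f11 x * (C x + 3)"
    "(- 4 * f11 x * w x / e x) * e x + f11 x * (M x * e x - w x * (C x - 1))
      = f11 x * e x * M x - f11 x * w x * (C x + 3)"
    using e_nz[OF assms] by (simp_all add: algebra_simps)
  show ?thesis
    using D unfolding num
  proof (rule has_partials_eq)
    have *: "(y * c * c - z * (0 + 0)) / (c * c) = y" "((y - t * c) * c - z * (0 + 0)) / (c * c) = y / c - t"
      if "c \<noteq> 0" for c y z t :: complex
      using that by (simp_all add: field_simps)
    note * = *[OF C3_nz(1)[OF assms]]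
    show "(f11 x * (C x + 3) * (C x + 3) - f11 x * e x * (0 + 0)) / ((C x + 3) * (C x + 3)) = f11 x"
      by (rule *)
    show "((f11 x * e x * M x - f11 x * w x * (C x + 3)) * (C x + 3) - f11 x * e x * (0 + 0)) /
        ((C x + 3) * (C x + 3)) = K x * M x - f11 x * w x"
      unfolding * by (simp add: K_def)
  qed
qed

lemma hol_P: "hol_smooth S P"
  unfolding P_def[abs_def]
  by (intro hol_smooth_mult[OF open_S] hol_smooth_add[OF open_S] hol_partials hol_w hol_M hol_e)

lemma hol_R: "hol_smooth S R"
  unfolding R_def[abs_def] by (intro hol_smooth_diff[OF open_S] hol_partials hol_\<phi> hol_K)

lemma P_partials:
  assumes "x \<in> S"
  shows "has_partials P x 0 (D2 (D2 w) x + D2 w x * M x + 3 * (w x * M x * M x) + 3 * (M x * M x * M x * e x))"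
proof -
  note M = M_facts(2)[OF assms]
  have "has_partials P x
     ((M x * M x + (M x * M x + w x * 0)) + ((0 * M x + M x * 0) * e x + M x * M x * (C x - 1)))
     ((D2 (D2 w) x + (D2 w x * M x + w x * (M x * M x)))
       + ((M x * M x * M x + M x * (M x * M x)) * e x + M x * M x * (M x * e x - w x * (C x - 1))))"
    unfolding P_def[abs_def]
    by (intro has_partials_add has_partials_mult D2w_partials w_partials M_facts(4) e_partials assms)
  moreover have "M x * M x * (C x - 1) = M x * (C x * M x) - M x * M x"
    "M x * M x * (M x * e x - w x * (C x - 1)) = M x * M x * M x * e x - w x * (M x * (C x * M x)) + w x * M x * M x"
    by (simp_all add: algebra_simps)
  ultimately show ?thesis
    unfolding M by (auto elim!: has_partials_eq simp: algebra_simps)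
qed

lemma R_partials:
  assumes "x \<in> S"
  shows "has_partials R x 0 (f12 x + f11 x * w x - K x * M x)"
proof -
  have "has_partials R x (f11 x - f11 x) (f12 x - (K x * M x - f11 x * w x))"
    unfolding R_def[abs_def]
    by (intro has_partials_diff K_partials hp[OF hol_partials(1)[OF hol_\<phi>]] assms)
  then show ?thesis by (rule has_partials_eq) (simp_all add: algebra_simps)
qed

lemma D2_partials:
  assumes "hol_smooth S H" "\<And>x. x \<in> S \<Longrightarrow> D1 H x = 0" "x \<in> S"
  shows "has_partials (D2 H) x 0 (D2 (D2 H) x)"
proof -
  have "has_partials (D1 H) x 0 0"
    by (rule has_partials_cong[OF has_partials_const open_S assms(3)]) (simp add: assms(2))
  then show ?thesis
    using hp[OF hol_partials(2)[OF assms(1)] assms(3)] partials_commute[OF assms(1,3)]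
      has_partials_D(2) by metis
qed

lemma DP_partials: "x \<in> S \<Longrightarrow> has_partials (D2 P) x 0 (D2 (D2 P) x)"
  using D2_partials[OF hol_P] has_partials_D(1)[OF P_partials] by blast

lemma DR_partials: "x \<in> S \<Longrightarrow> has_partials (D2 R) x 0 (D2 (D2 R) x)"
  using D2_partials[OF hol_R] has_partials_D(1)[OF R_partials] by blast

text \<open>\<open>E4\<close> is \<open>E3\<close> times the factor exp (- a - cnj a) of \<Delta>.
  The literal coefficients have the shape produced by \<open>cf_exp\<close>.\<close>

definition "E3 q = exp (- 1 * A (pr q) + (- 3) * cnj (A (pr q)))"
definition "E4 q = exp (- 2 * A (pr q) + (- 4) * cnj (A (pr q)))"

lemma Nu_eq: "Nu q = E3 q * (g (pr q) - M (pr q) * M (pr q) * e (pr q) + cnj (K (pr q)))"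
  by (simp add: Nu_def E3_def g_def P_def R_def)

context
  fixes q :: point
  assumes qS: "pr q \<in> S"
begin

lemma cf_g: "cf (\<lambda>q. g (pr q)) q 0 0 (G (pr q))"
proof -
  have "has_partials P (pr q) 0 (D2 P (pr q))" "has_partials R (pr q) 0 (D2 R (pr q))"
    using P_partials[OF qS] R_partials[OF qS] has_partials_D(2) by metis+
  then have "cf (\<lambda>q. P (pr q)) q 0 0 (D2 P (pr q))" "cf (\<lambda>q. R (pr q)) q 0 0 (D2 R (pr q))"
    by (auto intro: cf_hol[OF qS])
  from has_coform_add[OF this(1) has_coform_cnj[OF this(2)]] show ?thesis
    by (simp add: g_def[abs_def] G_def)
qed

lemma cf_G: "cf (\<lambda>q. G (pr q)) q 0 0 (G' (pr q))"
proof -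
  have "cf (\<lambda>q. D2 P (pr q)) q 0 0 (D2 (D2 P) (pr q))" "cf (\<lambda>q. D2 R (pr q)) q 0 0 (D2 (D2 R) (pr q))"
    by (rule cf_hol[OF qS DP_partials[OF qS]] cf_hol[OF qS DR_partials[OF qS]]; simp)+
  from has_coform_add[OF this(1) has_coform_cnj[OF this(2)]] show ?thesis
    by (simp add: G_def[abs_def] G'_def)
qed

lemma cf_M: "cf (\<lambda>q. M (pr q)) q 0 0 (M (pr q) * M (pr q))"
  by (rule cf_hol[OF qS M_facts(4)[OF qS]]) simp_all

lemma cf_e: "cf (\<lambda>q. e (pr q)) q (e (pr q) * (C (pr q) - 1)) 0 (M (pr q) * e (pr q))"
  by (rule cf_hol[OF qS e_partials[OF qS]]) simp_all

lemma cf_cnj_K: "cf (\<lambda>q. cnj (K (pr q))) q 0 ((cnj (C (pr q)) + 3) * cnj (K (pr q))) (M (pr q) * cnj (K (pr q)))"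
proof -
  have "cf (\<lambda>q. K (pr q)) q ((C (pr q) + 3) * K (pr q)) 0 (M (pr q) * K (pr q))"
    by (rule cf_hol[OF qS K_partials[OF qS]]) (use C3_nz[OF qS] in \<open>simp_all add: K_def field_simps\<close>)
  from has_coform_cnj[OF this] show ?thesis by (simp add: M_facts(1)[OF qS])
qed

lemma cf_MMe:
  "cf (\<lambda>q. M (pr q) * M (pr q) * e (pr q)) q (- 2 * (M (pr q) * M (pr q) * e (pr q))) 0
    (3 * (M (pr q) * (M (pr q) * M (pr q) * e (pr q))))"
proof (rule has_coform_eq[OF has_coform_mult[OF has_coform_mult[OF cf_M cf_M] cf_e]])
  have "M (pr q) * M (pr q) * (e (pr q) * (C (pr q) - 1)) =
      M (pr q) * e (pr q) * (C (pr q) * M (pr q)) - M (pr q) * e (pr q) * M (pr q)"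
    by (simp add: algebra_simps)
  then show "M (pr q) * M (pr q) * (e (pr q) * (C (pr q) - 1)) + (M (pr q) * 0 + 0 * M (pr q)) * e (pr q) =
      - 2 * (M (pr q) * M (pr q) * e (pr q))"
    unfolding M_facts(2)[OF qS] by (simp add: algebra_simps)
qed (simp_all add: algebra_simps)

lemma cf_\<rho>:
  "cf (\<lambda>q. \<rho> (pr q)) q (- 6 * (M (pr q) * M (pr q) * e (pr q))) (- ((cnj (C (pr q)) + 3) * cnj (K (pr q))))
    (9 * (M (pr q) * (M (pr q) * M (pr q) * e (pr q))) - M (pr q) * cnj (K (pr q)))"
  unfolding \<rho>_def by (rule has_coform_eq[OF has_coform_diff[OF has_coform_cmult[OF cf_MMe] cf_cnj_K]]) simp_all

end

text \<open>The terms of \<nu> beyond g contribute exactly \<rho> times the row (1, - cnj C, - M) of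
  d\<alpha>, thanks to cnj C M = - M. Only - g, - 3 g and G matter in wedge products with
  d\<alpha>.\<close>

lemma cf_Nu:
  assumes "pr q \<in> S"
  shows "cf Nu q (E3 q * (- g (pr q) + \<rho> (pr q) * 1)) (E3 q * (- 3 * g (pr q) + \<rho> (pr q) * - cnj (C (pr q))))
    (E3 q * (G (pr q) + \<rho> (pr q) * - M (pr q)))"
proof -
  have "cf (\<lambda>q. E3 q * (g (pr q) - M (pr q) * M (pr q) * e (pr q) + cnj (K (pr q)))) q
    (E3 q * (- g (pr q) + \<rho> (pr q) * 1)) (E3 q * (- 3 * g (pr q) + \<rho> (pr q) * - cnj (C (pr q))))
    (E3 q * (G (pr q) + \<rho> (pr q) * - M (pr q)))"
  proof (rule has_coform_eq[OF has_coform_mult[OF cf_exp[OF assms, of "- 1" "- 3", folded E3_def]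
          has_coform_add[OF has_coform_diff[OF cf_g[OF assms] cf_MMe[OF assms]] cf_cnj_K[OF assms]]]])
    have "3 * (M (pr q) * M (pr q) * e (pr q)) * - cnj (C (pr q)) =
        - 3 * (M (pr q) * e (pr q)) * (cnj (C (pr q)) * M (pr q))"
      by (simp add: algebra_simps)
    then have *: "\<rho> (pr q) * - cnj (C (pr q)) =
        3 * (M (pr q) * M (pr q) * e (pr q)) + cnj (C (pr q)) * cnj (K (pr q))"
      unfolding M_facts(3)[OF assms] by (simp add: \<rho>_def algebra_simps)
    show "E3 q * (0 - 0 + (cnj (C (pr q)) + 3) * cnj (K (pr q))) +
        E3 q * - 3 * (g (pr q) - M (pr q) * M (pr q) * e (pr q) + cnj (K (pr q))) =
        E3 q * (- 3 * g (pr q) + \<rho> (pr q) * - cnj (C (pr q)))"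
      unfolding * by (simp add: algebra_simps)
  qed (simp_all add: \<rho>_def algebra_simps)
  moreover have "(\<lambda>q. E3 q * (g (pr q) - M (pr q) * M (pr q) * e (pr q) + cnj (K (pr q)))) = Nu"
    by (rule ext) (simp only: Nu_eq)
  ultimately show ?thesis by (simp only:)
qed

lemma cf_Delta_Nu:
  assumes "pr q \<in> S"
  shows "\<exists>\<tau>. cf (\<lambda>q. E4 q * (G (pr q) - M (pr q) * \<rho> (pr q))) q
    (E4 q * (- 2 * G (pr q) + \<tau> * 1)) (E4 q * (- 4 * G (pr q) + \<tau> * - cnj (C (pr q))))
    (E4 q * (G' (pr q) + \<tau> * - M (pr q)))"
proof -
  define x where "x = pr q"
  have x: "x \<in> S" using assms by (simp add: x_def)
  define Q where "Q = M x * M x * e x"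
  define k where "k = cnj (K x)"
  \<comment> \<open>What the da coefficient contains besides - 2 G; cnj C M = - M makes the same
    \<tau> fit the other two coefficients.\<close>
  define \<tau> where "\<tau> = 12 * (M x * Q) - 2 * (M x * k)"
  have \<rho>: "\<rho> x = 3 * Q - k" by (simp add: \<rho>_def Q_def k_def)
  have CM: "cnj (C x) * (M x * y) = - (M x * y)" for y
    using M_facts(3)[OF x] by (metis mult.assoc minus_mult_left)
  have \<tau>_C: "\<tau> * - cnj (C x) = \<tau>"
  proof -
    have "\<tau> * - cnj (C x) = 2 * (cnj (C x) * (M x * k)) - 12 * (cnj (C x) * (M x * Q))"
      by (simp add: \<tau>_def algebra_simps)
    then show ?thesis unfolding CM by (simp add: \<tau>_def)
  qed
  have k_C: "M x * - ((cnj (C x) + 3) * k) = - 2 * (M x * k)"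
    using CM[of k] by (simp add: algebra_simps)
  have "cf (\<lambda>q. E4 q * (G (pr q) - M (pr q) * \<rho> (pr q))) q
    (E4 q * (- 2 * G (pr q) + \<tau> * 1)) (E4 q * (- 4 * G (pr q) + \<tau> * - cnj (C (pr q))))
    (E4 q * (G' (pr q) + \<tau> * - M (pr q)))"
  proof (rule has_coform_eq[OF has_coform_mult[OF cf_exp[OF assms, of "- 2" "- 4", folded E4_def]
          has_coform_diff[OF cf_G[OF assms] has_coform_mult[OF cf_M[OF assms] cf_\<rho>[OF assms]]]]];
      fold x_def; fold Q_def k_def; unfold \<rho> \<tau>_C k_C)
    show "E4 q * (0 - (M x * (- 6 * Q) + 0 * (3 * Q - k))) + E4 q * - 2 * (G x - M x * (3 * Q - k)) =
        E4 q * (- 2 * G x + \<tau> * 1)"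
      by (simp add: \<tau>_def algebra_simps)
    show "E4 q * (0 - (- 2 * (M x * k) + 0 * (3 * Q - k))) + E4 q * - 4 * (G x - M x * (3 * Q - k)) =
        E4 q * (- 4 * G x + \<tau>)"
      by (simp add: \<tau>_def algebra_simps)
    show "E4 q * (G' x - (M x * (9 * (M x * Q) - M x * k) + M x * M x * (3 * Q - k))) +
        0 * (G x - M x * (3 * Q - k)) = E4 q * (G' x + \<tau> * - M x)"
      by (simp add: \<tau>_def algebra_simps)
  qed
  then show ?thesis by blast
qed

text \<open>The rows are the components of \<open>d\<alpha>\<close>, \<open>d\<nu>\<close> and \<open>d\<nu>*\<close> (respectively \<open>d(\<Delta>\<nu>)\<close>) with respect to
  \<open>da, da*, du\<close>, up to nonzero factors and multiples of the first row.\<close>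

definition "cond1 x \<longleftrightarrow> det3 1 (- cnj (C x)) (- M x) (- g x) (- 3 * g x) (G x)
  (- 3 * cnj (g x)) (- cnj (g x)) (cnj (G x)) = 0"

definition "cond2 x \<longleftrightarrow> det3 1 (- cnj (C x)) (- M x) (- g x) (- 3 * g x) (G x)
  (- 2 * G x) (- 4 * G x) (G' x) = 0"

lemma E_nz: "E3 q \<noteq> 0" "E4 q \<noteq> 0"
  by (simp_all add: E3_def E4_def)

lemma cf_Al': "pr q \<in> S \<Longrightarrow> cf Al q (Al q * 1) (Al q * - cnj (C (pr q))) (Al q * - M (pr q))"
  by (rule has_coform_eq[OF cf_Al]) (simp_all add: M_facts)

text \<open>If both vanished, \<open>cf_Nu\<close> would make d\<nu> a multiple of
  d\<alpha>.\<close>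

lemma g_G_nz:
  assumes "x \<in> S"
  shows "g x \<noteq> 0 \<or> G x \<noteq> 0"
proof (rule ccontr)
  obtain q where qU: "q \<in> U" and q: "pr q = x" using assms S_eq by blast
  then have qS: "pr q \<in> S" using assms by simp
  assume "\<not> (g x \<noteq> 0 \<or> G x \<noteq> 0)"
  then have "wedge2 (ext_d Al q) (ext_d Nu q) = (\<lambda>X Y. 0)"
    unfolding has_coform_ext_d[OF cf_Al'[OF qS]] has_coform_ext_d[OF cf_Nu[OF qS]]
      q wedge2_coform_iff[OF e_nz[OF assms]] by simp
  then show False using wedge_Nu[OF qU] by simp
qed

lemma wedge3_Nu_iff:
  assumes "pr q \<in> S"
  shows "wedge3 (ext_d Al q) (ext_d Nu q) (ext_d (\<lambda>q. cnj (Nu q)) q) = (\<lambda>X Y W. 0) \<longleftrightarrow> cond1 (pr q)"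
proof -
  \<comment> \<open>The conjugate of \<beta> is - C \<beta>, so conjugating \<rho> \<beta> gives t
    \<beta>.\<close>
  define t where "t = - C (pr q) * cnj (\<rho> (pr q))"
  have "cf (\<lambda>q. cnj (Nu q)) q (cnj (E3 q) * (- 3 * cnj (g (pr q)) + t * 1))
    (cnj (E3 q) * (- cnj (g (pr q)) + t * - cnj (C (pr q)))) (cnj (E3 q) * (cnj (G (pr q)) + t * - M (pr q)))"
  proof (rule has_coform_eq[OF has_coform_cnj[OF cf_Nu[OF assms]]])
    have "t * - cnj (C (pr q)) = (C (pr q) * cnj (C (pr q))) * cnj (\<rho> (pr q))"
      "t * - M (pr q) = (C (pr q) * M (pr q)) * cnj (\<rho> (pr q))"
      by (simp_all add: t_def algebra_simps)
    then have *: "t * - cnj (C (pr q)) = cnj (\<rho> (pr q))" "t * - M (pr q) = - M (pr q) * cnj (\<rho> (pr q))"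
      unfolding CC_MC(1)[OF assms] M_facts(2)[OF assms] by simp_all
    show "cnj (E3 q * (- g (pr q) + \<rho> (pr q) * 1)) =
        cnj (E3 q) * (- cnj (g (pr q)) + t * - cnj (C (pr q)))"
      "cnj (E3 q * (G (pr q) + \<rho> (pr q) * - M (pr q))) = cnj (E3 q) * (cnj (G (pr q)) + t * - M (pr q))"
      unfolding * by (simp_all add: M_facts(1)[OF assms] algebra_simps)
    show "cnj (E3 q * (- 3 * g (pr q) + \<rho> (pr q) * - cnj (C (pr q)))) =
        cnj (E3 q) * (- 3 * cnj (g (pr q)) + t * 1)"
      by (simp add: t_def)
  qed
  note cnj_Nu = this
  show ?thesis
    unfolding has_coform_ext_d[OF cf_Al'[OF assms]] has_coform_ext_d[OF cf_Nu[OF assms]]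
      has_coform_ext_d[OF cnj_Nu] wedge3_coform_iff[OF e_nz[OF assms]] det3_combine cond1_def
    using E_nz(1)[of q] Al_nz[OF assms] by simp
qed

lemma wedge3_Delta_Nu_iff:
  assumes "pr q \<in> S" "open V" "q \<in> V" "\<And>q. q \<in> V \<Longrightarrow> H q = E4 q * (G (pr q) - M (pr q) * \<rho> (pr q))"
  shows "wedge3 (ext_d Al q) (ext_d Nu q) (ext_d H q) = (\<lambda>X Y W. 0) \<longleftrightarrow> cond2 (pr q)"
proof -
  obtain \<tau> where "cf (\<lambda>q. E4 q * (G (pr q) - M (pr q) * \<rho> (pr q))) q
    (E4 q * (- 2 * G (pr q) + \<tau> * 1)) (E4 q * (- 4 * G (pr q) + \<tau> * - cnj (C (pr q))))
    (E4 q * (G' (pr q) + \<tau> * - M (pr q)))"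
    using cf_Delta_Nu[OF assms(1)] by blast
  from has_coform_cong[OF this assms(2,3)] assms(4)
  have H: "cf H q
    (E4 q * (- 2 * G (pr q) + \<tau> * 1)) (E4 q * (- 4 * G (pr q) + \<tau> * - cnj (C (pr q))))
    (E4 q * (G' (pr q) + \<tau> * - M (pr q)))" by simp
  show ?thesis
    unfolding has_coform_ext_d[OF cf_Al'[OF assms(1)]] has_coform_ext_d[OF cf_Nu[OF assms(1)]]
      has_coform_ext_d[OF H] wedge3_coform_iff[OF e_nz[OF assms(1)]] det3_combine cond2_def
    using E_nz[of q] Al_nz[OF assms(1)] by simp
qed

end

section \<open>Necessity\<close>

text \<open>Cramer's rule: z times the determinant is the determinant whose third column is the
  image of (x, y, z).\<close>

lemma det3_kernel:
  fixes z :: "'a::field"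
  assumes "a1 * x + a2 * y + a3 * z = 0" "b1 * x + b2 * y + b3 * z = 0" "c1 * x + c2 * y + c3 * z = 0" "z \<noteq> 0"
  shows "det3 a1 a2 a3 b1 b2 b3 c1 c2 c3 = 0"
proof -
  have "z * det3 a1 a2 a3 b1 b2 b3 c1 c2 c3 = (a1 * x + a2 * y + a3 * z) * (b1 * c2 - b2 * c1)
      - (b1 * x + b2 * y + b3 * z) * (a1 * c2 - a2 * c1) + (c1 * x + c2 * y + c3 * z) * (a1 * b2 - a2 * b1)"
    by (simp add: det3_def algebra_simps)
  also have "\<dots> = 0" unfolding assms(1,2,3) by simp
  finally show ?thesis using assms(4) by simp
qed

section \<open>The Killing condition as a transport equation for g\<close>

context wave_invariants
begin

lemma D2e_partials:
  assumes "x \<in> S"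
  shows "has_partials (D2 e) x 0 (2 * (M x * M x * e x) + 2 * (M x * w x) - D2 w x * (C x - 1))"
proof -
  have "has_partials (\<lambda>x. M x * e x - w x * (C x - 1)) x
     ((0 * e x + M x * (C x - 1)) - (M x * (C x - 1) + w x * (0 - 0)))
     ((M x * M x * e x + M x * (M x * e x - w x * (C x - 1))) - (D2 w x * (C x - 1) + w x * (0 - 0)))"
    by (intro has_partials_diff has_partials_mult has_partials_const e_partials M_facts(4)
        w_partials C_partials assms)
  then have "has_partials (D2 e) x
     ((0 * e x + M x * (C x - 1)) - (M x * (C x - 1) + w x * (0 - 0)))
     ((M x * M x * e x + M x * (M x * e x - w x * (C x - 1))) - (D2 w x * (C x - 1) + w x * (0 - 0)))"
    by (rule has_partials_cong[OF _ open_S assms]) (use e_partials has_partials_D(2) in metis)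
  moreover have "M x * (M x * e x - w x * (C x - 1)) = M x * M x * e x - w x * (C x * M x) + w x * M x"
    by (simp add: algebra_simps)
  ultimately show ?thesis
    unfolding M_facts(2)[OF assms] by (auto elim!: has_partials_eq simp: algebra_simps)
qed

context
  fixes x k s and \<theta> \<sigma> :: real
  assumes xS: "x \<in> S" and k: "k = - (of_real \<sigma> + \<i> * of_real \<theta>) / 2"
    and kC: "cnj k - C x * k - M x * of_real s = 0"
begin

lemma cnj_k: "cnj k = k + \<i> * of_real \<theta>"
  by (simp add: k complex_eq_iff)

lemma k2: "2 * k = - of_real \<sigma> - \<i> * of_real \<theta>"
  by (simp add: k)

text \<open>Multiply \<open>kC\<close> by M and use C M = - M and k + cnj k = - \<sigma>. Since M_u
  = M^2, this is the constancy of s M when s_u = \<sigma>.\<close>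

lemma M_\<sigma>: "M x * (of_real \<sigma> + of_real s * M x) = 0"
proof -
  have "M x * (of_real \<sigma> + of_real s * M x) = - (M x * (cnj k - C x * k - M x * of_real s))
      + M x * (2 * k + of_real \<sigma> + \<i> * of_real \<theta>) - (C x * M x + M x) * k"
    unfolding cnj_k by (simp add: algebra_simps)
  then show ?thesis unfolding kC k2 M_facts(2)[OF xS] by simp
qed

text \<open>The left side is the second u derivative of k e + s w when s_u = \<sigma>. On the right
  stands the operator that \<open>killing_condition_iff\<close> applies to g, here acting on its
  part P.\<close>

lemma x_uu:
  "k * D2 (D2 e) x + of_real s * D2 (D2 w) x + 2 * of_real \<sigma> * D2 w x =
    of_real s * D2 P x + (2 * of_real \<sigma> - \<i> * of_real \<theta>) * P x" (is "?L = ?R")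
proof -
  have "?L - ?R = D2 w x * (k + \<i> * of_real \<theta> - C x * k - M x * of_real s)
      + (w x + M x * e x) * M x * (2 * k + of_real \<sigma> + \<i> * of_real \<theta>)
      - 3 * (w x + M x * e x) * (M x * (of_real \<sigma> + of_real s * M x))"
    unfolding has_partials_D(2)[OF D2e_partials[OF xS]] has_partials_D(2)[OF P_partials[OF xS]] P_def
    by (simp add: algebra_simps)
  also have "\<dots> = 0" using kC unfolding cnj_k k2 M_\<sigma> by simp
  finally show ?thesis by simp
qed

text \<open>The counterpart of \<open>x_uu\<close> for R. The sign of \<theta> is opposite because R
  enters g through its conjugate.\<close>

lemma Q_zeta:
  "f11 x * (k * e x + of_real s * w x) + (\<i> * of_real \<theta> + 2 * of_real \<sigma>) * f1 x + f12 x * of_real s =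
    of_real s * D2 R x + (2 * of_real \<sigma> + \<i> * of_real \<theta>) * R x" (is "?L = ?R")
proof -
  have K: "f11 x * e x = K x * (C x + 3)"
    using C3_nz[OF xS] by (simp add: K_def)
  have "?L - ?R = f11 x * e x * k + K x * (of_real s * M x + 2 * of_real \<sigma> + \<i> * of_real \<theta>)"
    unfolding has_partials_D(2)[OF R_partials[OF xS]] R_def by (simp add: algebra_simps)
  also have "\<dots> = K x * (2 * (2 * k + of_real \<sigma> + \<i> * of_real \<theta>)
      - (k + \<i> * of_real \<theta> - C x * k - M x * of_real s))"
    unfolding K by (simp add: algebra_simps)
  also have "\<dots> = 0" using kC unfolding cnj_k k2 by simp
  finally show ?thesis by simp
qed

lemma killing_condition_iff:
  "f11 x * (k * e x + of_real s * w x) + (\<i> * of_real \<theta> + 2 * of_real \<sigma>) * f1 x + f12 x * of_real s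
    + cnj (k * D2 (D2 e) x + of_real s * D2 (D2 w) x + 2 * of_real \<sigma> * D2 w x) = 0 \<longleftrightarrow>
   of_real s * G x + (2 * of_real \<sigma> - \<i> * of_real \<theta>) * g x = 0" (is "?L = 0 \<longleftrightarrow> ?R = 0")
proof -
  have "?L = cnj ?R"
    unfolding x_uu Q_zeta by (simp add: g_def G_def algebra_simps)
  then show ?thesis by (metis complex_cnj_zero_iff)
qed

end

end

section \<open>Killing fields of the given wave\<close>

locale wave_killing = wave_invariants S "\<lambda>(z, u). f z u" A U
  for S f A U
begin

lemma killing_near_structure:
  assumes "killing_near (pp_metric f) p X" "pr p \<in> S"
  obtains V and \<theta> \<sigma> :: real and k where "open V" "convex V" "p \<in> V" "\<And>q. q \<in> V \<Longrightarrow> pr q \<in> S"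
    "killing_field S f V X"
    "k = - (of_real \<sigma> + \<i> * of_real \<theta>) / 2"
    "\<And>q. q \<in> V \<Longrightarrow> fst (X q) = k * e (pr q) + of_real (fst (snd (X q))) * w (pr q)"
    "\<And>q. q \<in> V \<Longrightarrow> ((\<lambda>q. fst (snd (X q))) has_derivative (\<lambda>v. \<sigma> * fst (snd v))) (at q)"
    "\<And>q. q \<in> V \<Longrightarrow> cnj k - C (pr q) * k - M (pr q) * of_real (fst (snd (X q))) = 0"
    "\<And>q. q \<in> V \<Longrightarrow> of_real (fst (snd (X q))) * G (pr q) + (2 * of_real \<sigma> - \<i> * of_real \<theta>) * g (pr q) = 0"
    "\<And>q. q \<in> V \<Longrightarrow> of_real (fst (snd (X q))) * G' (pr q) + (3 * of_real \<sigma> - \<i> * of_real \<theta>) * G (pr q) = 0"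
proof -
  obtain W where W: "open W" "p \<in> W" "smooth_on W X"
    "\<And>q Y Z. q \<in> W \<Longrightarrow> lie_derivative X (pp_metric f) q Y Z = 0"
    using assms(1) unfolding killing_near_def by blast
  have "open (W \<inter> pr -` S)" "p \<in> W \<inter> pr -` S"
    using W(1,2) open_pr assms(2) by auto
  then obtain r where r: "r > 0" "ball p r \<subseteq> W \<inter> pr -` S"
    using openE by blast
  define V where "V = ball p r"
  have V: "open V" "convex V" "p \<in> V" "\<And>q. q \<in> V \<Longrightarrow> pr q \<in> S"
    using r by (auto simp: V_def)
  have VW: "V \<subseteq> W" using r by (auto simp: V_def)
  have K: "killing_field S f V X"
    using open_S hol_\<phi> f11_nz V smooth_on_subset[OF W(3) VW] W(4) VW
    by unfold_locales auto
  interpret killing_field S f V X by (rule K)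
  obtain \<theta> \<sigma> :: real where st:
    "\<And>q. q \<in> V \<Longrightarrow> (xc has_derivative
      (\<lambda>v. \<i> * of_real \<theta> * fst v + pd eu xc q * of_real (fst (snd v)))) (at q)"
    "\<And>q. q \<in> V \<Longrightarrow> (pd eu xc has_derivative
      (\<lambda>v. pd eu (pd eu xc) q * of_real (fst (snd v)))) (at q)"
    "\<And>q. q \<in> V \<Longrightarrow> (s has_derivative (\<lambda>v. \<sigma> * fst (snd v))) (at q)"
    "\<And>q. q \<in> V \<Longrightarrow> D1 (D1 \<phi>) (pr q) * xc q + (\<i> * of_real \<theta> + 2 * of_real \<sigma>) * D1 \<phi> (pr q)
      + D2 (D1 \<phi>) (pr q) * of_real (s q) + cnj (pd eu (pd eu xc) q) = 0"
    "\<And>q. q \<in> V \<Longrightarrow> D1 (D1 (D1 \<phi>)) (pr q) * xc q + 2 * (\<i> * of_real \<theta> + of_real \<sigma>) * D1 (D1 \<phi>) (pr q)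
      + D2 (D1 (D1 \<phi>)) (pr q) * of_real (s q) = 0"
    using killing_structure[OF V(2)] by blast
  define k where "k = - (of_real \<sigma> + \<i> * of_real \<theta>) / (2::complex)"
  \<comment> \<open>Solve the equation for X f_\<zeta>\<zeta> for x, using the partial derivatives
    of f_\<zeta>\<zeta> = exp (4 A).\<close>
  have x: "xc q = k * e (pr q) + of_real (s q) * w (pr q)" if "q \<in> V" for q
  proof -
    define y where "y = pr q"
    have y: "y \<in> S" using V(4)[OF that] by (simp add: y_def)
    have "4 * f11 y / e y * xc q + 2 * (\<i> * of_real \<theta> + of_real \<sigma>) * f11 y
        + (- 4 * f11 y * w y / e y) * of_real (s q) = 0"
      using st(5)[OF that] unfolding has_partials_D[OF f11_partials[OF V(4)[OF that]]] y_def .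
    moreover have "4 * f11 y / e y * xc q + 2 * (\<i> * of_real \<theta> + of_real \<sigma>) * f11 y
        + (- 4 * f11 y * w y / e y) * of_real (s q)
        = 4 * f11 y / e y * (xc q - k * e y - of_real (s q) * w y)"
      using e_nz[OF y] by (simp add: k_def field_simps)
    ultimately have "4 * f11 y / e y * (xc q - k * e y - of_real (s q) * w y) = 0"
      by (rule back_subst[of "\<lambda>c. c = 0"])
    then have "xc q - k * e y - of_real (s q) * w y = 0"
      using e_nz[OF y] f11_nz[OF y] by (simp only: mult_eq_0_iff divide_eq_0_iff) simp
    then show ?thesis by (simp add: y_def algebra_simps)
  qed
  \<comment> \<open>Differentiate this formula for x and compare with \<open>st(1)\<close>: the
    \<zeta> direction gives \<theta>, the u direction gives x_u.\<close>
  have dx: "\<i> * of_real \<theta> = k * (C (pr q) - 1) + of_real (s q) * M (pr q)"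
    "pd eu xc q = k * D2 e (pr q) + of_real (s q) * D2 w (pr q) + of_real \<sigma> * w (pr q)"
    if "q \<in> V" for q
  proof -
    have "((\<lambda>q. k * e (pr q) + of_real (s q) * w (pr q)) has_derivative
        (\<lambda>v. k * (D1 e (pr q) * fst v + D2 e (pr q) * of_real (fst (snd v)))
          + (of_real (s q) * (M (pr q) * fst v + D2 w (pr q) * of_real (fst (snd v)))
          + of_real (\<sigma> * fst (snd v)) * w (pr q)))) (at q)"
      by (intro has_derivative_add has_derivative_mult_right has_derivative_mult has_derivative_of_real
          has_derivative_pr st(3) hp[OF hol_e] w_partials V(4) that)
    note * = pd_eqI[OF that x this]
    note ** = pd_eqI[OF that refl st(1)[OF that]]
    show "\<i> * of_real \<theta> = k * (C (pr q) - 1) + of_real (s q) * M (pr q)"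
      using *[of e1] **[of e1] by (simp add: C_def)
    show "pd eu xc q = k * D2 e (pr q) + of_real (s q) * D2 w (pr q) + of_real \<sigma> * w (pr q)"
      using *[of eu] by (simp add: algebra_simps)
  qed
  have kC: "cnj k - C (pr q) * k - M (pr q) * of_real (s q) = 0" if "q \<in> V" for q
  proof -
    have "cnj k = k + \<i> * of_real \<theta>" by (simp add: k_def complex_eq_iff)
    then show ?thesis unfolding dx(1)[OF that] by (simp add: algebra_simps)
  qed
  have duu: "pd eu (pd eu xc) q = k * D2 (D2 e) (pr q) + of_real (s q) * D2 (D2 w) (pr q)
      + 2 * of_real \<sigma> * D2 w (pr q)" if "q \<in> V" for q
  proof -
    have "((\<lambda>q. k * D2 e (pr q) + of_real (s q) * D2 w (pr q) + of_real \<sigma> * w (pr q)) has_derivative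
        (\<lambda>v. k * (D1 (D2 e) (pr q) * fst v + D2 (D2 e) (pr q) * of_real (fst (snd v)))
          + (of_real (s q) * (D1 (D2 w) (pr q) * fst v + D2 (D2 w) (pr q) * of_real (fst (snd v)))
          + of_real (\<sigma> * fst (snd v)) * D2 w (pr q))
          + of_real \<sigma> * (M (pr q) * fst v + D2 w (pr q) * of_real (fst (snd v))))) (at q)"
      by (intro has_derivative_add has_derivative_mult_right has_derivative_mult has_derivative_of_real
          has_derivative_pr st(3) hp[OF hol_partials(2)[OF hol_e]] hp[OF hol_partials(2)[OF hol_w]]
          w_partials V(4) that)
    from pd_eqI[OF that dx(2) this, of eu] show ?thesis by (simp add: algebra_simps)
  qed
  have n: "of_real (s q) * G (pr q) + (2 * of_real \<sigma> - \<i> * of_real \<theta>) * g (pr q) = 0" if "q \<in> V" for q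
    using st(4)[OF that] killing_condition_iff[OF V(4)[OF that] k_def kC[OF that]]
    unfolding x[OF that] duu[OF that] by simp
  \<comment> \<open>The du coefficient of the differential of \<open>n\<close>; the term s_u G
    raises 2 \<sigma> to 3 \<sigma>.\<close>
  have n': "of_real (s q) * G' (pr q) + (3 * of_real \<sigma> - \<i> * of_real \<theta>) * G (pr q) = 0" if "q \<in> V" for q
  proof -
    have "(s has_derivative (\<lambda>v. \<sigma> * fst (snd v))) (at q)" by (rule st(3)[OF that])
    then have "((\<lambda>q. of_real (s q)) has_derivative coform (e (pr q)) (w (pr q)) 0 0 (of_real \<sigma>)) (at q)"
      by (auto dest: has_derivative_of_real simp: coform_def)
    then have "cf (\<lambda>q. of_real (s q)) q 0 0 (of_real \<sigma>)"
      by (simp add: has_coform_def)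
    note cf = has_coform_add[OF has_coform_mult[OF this cf_G[OF V(4)[OF that]]]
        has_coform_cmult[OF cf_g[OF V(4)[OF that]]], of "2 * of_real \<sigma> - \<i> * of_real \<theta>"]
    have "cf (\<lambda>q. of_real (s q) * G (pr q) + (2 * of_real \<sigma> - \<i> * of_real \<theta>) * g (pr q)) q 0 0 0"
      by (rule has_coform_cong[OF has_coform_const V(1) that]) (simp add: n)
    from has_coform_unique(3)[OF cf this e_nz[OF V(4)[OF that]]] show ?thesis
      by (simp add: algebra_simps)
  qed
  show ?thesis
    using that[OF V K k_def] x st(3) kC n n' unfolding xc_def[abs_def] s_def[abs_def] by blast
qed

lemma killing_conditions:
  assumes "killing_near (pp_metric f) p X" "pr p \<in> S" "fst (snd (X p)) \<noteq> 0"
  shows "cond1 (pr p)" "cond2 (pr p)"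
proof -
  obtain V and \<theta> \<sigma> :: real and k where "p \<in> V" and k: "k = - (of_real \<sigma> + \<i> * of_real \<theta>) / 2"
    and *: "\<And>q. q \<in> V \<Longrightarrow> cnj k - C (pr q) * k - M (pr q) * of_real (fst (snd (X q))) = 0"
    "\<And>q. q \<in> V \<Longrightarrow> of_real (fst (snd (X q))) * G (pr q) + (2 * of_real \<sigma> - \<i> * of_real \<theta>) * g (pr q) = 0"
    "\<And>q. q \<in> V \<Longrightarrow> of_real (fst (snd (X q))) * G' (pr q) + (3 * of_real \<sigma> - \<i> * of_real \<theta>) * G (pr q) = 0"
    using killing_near_structure[OF assms(1,2)] by metis
  define s where "s = complex_of_real (fst (snd (X p)))"
  have s: "s \<noteq> 0" "cnj s = s" using assms(3) by (simp_all add: s_def)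
  note * = *[OF \<open>p \<in> V\<close>, folded s_def]
  have "cnj (cnj k - C (pr p) * k - M (pr p) * s) = 0"
    using *(1) by simp
  then have r1: "1 * k + (- cnj (C (pr p))) * cnj k + (- M (pr p)) * s = 0"
    by (simp add: M_facts(1)[OF assms(2)] s)
  \<comment> \<open>The exponents in \<open>E3\<close> and \<open>E4\<close>, paired with (k, cnj
    k), give the weights of g and G.\<close>
  have kk: "- k - 3 * cnj k = 2 * of_real \<sigma> - \<i> * of_real \<theta>"
    "- 2 * k - 4 * cnj k = 3 * of_real \<sigma> - \<i> * of_real \<theta>"
    by (simp_all add: k complex_eq_iff)
  have "(- g (pr p)) * k + (- 3 * g (pr p)) * cnj k + G (pr p) * s = s * G (pr p) + (- k - 3 * cnj k) * g (pr p)"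
    by (simp add: algebra_simps)
  then have r2: "(- g (pr p)) * k + (- 3 * g (pr p)) * cnj k + G (pr p) * s = 0"
    unfolding kk *(2) .
  then have "cnj ((- g (pr p)) * k + (- 3 * g (pr p)) * cnj k + G (pr p) * s) = 0" by simp
  then have r3: "(- 3 * cnj (g (pr p))) * k + (- cnj (g (pr p))) * cnj k + cnj (G (pr p)) * s = 0"
    by (simp add: s algebra_simps)
  have "(- 2 * G (pr p)) * k + (- 4 * G (pr p)) * cnj k + G' (pr p) * s =
      s * G' (pr p) + (- 2 * k - 4 * cnj k) * G (pr p)"
    by (simp add: algebra_simps)
  then have r4: "(- 2 * G (pr p)) * k + (- 4 * G (pr p)) * cnj k + G' (pr p) * s = 0"
    unfolding kk *(3) .
  show "cond1 (pr p)" unfolding cond1_def by (rule det3_kernel[OF r1 r2 r3 s(1)])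
  show "cond2 (pr p)" unfolding cond2_def by (rule det3_kernel[OF r1 r2 r4 s(1)])
qed

text \<open>With s = 0 at p the transport equations read (2 \<sigma> - i \<theta>) g = 0 and (3
  \<sigma> - i \<theta>) G = 0 there. One of g and G is nonzero, so \<sigma> = \<theta> = 0; then k
  and s vanish on V and x with them.\<close>

lemma killing_null_multiple:
  assumes "killing_near (pp_metric f) p X" "pr p \<in> S" "fst (snd (X p)) = 0"
  shows "\<exists>c. \<forall>\<^sub>F q in nhds p. X q = (0, 0, c)"
proof -
  obtain V and \<theta> \<sigma> :: real and k where V: "open V" "convex V" "p \<in> V" "killing_field S f V X"
    and k: "k = - (of_real \<sigma> + \<i> * of_real \<theta>) / 2"
    and x: "\<And>q. q \<in> V \<Longrightarrow> fst (X q) = k * e (pr q) + of_real (fst (snd (X q))) * w (pr q)"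
    and s: "\<And>q. q \<in> V \<Longrightarrow> ((\<lambda>q. fst (snd (X q))) has_derivative (\<lambda>v. \<sigma> * fst (snd v))) (at q)"
    and *: "of_real (fst (snd (X p))) * G (pr p) + (2 * of_real \<sigma> - \<i> * of_real \<theta>) * g (pr p) = 0"
    "of_real (fst (snd (X p))) * G' (pr p) + (3 * of_real \<sigma> - \<i> * of_real \<theta>) * G (pr p) = 0"
    using killing_near_structure[OF assms(1,2)] by metis
  interpret kf: killing_field S f V X by (rule V(4))
  have "2 * of_real \<sigma> - \<i> * of_real \<theta> = (0::complex) \<or> 3 * of_real \<sigma> - \<i> * of_real \<theta> = (0::complex)"
    using * g_G_nz[OF assms(2)] assms(3) by auto
  then have 0: "\<sigma> = 0" "\<theta> = 0" by (auto simp: complex_eq_iff)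
  have "\<exists>c. \<forall>q\<in>V. fst (snd (X q)) = c"
    using s 0 by (intro has_derivative_zero_constant[OF V(2)]) (simp add: has_derivative_at_withinI)
  then have s0: "fst (snd (X q)) = 0" if "q \<in> V" for q
    using that V(3) assms(3) by metis
  have "\<exists>c. \<forall>q\<in>V. X q = (0, 0, c)"
    using x s0 0 k by (intro kf.killing_vertical[OF V(2)]) (auto simp: kf.s_def)
  then obtain c where "\<And>q. q \<in> V \<Longrightarrow> X q = (0, 0, c)" by blast
  then show ?thesis
    using eventually_nhds_in_open[OF V(1,3)] by (auto elim!: eventually_mono)
qed

section \<open>Dimension of the space of Killing germs\<close>

lemma killing_near_vertical: "killing_near (pp_metric f) p (\<lambda>q. (0, 0, 1))" if "pr p \<in> S"
proof -
  have "lie_derivative (\<lambda>q. (0, 0, 1)) (pp_metric f) q Y W = 0" if "q \<in> pr -` S" for q Y W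
    using that unfolding lie_derivative_pp_metric[OF hp[OF hol_\<phi> that[unfolded vimage_def mem_Collect_eq]]]
    by (cases q; cases Y; cases W) (simp add: pp_metric_def frechet_derivative_const zero_prod_def)
  then show ?thesis
    unfolding killing_near_def using that open_pr smooth_on_const by (intro exI[of _ "pr -` S"]) auto
qed

lemma killing_near_combine:
  assumes "killing_near (pp_metric f) p X" "killing_near (pp_metric f) p Y" "pr p \<in> S"
  shows "killing_near (pp_metric f) p (\<lambda>q. X q + c *\<^sub>R Y q)"
proof -
  obtain V1 V2 where V: "open V1" "p \<in> V1" "smooth_on V1 X" "open V2" "p \<in> V2" "smooth_on V2 Y"
    and K: "\<And>q Z W. q \<in> V1 \<Longrightarrow> lie_derivative X (pp_metric f) q Z W = 0"
    "\<And>q Z W. q \<in> V2 \<Longrightarrow> lie_derivative Y (pp_metric f) q Z W = 0"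
    using assms(1,2) unfolding killing_near_def by metis
  define V where "V = V1 \<inter> V2 \<inter> pr -` S"
  have oV: "open V" using V open_pr by (auto simp: V_def)
  have sm: "smooth_on V X" "smooth_on V Y"
    using V(3,6) by (auto intro: smooth_on_subset simp: V_def)
  have "lie_derivative (\<lambda>q. X q + c *\<^sub>R Y q) (pp_metric f) q Z W = 0" if "q \<in> V" for q Z W
  proof -
    have q: "q \<in> V1" "q \<in> V2" "pr q \<in> S" using that by (auto simp: V_def)
    define DX DY where "DX = frechet_derivative X (at q)" and "DY = frechet_derivative Y (at q)"
    have "((\<lambda>q. X q + c *\<^sub>R Y q) has_derivative (\<lambda>v. DX v + c *\<^sub>R DY v)) (at q)"
      unfolding DX_def DY_def
      by (intro has_derivative_add has_derivative_scaleR_right smooth_on_has_derivative[OF sm(1) that]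
          smooth_on_has_derivative[OF sm(2) that])
    from frechet_derivative_at[OF this]
    have D: "frechet_derivative (\<lambda>q. X q + c *\<^sub>R Y q) (at q) = (\<lambda>v. DX v + c *\<^sub>R DY v)" by simp
    note L = lie_derivative_pp_metric[OF hp[OF hol_\<phi> q(3)]]
    have bil: "pp_metric f q (a + c *\<^sub>R b) d = pp_metric f q a d + c * pp_metric f q b d"
      "pp_metric f q d (a + c *\<^sub>R b) = pp_metric f q d a + c * pp_metric f q d b" for a b d
      by (cases q; cases a; cases b; cases d; simp add: pp_metric_def algebra_simps)+
    have "lie_derivative (\<lambda>q. X q + c *\<^sub>R Y q) (pp_metric f) q Z W =
        lie_derivative X (pp_metric f) q Z W + c * lie_derivative Y (pp_metric f) q Z W"
      unfolding L D bil DX_def[symmetric] DY_def[symmetric]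
      by (simp add: algebra_simps)
    then show ?thesis using K q by simp
  qed
  moreover have "smooth_on V (\<lambda>q. X q + c *\<^sub>R Y q)"
    by (rule smooth_on_add[OF oV sm(1) smooth_on_bounded_linear[OF oV bounded_linear_scaleR_right sm(2)]])
  ultimately show ?thesis
    unfolding killing_near_def using oV V(2,5) assms(3) by (intro exI[of _ V]) (auto simp: V_def)
qed

text \<open>Evaluating the u component at p is a linear functional on Killing germs whose kernel is
  spanned by the vertical field, by \<open>killing_null_multiple\<close>. The dimension is therefore
  2 exactly if the functional is nonzero.\<close>

lemma killing_germs_dim_2_iff:
  assumes "pr p \<in> S"
  shows "killing_germs_dim (pp_metric f) p 2 \<longleftrightarrow>
    (\<exists>X. killing_near (pp_metric f) p X \<and> fst (snd (X p)) \<noteq> 0)"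
proof
  assume "killing_germs_dim (pp_metric f) p 2"
  then obtain B :: "nat \<Rightarrow> point \<Rightarrow> tangent" where
    B: "\<And>i. i < 2 \<Longrightarrow> killing_near (pp_metric f) p (B i)" and
    ind: "\<And>c :: nat \<Rightarrow> real. (\<forall>\<^sub>F q in nhds p. (\<Sum>i<2. c i *\<^sub>R B i q) = 0) \<Longrightarrow> (\<forall>i<2. c i = 0)"
    unfolding killing_germs_dim_def by blast
  show "\<exists>X. killing_near (pp_metric f) p X \<and> fst (snd (X p)) \<noteq> 0"
  proof (rule ccontr)
    assume "\<nexists>X. killing_near (pp_metric f) p X \<and> fst (snd (X p)) \<noteq> 0"
    then have z: "fst (snd (B i p)) = 0" if "i < 2" for i using B that by blast
    obtain c0 where c0: "\<forall>\<^sub>F q in nhds p. B 0 q = (0, 0, c0)"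
      using killing_null_multiple[OF B assms z, of 0] by auto
    obtain c1 where c1: "\<forall>\<^sub>F q in nhds p. B 1 q = (0, 0, c1)"
      using killing_null_multiple[OF B assms z, of 1] by auto
    \<comment> \<open>Coefficients of a relation between two vertical fields; the case c0 = 0 is
      separated so that they are never both zero.\<close>
    define c where "c i = (if c0 = 0 then (if i = (0::nat) then 1 else 0) else if i = 0 then c1 else - c0)" for i
    have "\<forall>\<^sub>F q in nhds p. (\<Sum>i<2. c i *\<^sub>R B i q) = 0"
      using eventually_conj[OF c0 c1] by (rule eventually_mono) (auto simp: c_def numeral_2_eq_2 zero_prod_def)
    from ind[OF this] have "c 0 = 0" "c 1 = 0" by auto
    then show False by (auto simp: c_def split: if_splits)
  qed
next
  assume "\<exists>X. killing_near (pp_metric f) p X \<and> fst (snd (X p)) \<noteq> 0"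
  then obtain X where X: "killing_near (pp_metric f) p X" "fst (snd (X p)) \<noteq> 0" by blast
  define B :: "nat \<Rightarrow> point \<Rightarrow> tangent" where "B i = (if i = 0 then (\<lambda>q. (0, 0, 1)) else X)" for i
  have sum: "(\<Sum>i<2. c i *\<^sub>R B i q) = (0, 0, c 0) + c 1 *\<^sub>R X q" for c q
    by (simp add: B_def numeral_2_eq_2)
  have indep: "\<forall>i<2. c i = 0" if "\<forall>\<^sub>F q in nhds p. (\<Sum>i<2. c i *\<^sub>R B i q) = 0" for c :: "nat \<Rightarrow> real"
  proof -
    have *: "(0, 0, c 0) + c 1 *\<^sub>R X p = 0"
      using eventually_nhds_x_imp_x[OF that] unfolding sum .
    then have "fst (snd ((0 :: complex, 0 :: real, c 0) + c 1 *\<^sub>R X p)) = 0" by (simp only:) simp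
    then have "c 1 = 0" using X(2) by simp
    moreover from this * have "c 0 = 0" by (simp add: zero_prod_def)
    ultimately show ?thesis by (auto simp: less_Suc_eq numeral_2_eq_2)
  qed
  have span: "\<exists>c :: nat \<Rightarrow> real. \<forall>\<^sub>F q in nhds p. Y q = (\<Sum>i<2. c i *\<^sub>R B i q)"
    if Y: "killing_near (pp_metric f) p Y" for Y
  proof -
    define l where "l = fst (snd (Y p)) / fst (snd (X p))"
    have "killing_near (pp_metric f) p (\<lambda>q. Y q + (- l) *\<^sub>R X q)"
      by (rule killing_near_combine[OF Y X(1) assms])
    moreover have "fst (snd (Y p + (- l) *\<^sub>R X p)) = 0" using X(2) by (simp add: l_def)
    ultimately obtain c0 where "\<forall>\<^sub>F q in nhds p. Y q + (- l) *\<^sub>R X q = (0, 0, c0)"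
      using killing_null_multiple assms by blast
    then have "\<forall>\<^sub>F q in nhds p. Y q = (\<Sum>i<2. (if i = 0 then c0 else l) *\<^sub>R B i q)"
    proof (rule eventually_mono)
      fix q assume "Y q + (- l) *\<^sub>R X q = (0, 0, c0)"
      then have "Y q = (0, 0, c0) + l *\<^sub>R X q" by (simp add: algebra_simps)
      then show "Y q = (\<Sum>i<2. (if i = 0 then c0 else l) *\<^sub>R B i q)" unfolding sum by simp
    qed
    then show ?thesis by (rule exI[of _ "\<lambda>i. if i = 0 then c0 else l"])
  qed
  have "\<forall>i<2. killing_near (pp_metric f) p (B i)"
    using X(1) killing_near_vertical[OF assms] by (simp add: B_def)
  with indep span show "killing_germs_dim (pp_metric f) p 2"
    unfolding killing_germs_dim_def by (intro exI[of _ B] conjI allI impI) simp_all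
qed

end

section \<open>Existence of a second Killing field\<close>

text \<open>H has no \<zeta> derivative and hence depends on u alone on the box, so integrating it
  over u at the centre z0 suffices.\<close>

lemma antiderivative_box:
  fixes H :: "complex \<times> real \<Rightarrow> real"
  assumes "r > 0" "smooth_on (ball z0 r \<times> ball u0 r) H"
    and dH: "\<And>x. x \<in> ball z0 r \<times> ball u0 r \<Longrightarrow> (H has_derivative (\<lambda>v. snd v * h x)) (at x)"
  shows "\<exists>\<Phi>. \<forall>x\<in>ball z0 r \<times> ball u0 (r / 2). (\<Phi> has_derivative (\<lambda>v. snd v * H x)) (at x)"
proof -
  have slice: "H (z, u) = H (z0, u)" if "z \<in> ball z0 r" "u \<in> ball u0 r" for z u
  proof -
    have "((\<lambda>z. H (z, u)) has_derivative (\<lambda>k. 0)) (at z within ball z0 r)" if "z \<in> ball z0 r" for z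
    proof -
      have "((\<lambda>z. (z, u)) has_derivative (\<lambda>k. (k, 0))) (at z)"
        by (intro has_derivative_Pair has_derivative_ident has_derivative_const)
      from has_derivative_compose[OF this dH] that \<open>u \<in> ball u0 r\<close> show ?thesis
        by (simp add: has_derivative_at_withinI)
    qed
    then have "\<exists>c. \<forall>z\<in>ball z0 r. H (z, u) = c"
      by (intro has_derivative_zero_constant convex_ball)
    then show ?thesis using that \<open>r > 0\<close> by (metis centre_in_ball)
  qed
  \<comment> \<open>Halving the radius leaves a closed interval inside the ball, where the
    continuous H has an antiderivative.\<close>
  have sub: "{u0 - r / 2 .. u0 + r / 2} \<subseteq> ball u0 r"
    using \<open>r > 0\<close> by (auto simp: dist_real_def)
  have "continuous_on {u0 - r / 2 .. u0 + r / 2} (\<lambda>u. H (z0, u))"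
  proof (rule continuous_on_compose2[OF smooth_on_continuous[OF assms(2)]])
    show "continuous_on {u0 - r / 2 .. u0 + r / 2} (\<lambda>u. (z0, u))"
      by (intro continuous_intros)
    show "(\<lambda>u. (z0, u)) ` {u0 - r / 2 .. u0 + r / 2} \<subseteq> ball z0 r \<times> ball u0 r"
      using sub \<open>r > 0\<close> by auto
  qed
  then obtain \<psi> where \<psi>: "\<And>u. u \<in> {u0 - r / 2 .. u0 + r / 2} \<Longrightarrow>
      (\<psi> has_vector_derivative H (z0, u)) (at u within {u0 - r / 2 .. u0 + r / 2})"
    using antiderivative_continuous by blast
  have "((\<lambda>x. \<psi> (snd x)) has_derivative (\<lambda>v. snd v * H x)) (at x)"
    if "x \<in> ball z0 r \<times> ball u0 (r / 2)" for x
  proof -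
    have "\<bar>u0 - snd x\<bar> < r / 2" "fst x \<in> ball z0 r"
      using that by (auto simp: dist_real_def)
    then have u: "snd x \<in> {u0 - r / 2 <..< u0 + r / 2}" "fst x \<in> ball z0 r"
      unfolding greaterThanLessThan_iff by linarith+
    then have "at (snd x) within {u0 - r / 2 .. u0 + r / 2} = at (snd x)"
      by (intro at_within_Icc_at) auto
    then have "(\<psi> has_derivative (\<lambda>k. k *\<^sub>R H (z0, snd x))) (at (snd x))"
      using \<psi>[of "snd x"] u by (simp add: has_vector_derivative_def)
    from has_derivative_compose[OF has_derivative_snd[OF has_derivative_ident] this]
    have "((\<lambda>x. \<psi> (snd x)) has_derivative (\<lambda>v. snd v *\<^sub>R H (z0, snd x))) (at x)" .
    moreover have "H (z0, snd x) = H x"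
      using slice[of "fst x" "snd x"] u sub by (auto simp: dist_real_def)
    ultimately show ?thesis by simp
  qed
  then show ?thesis by blast
qed

section \<open>Solving the determinant conditions\<close>

context wave_invariants
begin

lemma cond_consequences:
  assumes "x \<in> S" "cond1 x" "cond2 x"
  defines "p \<equiv> G x / g x"
  shows "g x \<noteq> 0" "p * (1 + 3 * cnj (C x)) - cnj p * (3 + cnj (C x)) + 8 * M x = 0"
    "(G' x * g x - G x * G x) / (g x * g x) = p * of_real (Re p / 2)"
proof -
  have c1: "G x * cnj (g x) * (1 + 3 * cnj (C x)) - cnj (G x) * g x * (3 + cnj (C x))
      + 8 * M x * g x * cnj (g x) = 0"
    using assms(2) by (simp add: cond1_def det3_def algebra_simps)
  have c2: "- g x * G' x * (3 + cnj (C x)) + G x * G x * (4 + 2 * cnj (C x)) + 2 * M x * g x * G x = 0"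
    using assms(3) by (simp add: cond2_def det3_def algebra_simps)
  \<comment> \<open>With g = 0 the second condition leaves G^2 (4 + 2 cnj C) = 0, hence C = - 2,
    against |C| = 1.\<close>
  show g: "g x \<noteq> 0"
  proof
    assume "g x = 0"
    then have "G x \<noteq> 0" using g_G_nz[OF assms(1)] by simp
    then have "4 + 2 * cnj (C x) = 0" using c2 \<open>g x = 0\<close> by simp
    then have "2 * cnj (C x) = 2 * (- 2)" by (simp add: eq_neg_iff_add_eq_0 add.commute)
    then have "cnj (C x) = - 2" by (simp only: mult_cancel_left) simp
    then have "C x = cnj (- 2)" by (metis complex_cnj_cnj)
    then show False using CC_MC(1)[OF assms(1)] by simp
  qed
  have G: "G x = p * g x" using g by (simp add: p_def)
  have "g x * cnj (g x) * (p * (1 + 3 * cnj (C x)) - cnj p * (3 + cnj (C x)) + 8 * M x) = 0"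
    using c1 unfolding G by (simp add: algebra_simps)
  then show 1: "p * (1 + 3 * cnj (C x)) - cnj p * (3 + cnj (C x)) + 8 * M x = 0"
    using g by simp
  define t where "t = G' x / g x"
  have G': "G' x = t * g x" using g by (simp add: t_def)
  have "g x * g x * (- t * (3 + cnj (C x)) + p * p * (4 + 2 * cnj (C x)) + 2 * M x * p) = 0"
    using c2 unfolding G G' by (simp add: algebra_simps)
  then have 2: "- t * (3 + cnj (C x)) + p * p * (4 + 2 * cnj (C x)) + 2 * M x * p = 0"
    using g by simp
  \<comment> \<open>- 4 times the second condition plus p times the first eliminates M; the common
    factor cnj C + 3 is nonzero.\<close>
  have "4 * ((t - p * p) - p * ((p + cnj p) / 4)) * (cnj (C x) + 3) =
      - 4 * (- t * (3 + cnj (C x)) + p * p * (4 + 2 * cnj (C x)) + 2 * M x * p)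
      + p * (p * (1 + 3 * cnj (C x)) - cnj p * (3 + cnj (C x)) + 8 * M x)"
    by (simp add: algebra_simps)
  then have "4 * ((t - p * p) - p * ((p + cnj p) / 4)) * (cnj (C x) + 3) = 0"
    unfolding 1 2 by simp
  then have "t - p * p - p * ((p + cnj p) / 4) = 0"
    using C3_nz[OF assms(1)] by (simp only: mult_eq_0_iff add.commute) simp
  then have "t - p * p = p * ((p + cnj p) / 4)" by (simp only: right_minus_eq)
  moreover have "(p + cnj p) / 4 = of_real (Re p / 2)" by (simp add: complex_eq_iff)
  moreover have "(G' x * g x - G x * G x) / (g x * g x) = t - p * p"
    using g unfolding G G' by (simp add: field_simps)
  ultimately show "(G' x * g x - G x * G x) / (g x * g x) = p * of_real (Re p / 2)" by simp
qed

lemma partials_du: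
  assumes "has_partials H x 0 h"
  shows "(H has_derivative (\<lambda>v. of_real (snd v) * h)) (at x)"
  using assms by (simp add: has_partials_def mult.commute)

lemma g_G_du:
  assumes "x \<in> S"
  shows "(g has_derivative (\<lambda>v. of_real (snd v) * G x)) (at x)"
    "(G has_derivative (\<lambda>v. of_real (snd v) * G' x)) (at x)"
proof -
  have "has_partials P x 0 (D2 P x)" "has_partials R x 0 (D2 R x)"
    using P_partials[OF assms] R_partials[OF assms] has_partials_D(2) by metis+
  from has_derivative_add[OF partials_du[OF this(1)] has_derivative_cnj[OF partials_du[OF this(2)]]]
  show "(g has_derivative (\<lambda>v. of_real (snd v) * G x)) (at x)"
    by (simp add: g_def[abs_def] G_def algebra_simps)
  from has_derivative_add[OF partials_du[OF DP_partials[OF assms]]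
      has_derivative_cnj[OF partials_du[OF DR_partials[OF assms]]]]
  show "(G has_derivative (\<lambda>v. of_real (snd v) * G' x)) (at x)"
    by (simp add: G_def[abs_def] G'_def algebra_simps)
qed

lemma smooth_g_G: "smooth_on S g" "smooth_on S G"
  unfolding g_def[abs_def] G_def[abs_def]
  by (rule smooth_on_add[OF open_S _ smooth_on_bounded_linear[OF open_S bounded_linear_cnj]];
      rule hol_smooth_smooth_on; intro hol_partials hol_P hol_R)+

lemma killing_parameters:
  assumes "\<And>x. x \<in> S \<Longrightarrow> cond1 x \<and> cond2 x" "y \<in> S"
  obtains B s and \<theta> \<sigma> :: real where "open B" "B \<subseteq> S" "y \<in> B" "\<And>x. s x \<noteq> 0"
    "\<And>x. x \<in> B \<Longrightarrow> (s has_derivative (\<lambda>v. snd v * \<sigma>)) (at x)"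
    "\<And>x k. x \<in> B \<Longrightarrow> k = - (of_real \<sigma> + \<i> * of_real \<theta>) / 2 \<Longrightarrow> cnj k - C x * k - M x * of_real (s x) = 0"
    "\<And>x. x \<in> B \<Longrightarrow> of_real (s x) * G x + (2 * of_real \<sigma> - \<i> * of_real \<theta>) * g x = 0"
    "\<exists>r>0. B = ball (fst y) r \<times> ball (snd y) r"
proof -
  obtain z0 u0 where y: "y = (z0, u0)" by (cases y) auto
  obtain U1 U2 where U: "open U1" "open U2" "y \<in> U1 \<times> U2" "U1 \<times> U2 \<subseteq> S"
    using open_S assms(2) by (metis open_prod_elim)
  obtain r1 where r1: "r1 > 0" "ball z0 r1 \<subseteq> U1" using U y by (metis mem_Sigma_iff openE)
  obtain r2 where r2: "r2 > 0" "ball u0 r2 \<subseteq> U2" using U y by (metis mem_Sigma_iff openE)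
  define r where "r = min r1 r2"
  have r: "r > 0" using r1 r2 by (simp add: r_def)
  have BS: "ball z0 r \<times> ball u0 r \<subseteq> S"
    using r1 r2 U by (fastforce simp: r_def)
  define p where "p x = G x / g x" for x
  have gnz: "g x \<noteq> 0" if "x \<in> S" for x using cond_consequences(1) assms(1) that by blast
  have dp: "(p has_derivative (\<lambda>v. of_real (snd v) * (p x * of_real (Re (p x) / 2)))) (at x)" if "x \<in> S" for x
  proof -
    have eq: "(G' x * g x - G x * G x) / (g x * g x) = p x * of_real (Re (p x) / 2)"
      unfolding p_def using cond_consequences(3) assms(1) that by blast
    have "(p has_derivative (\<lambda>v. (of_real (snd v) * G' x * g x - G x * (of_real (snd v) * G x)) / (g x * g x))) (at x)"
      unfolding p_def[abs_def] by (rule has_derivative_divide'[OF g_G_du(2,1)[OF that] gnz[OF that]])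
    moreover have "(of_real (snd v) * G' x * g x - G x * (of_real (snd v) * G x)) / (g x * g x) =
        of_real (snd v) * ((G' x * g x - G x * G x) / (g x * g x))" for v :: "complex \<times> real"
      by (simp add: algebra_simps diff_divide_distrib)
    ultimately show ?thesis unfolding eq by simp
  qed
  have smooth_p: "smooth_on S p"
    unfolding p_def[abs_def] by (rule smooth_on_divide[OF open_S smooth_g_G(2,1) gnz])
  define H where "H x = Re (p x) / 2" for x
  have "smooth_on (ball z0 r \<times> ball u0 r) H"
    unfolding H_def[abs_def]
    by (rule smooth_on_subset[OF smooth_on_bounded_linear[OF open_S
          bounded_linear_compose[OF bounded_linear_divide bounded_linear_Re] smooth_p] BS])
  note smooth_H = this
  have dRe: "((\<lambda>x. Re (p x) / 2) has_derivative
      (\<lambda>v. Re (of_real (snd v) * (p x * of_real (Re (p x) / 2))) / 2)) (at x)"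
    if "x \<in> S" for x
    by (rule bounded_linear.has_derivative[OF bounded_linear_compose[OF bounded_linear_divide bounded_linear_Re] dp[OF that]])
  have dH: "(H has_derivative (\<lambda>v. snd v * (Re (p x) * (Re (p x) / 2) / 2))) (at x)"
    if "x \<in> ball z0 r \<times> ball u0 r" for x
  proof -
    have "x \<in> S" using that BS by blast
    from dRe[OF this] show ?thesis unfolding H_def[abs_def] by (simp add: algebra_simps)
  qed
  obtain \<Phi> where \<Phi>: "\<And>x. x \<in> ball z0 r \<times> ball u0 (r / 2) \<Longrightarrow>
      (\<Phi> has_derivative (\<lambda>v. snd v * H x)) (at x)"
    using antiderivative_box[OF r smooth_H dH] by blast
  \<comment> \<open>The \<zeta> ball is halved as well, so that B has equal radii, as a second use
    of \<open>antiderivative_box\<close> requires.\<close>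
  define B where "B = ball z0 (r / 2) \<times> ball u0 (r / 2)"
  have B: "open B" "convex B" "y \<in> B" "B \<subseteq> S" "B \<subseteq> ball z0 r \<times> ball u0 (r / 2)"
    using r BS by (auto simp: B_def y open_Times convex_Times)
  define s where "s x = exp (- \<Phi> x)" for x
  have ds: "(s has_derivative (\<lambda>v. - (snd v * H x) * s x)) (at x)" if "x \<in> B" for x
  proof -
    have "((\<lambda>x. - \<Phi> x) has_derivative (\<lambda>v. - (snd v * H x))) (at x)"
      using \<Phi> B that by (intro has_derivative_minus) blast
    from has_derivative_exp[OF this] show ?thesis by (simp add: s_def[abs_def])
  qed
  \<comment> \<open>p grows at the relative rate Re p / 2 and s decays at the same rate, so p s is
    constant.\<close>
  have "((\<lambda>x. p x * of_real (s x)) has_derivative (\<lambda>v. 0)) (at x within B)" if "x \<in> B" for x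
  proof -
    have "((\<lambda>x. p x * of_real (s x)) has_derivative (\<lambda>v. p x * of_real (- (snd v * H x) * s x)
        + of_real (snd v) * (p x * of_real (Re (p x) / 2)) * of_real (s x))) (at x)"
      using that B by (intro has_derivative_mult has_derivative_of_real ds dp) auto
    moreover have "p x * of_real (- (snd v * H x) * s x)
        + of_real (snd v) * (p x * of_real (Re (p x) / 2)) * of_real (s x) = 0" for v :: "complex \<times> real"
      by (simp add: H_def)
    ultimately have "((\<lambda>x. p x * of_real (s x)) has_derivative (\<lambda>v. 0)) (at x)"
      by (simp only:)
    then show ?thesis by (rule has_derivative_at_withinI)
  qed
  then obtain c where c: "\<And>x. x \<in> B \<Longrightarrow> p x * of_real (s x) = c"
    using has_derivative_zero_constant[OF B(2), of "\<lambda>x. p x * of_real (s x)"] by blast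
  \<comment> \<open>Forced by the equation for g: with G = p g it reads s p = - (2 \<sigma> - i
    \<theta>). Then s_u = - s Re p / 2 is indeed \<sigma>.\<close>
  define \<sigma> \<theta> where "\<sigma> = - Re c / 2" and "\<theta> = Im c"
  have st: "2 * of_real \<sigma> - \<i> * of_real \<theta> = - c"
    by (simp add: \<sigma>_def \<theta>_def complex_eq_iff)
  have s_nz: "s x \<noteq> 0" for x by (simp add: s_def)
  have ds': "(s has_derivative (\<lambda>v. snd v * \<sigma>)) (at x)" if "x \<in> B" for x
  proof -
    have "- (snd v * H x) * s x = snd v * \<sigma>" for v :: "complex \<times> real"
      using arg_cong[OF c[OF that], of Re] by (simp add: H_def \<sigma>_def)
    then show ?thesis using ds[OF that] by simp
  qed
  have n: "of_real (s x) * G x + (2 * of_real \<sigma> - \<i> * of_real \<theta>) * g x = 0" if "x \<in> B" for x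
    using gnz[of x] that B(4) unfolding st c[OF that, symmetric] p_def by auto
  have kC: "cnj k - C x * k - M x * of_real (s x) = 0"
    if "x \<in> B" and k: "k = - (of_real \<sigma> + \<i> * of_real \<theta>) / 2" for x k
  proof -
    have xS: "x \<in> S" using that B by blast
    have 1: "p x * (1 + 3 * cnj (C x)) - cnj (p x) * (3 + cnj (C x)) + 8 * M x = 0"
      unfolding p_def using cond_consequences(2) assms(1) xS by blast
    \<comment> \<open>k in terms of p; with it the conjugate of the required equation is - s / 8
      times the first condition.\<close>
    have k8: "8 * k = of_real (s x) * (3 * cnj (p x) - p x)" "8 * cnj k = of_real (s x) * (3 * p x - cnj (p x))"
      unfolding k \<sigma>_def \<theta>_def c[OF that(1), symmetric] by (simp_all add: complex_eq_iff field_simps)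
    have "8 * (k - cnj (C x) * cnj k - M x * of_real (s x)) =
        8 * k - cnj (C x) * (8 * cnj k) - 8 * M x * of_real (s x)" by (simp add: algebra_simps)
    also have "\<dots> = - of_real (s x) * (p x * (1 + 3 * cnj (C x)) - cnj (p x) * (3 + cnj (C x)) + 8 * M x)"
      unfolding k8 by (simp add: algebra_simps)
    also have "\<dots> = 0" unfolding 1 by simp
    finally have "k - cnj (C x) * cnj k - M x * of_real (s x) = 0"
      by (simp only: mult_eq_0_iff) simp
    then have "cnj (k - cnj (C x) * cnj k - M x * of_real (s x)) = 0" by simp
    then show ?thesis by (simp add: M_facts(1)[OF xS])
  qed
  show ?thesis
  proof (rule that[OF B(1,4,3) s_nz ds' kC n])
    show "\<exists>r>0. B = ball (fst y) r \<times> ball (snd y) r"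
      by (rule exI[of _ "r / 2"]) (simp add: B_def y r)
  qed
qed

end

section \<open>Construction of the field\<close>

context wave_killing
begin

text \<open>The prescribed derivative already satisfies every component of the Killing equation
  except the uu one, which is the last hypothesis; t is the du coefficient of the v
  component.\<close>

lemma lie_derivative_zero:
  assumes "pr q \<in> S"
    and dX: "(X has_derivative (\<lambda>v. (\<i> * of_real \<theta> * fst v + xu * of_real (fst (snd v)), fst (snd v) * \<sigma>,
      2 * Re (xu * cnj (fst v)) + t * fst (snd v) - snd (snd v) * \<sigma>))) (at q)"
    and t: "2 * Re (f1 (pr q) * fst (X q) + D2 (\<lambda>(z, u). f z u) (pr q) * of_real (fst (snd (X q)))
      + 2 * of_real \<sigma> * f (fst q) (fst (snd q))) + t = 0"
  shows "lie_derivative X (pp_metric f) q Y W = 0"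
proof -
  obtain z u v where q: "q = (z, u, v)" by (cases q) auto
  obtain y yu yv where Y: "Y = (y, yu, yv)" by (cases Y) auto
  obtain y' yu' yv' where W: "W = (y', yu', yv')" by (cases W) auto
  define a where "a = Re (f1 (pr q) * fst (X q) + D2 (\<lambda>(z, u). f z u) (pr q) * of_real (fst (snd (X q))))"
  have t: "t = - 2 * a - 4 * \<sigma> * Re (f z u)" using t by (simp add: a_def q)
  show ?thesis
    unfolding lie_derivative_pp_metric[OF hp[OF hol_\<phi> assms(1)]] frechet_derivative_at[OF dX, symmetric] a_def[symmetric]
    unfolding t q Y W pp_metric_def by (simp add: algebra_simps)
qed

lemma killing_exists:
  assumes "\<And>x. x \<in> S \<Longrightarrow> cond1 x \<and> cond2 x" "pr p \<in> S"
  shows "\<exists>X. killing_near (pp_metric f) p X \<and> fst (snd (X p)) \<noteq> 0"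
proof -
  let ?\<phi> = "\<lambda>(z, u). f z u"
  obtain B s and \<theta> \<sigma> :: real where B: "open B" "B \<subseteq> S" "pr p \<in> B" "\<And>x. s x \<noteq> 0"
    and ds: "\<And>x. x \<in> B \<Longrightarrow> (s has_derivative (\<lambda>v. snd v * \<sigma>)) (at x)"
    and kC': "\<And>x k. x \<in> B \<Longrightarrow> k = - (of_real \<sigma> + \<i> * of_real \<theta>) / 2 \<Longrightarrow> cnj k - C x * k - M x * of_real (s x) = 0"
    and n: "\<And>x. x \<in> B \<Longrightarrow> of_real (s x) * G x + (2 * of_real \<sigma> - \<i> * of_real \<theta>) * g x = 0"
    and "\<exists>r>0. B = ball (fst (pr p)) r \<times> ball (snd (pr p)) r"
    using killing_parameters[OF assms] by metis
  then obtain r where r: "r > 0" and Br: "B = ball (fst (pr p)) r \<times> ball (snd (pr p)) r" by blast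
  define z0 where "z0 = fst (pr p)"
  define u0 where "u0 = snd (pr p)"
  note Br = Br[folded z0_def u0_def]
  define k :: complex where "k = - (of_real \<sigma> + \<i> * of_real \<theta>) / 2"
  note kC = kC'[OF _ k_def]
  have BS: "x \<in> S" if "x \<in> B" for x using that B(2) by blast
  have smooth_s: "smooth_on B s"
    by (rule smooth_on_Suc[OF B(1) ds smooth_on_const])
  define c :: complex where "c = 2 * of_real \<sigma> - \<i> * of_real \<theta>"
  define x where "x q = k * e q + of_real (s q) * w q" for q
  define xu where "xu q = k * D2 e q + of_real (s q) * D2 w q + of_real \<sigma> * w q" for q
  \<comment> \<open>The second u derivative of x in the form of the lemma \<open>x_uu\<close>: it
    involves only P, which has no \<zeta> derivative.\<close>
  define xuu where "xuu q = of_real (s q) * D2 P q + c * P q" for q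
  \<comment> \<open>For a v component 2 Re (x_u cnj \<zeta>) + T - \<sigma> v the uu equation
    becomes T_u = - 2 Re Y. Inside the real part the x_uu term is conjugated, which makes Y
    holomorphic in \<zeta>.\<close>
  define Y where "Y q = f1 q * x q + D2 ?\<phi> q * of_real (s q) + 2 * of_real \<sigma> * ?\<phi> q + cnj (xuu q) * fst q" for q
  have dF: "(F has_derivative (\<lambda>v. D1 F q * fst v + D2 F q * of_real (snd v))) (at q)"
    if "hol_smooth S F" "q \<in> B" for F q
    using hp[OF that(1) BS[OF that(2)]] by (simp add: has_partials_def)
  have dsc: "((\<lambda>q. of_real (s q)) has_derivative (\<lambda>v. of_real (snd v * \<sigma>) :: complex)) (at q)" if "q \<in> B" for q
    by (rule has_derivative_of_real[OF ds[OF that]])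
  have dx: "(x has_derivative (\<lambda>v. \<i> * of_real \<theta> * fst v + xu q * of_real (snd v))) (at q)" if "q \<in> B" for q
  proof -
    have "(x has_derivative (\<lambda>v. k * (D1 e q * fst v + D2 e q * of_real (snd v))
        + (of_real (s q) * (D1 w q * fst v + D2 w q * of_real (snd v)) + of_real (snd v * \<sigma>) * w q))) (at q)"
      unfolding x_def[abs_def]
      by (intro has_derivative_add has_derivative_mult_right has_derivative_mult dsc dF hol_e hol_w that)
    moreover have "k * (D1 e q * y + D2 e q * of_real y') + (of_real (s q) * (D1 w q * y + D2 w q * of_real y')
        + of_real (y' * \<sigma>) * w q) = \<i> * of_real \<theta> * y + xu q * of_real y'" for y and y' :: real
    proof -
      have "\<i> * of_real \<theta> = k * D1 e q + of_real (s q) * D1 w q"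
        using kC[OF that] cnj_k[OF BS[OF that] k_def kC[OF that]] by (simp add: C_def M_def algebra_simps)
      then show ?thesis unfolding xu_def by (simp add: algebra_simps)
    qed
    ultimately show ?thesis by simp
  qed
  have dxu: "(xu has_derivative (\<lambda>v. xuu q * of_real (snd v))) (at q)" if "q \<in> B" for q
  proof -
    note kk = BS[OF that] k_def kC[OF that]
    have "(xu has_derivative (\<lambda>v. k * (D1 (D2 e) q * fst v + D2 (D2 e) q * of_real (snd v))
        + (of_real (s q) * (D1 (D2 w) q * fst v + D2 (D2 w) q * of_real (snd v)) + of_real (snd v * \<sigma>) * D2 w q)
        + of_real \<sigma> * (D1 w q * fst v + D2 w q * of_real (snd v)))) (at q)"
      unfolding xu_def[abs_def]
      by (intro has_derivative_add has_derivative_mult_right has_derivative_mult dsc dF hol_partials(2)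
          hol_e hol_w that)
    moreover have "k * (D1 (D2 e) q * y + D2 (D2 e) q * of_real y')
        + (of_real (s q) * (D1 (D2 w) q * y + D2 (D2 w) q * of_real y') + of_real (y' * \<sigma>) * D2 w q)
        + of_real \<sigma> * (D1 w q * y + D2 w q * of_real y') = xuu q * of_real y'" for y and y' :: real
    proof -
      have "D1 (D2 e) q = 0" "D1 (D2 w) q = M q * M q"
        using D2e_partials[OF BS[OF that]] D2w_partials[OF BS[OF that]] has_partials_D(1) by metis+
      moreover have "xuu q = k * D2 (D2 e) q + of_real (s q) * D2 (D2 w) q + 2 * of_real \<sigma> * D2 w q"
        unfolding xuu_def c_def x_uu[OF kk] ..
      moreover have "k * (0 * y + D2 (D2 e) q * of_real y') + (of_real (s q) * (M q * M q * y + D2 (D2 w) q * of_real y')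
          + of_real (y' * \<sigma>) * D2 w q) + of_real \<sigma> * (M q * y + D2 w q * of_real y') =
          (k * D2 (D2 e) q + of_real (s q) * D2 (D2 w) q + 2 * of_real \<sigma> * D2 w q) * of_real y'
          + M q * (of_real \<sigma> + of_real (s q) * M q) * y"
        by (simp add: algebra_simps)
      ultimately show ?thesis using M_\<sigma>[OF kk] by (simp add: M_def)
    qed
    ultimately show ?thesis by simp
  qed
  have dxuu: "\<exists>xuuu. (xuu has_derivative (\<lambda>v. of_real (snd v) * xuuu)) (at q)" if "q \<in> B" for q
  proof -
    have "has_partials P q 0 (D2 P q)"
      using P_partials[OF BS[OF that]] has_partials_D(2) by metis
    note dP = partials_du[OF this]
    have "(xuu has_derivative (\<lambda>v. (of_real (s q) * (of_real (snd v) * D2 (D2 P) q) + of_real (snd v * \<sigma>) * D2 P q)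
        + c * (of_real (snd v) * D2 P q))) (at q)"
      unfolding xuu_def[abs_def]
      by (intro has_derivative_add has_derivative_mult_right has_derivative_mult dsc that dP
          partials_du[OF DP_partials] BS)
    moreover have "(of_real (s q) * (of_real y * D2 (D2 P) q) + of_real (y * \<sigma>) * D2 P q) + c * (of_real y * D2 P q)
        = of_real y * (of_real (s q) * D2 (D2 P) q + of_real \<sigma> * D2 P q + c * D2 P q)" for y :: real
      by (simp add: algebra_simps)
    ultimately show ?thesis by auto
  qed
  \<comment> \<open>The \<zeta> derivative of Y is the left side of
    \<open>killing_condition_iff\<close>, so \<open>n\<close> annihilates it and T can be found by
    integrating over u alone.\<close>
  have dY: "\<exists>y'. (Y has_derivative (\<lambda>v. of_real (snd v) * y')) (at q)" if "q \<in> B" for q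
  proof -
    note kk = BS[OF that] k_def kC[OF that] and qB = that
    obtain x3 where x3: "(xuu has_derivative (\<lambda>v. of_real (snd v) * x3)) (at q)"
      using dxuu[OF qB] by blast
    have "(Y has_derivative (\<lambda>v. (f1 q * (\<i> * of_real \<theta> * fst v + xu q * of_real (snd v))
          + (f11 q * fst v + f12 q * of_real (snd v)) * x q)
        + (D2 ?\<phi> q * of_real (snd v * \<sigma>) + (D1 (D2 ?\<phi>) q * fst v + D2 (D2 ?\<phi>) q * of_real (snd v)) * of_real (s q))
        + 2 * of_real \<sigma> * (f1 q * fst v + D2 ?\<phi> q * of_real (snd v))
        + (cnj (xuu q) * fst v + cnj (of_real (snd v) * x3) * fst q))) (at q)"
      unfolding Y_def[abs_def]
      by (intro has_derivative_add has_derivative_mult has_derivative_mult_right dF dx dsc hol_partials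
          hol_\<phi> that has_derivative_cnj x3 has_derivative_fst has_derivative_ident)
    moreover have "(f1 q * (\<i> * of_real \<theta> * y + xu q * of_real y') + (f11 q * y + f12 q * of_real y') * x q)
        + (D2 ?\<phi> q * of_real (y' * \<sigma>) + (D1 (D2 ?\<phi>) q * y + D2 (D2 ?\<phi>) q * of_real y') * of_real (s q))
        + 2 * of_real \<sigma> * (f1 q * y + D2 ?\<phi> q * of_real y')
        + (cnj (xuu q) * y + cnj (of_real y' * x3) * fst q) =
        of_real y' * (f1 q * xu q + f12 q * x q + D2 ?\<phi> q * of_real \<sigma> + D2 (D2 ?\<phi>) q * of_real (s q)
          + 2 * of_real \<sigma> * D2 ?\<phi> q + cnj x3 * fst q)" for y and y' :: real
    proof -
      have "f11 q * (k * e q + of_real (s q) * w q) + (\<i> * of_real \<theta> + 2 * of_real \<sigma>) * f1 q + f12 q * of_real (s q)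
        + cnj (k * D2 (D2 e) q + of_real (s q) * D2 (D2 w) q + 2 * of_real \<sigma> * D2 w q) = 0"
        using killing_condition_iff[OF kk] n[OF that] by simp
      then have 0: "f11 q * x q + (\<i> * of_real \<theta> + 2 * of_real \<sigma>) * f1 q + f12 q * of_real (s q) + cnj (xuu q) = 0"
        unfolding x_uu[OF kk] x_def xuu_def c_def .
      have "(f1 q * (\<i> * of_real \<theta> * y + xu q * of_real y') + (f11 q * y + f12 q * of_real y') * x q)
        + (D2 ?\<phi> q * of_real (y' * \<sigma>) + (f12 q * y + D2 (D2 ?\<phi>) q * of_real y') * of_real (s q))
        + 2 * of_real \<sigma> * (f1 q * y + D2 ?\<phi> q * of_real y')
        + (cnj (xuu q) * y + cnj (of_real y' * x3) * fst q) =
        (f11 q * x q + (\<i> * of_real \<theta> + 2 * of_real \<sigma>) * f1 q + f12 q * of_real (s q) + cnj (xuu q)) * y +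
        of_real y' * (f1 q * xu q + f12 q * x q + D2 ?\<phi> q * of_real \<sigma> + D2 (D2 ?\<phi>) q * of_real (s q)
          + 2 * of_real \<sigma> * D2 ?\<phi> q + cnj x3 * fst q)"
        by (simp add: algebra_simps)
      then show ?thesis unfolding 0 partials_commute[OF hol_\<phi> BS[OF that]] by simp
    qed
    ultimately show ?thesis by auto
  qed
  have sm: "smooth_on B F" if "hol_smooth S F" for F
    using hol_smooth_smooth_on[OF that] B(2) by (rule smooth_on_subset)
  have smooth_sc: "smooth_on B (\<lambda>q. of_real (s q) :: complex)"
    by (rule smooth_on_bounded_linear[OF B(1) bounded_linear_of_real smooth_s])
  have smooth_x: "smooth_on B x" and smooth_xu: "smooth_on B xu" and smooth_xuu: "smooth_on B xuu"
    unfolding x_def[abs_def] xu_def[abs_def] xuu_def[abs_def]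
    by (intro smooth_on_add[OF B(1)] smooth_on_mult[OF B(1)] smooth_on_const smooth_sc sm hol_partials
        hol_e hol_w hol_P)+
  have smooth_Y: "smooth_on B Y"
    unfolding Y_def[abs_def]
    by (intro smooth_on_add[OF B(1)] smooth_on_mult[OF B(1)] smooth_on_const smooth_sc smooth_x sm hol_partials
        hol_\<phi> hol_smooth_fst[OF open_S] smooth_on_bounded_linear[OF B(1) bounded_linear_cnj smooth_xuu])
  obtain y' where y': "\<And>q. q \<in> B \<Longrightarrow> (Y has_derivative (\<lambda>v. of_real (snd v) * y' q)) (at q)"
    using dY by metis
  define H where "H q = - 2 * Re (Y q)" for q
  have smooth_H: "smooth_on (ball z0 r \<times> ball u0 r) H"
    unfolding H_def[abs_def] Br[symmetric]
    by (intro smooth_on_mult[OF B(1)] smooth_on_const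
        smooth_on_bounded_linear[OF B(1) bounded_linear_Re smooth_Y])
  have dH: "(H has_derivative (\<lambda>v. snd v * (- 2 * Re (y' q)))) (at q)"
    if "q \<in> ball z0 r \<times> ball u0 r" for q
    unfolding H_def[abs_def]
    using has_derivative_mult_right[OF has_derivative_Re[OF y'[unfolded Br, OF that]], of "- 2"]
    by (simp add: algebra_simps)
  obtain T where "\<forall>q\<in>ball z0 r \<times> ball u0 (r / 2). (T has_derivative (\<lambda>v. snd v * H q)) (at q)"
    using antiderivative_box[OF r smooth_H dH] by blast
  then have dT: "\<And>q. q \<in> ball z0 r \<times> ball u0 (r / 2) \<Longrightarrow> (T has_derivative (\<lambda>v. snd v * H q)) (at q)"
    by blast
  define B' where "B' = ball z0 r \<times> ball u0 (r / 2)"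
  have B': "open B'" "pr p \<in> B'" and B'B: "q \<in> B' \<Longrightarrow> q \<in> B" for q
    using r by (auto simp: B'_def Br z0_def u0_def open_Times pr_def)
  have smooth_T: "smooth_on B' T"
  proof (rule smooth_on_Suc[OF B'(1) dT[folded B'_def]])
    have "smooth_on B' H"
      by (rule smooth_on_subset[OF smooth_H[folded Br]]) (use B'B in blast)
    then show "smooth_on B' (\<lambda>q. snd v * H q)" for v :: "complex \<times> real"
      by (rule smooth_on_mult[OF B'(1) smooth_on_const])
  qed
  define V where "V = pr -` B'"
  have V: "open V" "p \<in> V" and VB': "q \<in> V \<Longrightarrow> pr q \<in> B'" for q
    using B' bounded_linear_pr by (auto simp: V_def intro: open_vimage linear_continuous_on)
  \<comment> \<open>The v component has \<zeta> gradient given by 2 x_u and v derivative - \<sigma>,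
    as the Killing equations demand; T takes care of the uu equation.\<close>
  define X where "X q = (x (pr q), s (pr q), 2 * Re (xu (pr q) * cnj (fst q)) + T (pr q) - snd (snd q) * \<sigma>)" for q :: point
  have prV: "smooth_on V (\<lambda>q. F (pr q))" if "smooth_on B' F" for F :: "complex \<times> real \<Rightarrow> 'b::real_normed_vector"
    by (rule smooth_on_linear_comp[OF that B'(1) V(1) bounded_linear_pr VB'])
  have BB': "smooth_on B' F" if "smooth_on B F" for F :: "complex \<times> real \<Rightarrow> 'b::real_normed_vector"
    by (rule smooth_on_subset[OF that]) (use B'B in blast)
  have "smooth_on V (\<lambda>q. xu (pr q) * cnj (fst q))"
    by (rule smooth_on_mult[OF V(1) prV[OF BB'[OF smooth_xu]] smooth_on_linear[OF V(1)
            bounded_linear_compose[OF bounded_linear_cnj bounded_linear_fst]]])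
  then have "smooth_on V (\<lambda>q. 2 * Re (xu (pr q) * cnj (fst q)))"
    by (intro smooth_on_mult[OF V(1) smooth_on_const] smooth_on_bounded_linear[OF V(1) bounded_linear_Re])
  moreover have "smooth_on V (\<lambda>q :: point. snd (snd q) * \<sigma>)"
    by (intro smooth_on_mult[OF V(1) _ smooth_on_const] smooth_on_linear[OF V(1)]
        bounded_linear_compose[OF bounded_linear_snd bounded_linear_snd])
  ultimately have smooth_X: "smooth_on V X"
    unfolding X_def[abs_def]
    by (intro smooth_on_Pair[OF V(1)] smooth_on_add[OF V(1)] smooth_on_diff[OF V(1)]
        prV[OF BB'[OF smooth_x]] prV[OF BB'[OF smooth_s]] prV[OF smooth_T])
  have "lie_derivative X (pp_metric f) q Y' W = 0" if "q \<in> V" for q Y' W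
  proof -
    have qB: "pr q \<in> B" and qB': "pr q \<in> B'" using VB'[OF that] B'B by blast+
    have dpr: "((\<lambda>q. F (pr q)) has_derivative (\<lambda>v. F' (pr v))) (at q)" if "(F has_derivative F') (at (pr q))"
      for F :: "complex \<times> real \<Rightarrow> 'b::real_normed_vector" and F'
      by (rule has_derivative_compose[OF bounded_linear_imp_has_derivative[OF bounded_linear_pr] that])
    have "(X has_derivative (\<lambda>v. (\<i> * of_real \<theta> * fst (pr v) + xu (pr q) * of_real (snd (pr v)), snd (pr v) * \<sigma>,
      2 * Re (xu (pr q) * cnj (fst v) + (xuu (pr q) * of_real (snd (pr v))) * cnj (fst q))
        + snd (pr v) * H (pr q) - snd (snd v) * \<sigma>))) (at q)"
      unfolding X_def[abs_def]
      by (intro has_derivative_Pair has_derivative_add has_derivative_diff has_derivative_mult_right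
          has_derivative_mult_left has_derivative_Re has_derivative_mult has_derivative_cnj has_derivative_fst
          has_derivative_snd has_derivative_ident dpr dx dxu ds qB dT[folded B'_def] qB')
    moreover have "(\<i> * of_real \<theta> * fst (pr v) + xu (pr q) * of_real (snd (pr v)), snd (pr v) * \<sigma>,
      2 * Re (xu (pr q) * cnj (fst v) + (xuu (pr q) * of_real (snd (pr v))) * cnj (fst q))
        + snd (pr v) * H (pr q) - snd (snd v) * \<sigma>) =
      (\<i> * of_real \<theta> * fst v + xu (pr q) * of_real (fst (snd v)), fst (snd v) * \<sigma>,
      2 * Re (xu (pr q) * cnj (fst v)) + (2 * Re (xuu (pr q) * cnj (fst q)) + H (pr q)) * fst (snd v)
        - snd (snd v) * \<sigma>)" for v :: point
      by (simp add: pr_def algebra_simps)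
    ultimately have dX: "(X has_derivative (\<lambda>v. (\<i> * of_real \<theta> * fst v + xu (pr q) * of_real (fst (snd v)), fst (snd v) * \<sigma>,
      2 * Re (xu (pr q) * cnj (fst v)) + (2 * Re (xuu (pr q) * cnj (fst q)) + H (pr q)) * fst (snd v)
        - snd (snd v) * \<sigma>))) (at q)"
      by (simp only:)
    show ?thesis
    proof (rule lie_derivative_zero[OF BS[OF qB] dX])
      show "2 * Re (f1 (pr q) * fst (X q) + D2 ?\<phi> (pr q) * of_real (fst (snd (X q)))
        + 2 * of_real \<sigma> * f (fst q) (fst (snd q))) + (2 * Re (xuu (pr q) * cnj (fst q)) + H (pr q)) = 0"
        unfolding H_def Y_def X_def by (simp add: pr_def algebra_simps)
    qed
  qed
  then have "killing_near (pp_metric f) p X"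
    unfolding killing_near_def using V smooth_X by blast
  moreover have "fst (snd (X p)) \<noteq> 0" by (simp add: X_def B(4))
  ultimately show ?thesis by blast
qed

end

section \<open>The coordinate \<open>Z\<close> and the main theorem\<close>

text \<open>Holds without differentiability: \<open>frechet_derivative\<close> is defined through
  \<open>has_derivative\<close> alone, and that predicate is local.\<close>

lemma frechet_derivative_cong_open:
  assumes "open V" "q \<in> V" "\<And>q. q \<in> V \<Longrightarrow> F q = G q"
  shows "frechet_derivative F (at q) = frechet_derivative G (at q)"
proof -
  have "(F has_derivative D) (at q) \<longleftrightarrow> (G has_derivative D) (at q)" for D
    using has_derivative_transform_within_open[OF _ assms(1,2), of F D UNIV G]
      has_derivative_transform_within_open[OF _ assms(1,2), of G D UNIV F] assms(3) by auto
  then show ?thesis unfolding frechet_derivative_def by simp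
qed

text \<open>The bridge from the calculus on pairs to the one-variable derivatives \<open>d1\<close>
  and \<open>d2\<close>.\<close>

lemma has_partials_slices:
  assumes "has_partials (\<lambda>(z, u). F z u) (z, u) p q"
  shows "((\<lambda>w. F w u) has_field_derivative p) (at z)" "((\<lambda>s. F z s) has_vector_derivative q) (at u)"
    "d1 F z u = p" "d2 F z u = q"
proof -
  note D = assms[unfolded has_partials_def]
  have "((\<lambda>w. (w, u)) has_derivative (\<lambda>h. (h, 0))) (at z)"
    by (intro has_derivative_Pair has_derivative_ident has_derivative_const)
  from has_derivative_compose[OF this D]
  show 1: "((\<lambda>w. F w u) has_field_derivative p) (at z)"
    by (simp add: has_field_derivative_def)
  have "((\<lambda>s. (z, s)) has_derivative (\<lambda>k. (0, k))) (at u)"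
    by (intro has_derivative_Pair has_derivative_ident has_derivative_const)
  from has_derivative_compose[OF this D]
  show 2: "((\<lambda>s. F z s) has_vector_derivative q) (at u)"
    by (simp add: has_vector_derivative_def scaleR_conv_of_real mult.commute)
  show "d1 F z u = p" unfolding d1_def by (rule DERIV_imp_deriv[OF 1])
  show "d2 F z u = q" unfolding d2_def by (rule vector_derivative_at[OF 2])
qed

lemma has_partials_complex_linear:
  assumes "(F has_derivative D) (at x)" "\<And>h. D (h, 0) = c * h"
  shows "has_partials F x c (D (0, 1))"
proof -
  have lin: "linear D" by (rule has_derivative_linear[OF assms(1)])
  have "D v = c * fst v + D (0, 1) * of_real (snd v)" for v
  proof -
    have "D v = D ((fst v, 0) + snd v *\<^sub>R (0, 1))" by simp
    then show ?thesis
      unfolding linear_add[OF lin] linear_scale[OF lin] assms(2)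
      by (simp add: scaleR_conv_of_real mult.commute)
  qed
  then have "D = (\<lambda>v. c * fst v + D (0, 1) * of_real (snd v))" by (rule ext)
  then show ?thesis using assms(1) unfolding has_partials_def by simp
qed

lemma has_partials_comp:
  assumes "has_partials H (F x, snd x) p q" "has_partials F x r t"
  shows "has_partials (\<lambda>x. H (F x, snd x)) x (p * r) (p * t + q)"
proof -
  have "((\<lambda>x. (F x, snd x)) has_derivative (\<lambda>v. (r * fst v + t * of_real (snd v), snd v))) (at x)"
    by (intro has_derivative_Pair assms(2)[unfolded has_partials_def] has_derivative_snd has_derivative_ident)
  from has_derivative_compose[OF this assms(1)[unfolded has_partials_def]] show ?thesis
    unfolding has_partials_def by (simp add: algebra_simps)
qed

lemma base_eq: "base U = pr ` U"
  unfolding base_def pr_def by (force simp: image_iff)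

lemma open_base:
  assumes "open U"
  shows "open (base U)"
proof -
  have "surj pr" by (rule surjI[of _ "\<lambda>x. (fst x, snd x, 0)"]) simp
  then show ?thesis
    unfolding base_eq using assms bounded_linear_pr
    by (intro open_surjective_linear_image) (auto simp: bounded_linear.linear)
qed

lemma hol_smooth_pp_wave:
  assumes "vacuum_pp_wave U f"
  shows "hol_smooth (base U) (\<lambda>(z, u). f z u)"
proof (rule hol_smoothI)
  show sm: "smooth_on (base U) (\<lambda>(z, u). f z u)"
    using assms by (simp add: vacuum_pp_wave_def)
  fix x assume x: "x \<in> base U"
  obtain z u where zu: "x = (z, u)" by (cases x)
  define D where "D = frechet_derivative (\<lambda>(z, u). f z u) (at x)"
  have D: "((\<lambda>(z, u). f z u) has_derivative D) (at (z, u))"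
    using smooth_on_has_derivative[OF sm x] by (simp add: D_def zu)
  have "open ((\<lambda>z. (z, u)) -` base U)"
    using assms by (intro open_vimage open_base continuous_intros) (simp add: vacuum_pp_wave_def)
  moreover have "(\<lambda>z. f z u) holomorphic_on (\<lambda>z. (z, u)) -` base U"
    using assms by (simp add: vacuum_pp_wave_def vimage_def)
  ultimately obtain c where "((\<lambda>z. f z u) has_field_derivative c) (at z)"
    using x zu by (metis DERIV_deriv_iff_field_differentiable holomorphic_on_imp_differentiable_at vimageI2)
  then have c: "((\<lambda>z. f z u) has_derivative (\<lambda>h. c * h)) (at z)"
    by (simp add: has_field_derivative_def)
  have "((\<lambda>w. (w, u)) has_derivative (\<lambda>h. (h, 0))) (at z)"
    by (intro has_derivative_Pair has_derivative_ident has_derivative_const)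
  from has_derivative_compose[OF this D]
  have "((\<lambda>z. f z u) has_derivative (\<lambda>h. D (h, 0))) (at z)" by simp
  from has_derivative_unique[OF this c] have "D (h, 0) = c * h" for h by metis
  from has_partials_complex_linear[OF D this]
  show "\<exists>p q. has_partials (\<lambda>(z, u). f z u) x p q" unfolding zu by blast
qed

lemma d1_d1_eq:
  assumes "open S" "hol_smooth S (\<lambda>(z, u). f z u)" "(z, u) \<in> S"
  shows "d1 f z u = D1 (\<lambda>(z, u). f z u) (z, u)" "d1 (d1 f) z u = D1 (D1 (\<lambda>(z, u). f z u)) (z, u)"
proof -
  have *: "d1 f z u = D1 (\<lambda>(z, u). f z u) (z, u)" if "(z, u) \<in> S" for z u
    by (rule has_partials_slices(3)[OF hol_smooth_has_partials[OF assms(2) that]])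
  show "d1 f z u = D1 (\<lambda>(z, u). f z u) (z, u)" using * assms(3) .
  have "has_partials (\<lambda>(z, u). d1 f z u) (z, u) (D1 (D1 (\<lambda>(z, u). f z u)) (z, u)) (D2 (D1 (\<lambda>(z, u). f z u)) (z, u))"
    by (rule has_partials_cong[OF hol_smooth_has_partials[OF hol_smooth_partials(1)[OF assms(1,2)] assms(3)]
          assms(1,3)]) (auto simp: *)
  then show "d1 (d1 f) z u = D1 (D1 (\<lambda>(z, u). f z u)) (z, u)"
    by (rule has_partials_slices(3))
qed

text \<open>Differentiating exp (4 A) = F gives 4 F dA = dF, so dA inherits complex linearity in
  \<zeta> for any smooth branch.\<close>

lemma hol_smooth_log:
  assumes "open S" "hol_smooth S F" "smooth_on S A" "\<And>x. x \<in> S \<Longrightarrow> exp (4 * A x) = F x"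
  shows "hol_smooth S A"
proof (rule hol_smoothI[OF assms(3)])
  fix x assume x: "x \<in> S"
  define D where "D = frechet_derivative A (at x)"
  have D: "(A has_derivative D) (at x)"
    using smooth_on_has_derivative[OF assms(3) x] by (simp add: D_def)
  have "(exp has_derivative (\<lambda>h. exp (4 * A x) * h)) (at (4 * A x))"
    using DERIV_exp[of "4 * A x"] by (simp add: has_field_derivative_def)
  from has_derivative_compose[OF has_derivative_mult_right[OF D] this]
  have "((\<lambda>x. exp (4 * A x)) has_derivative (\<lambda>v. exp (4 * A x) * (4 * D v))) (at x)" .
  then have "(F has_derivative (\<lambda>v. exp (4 * A x) * (4 * D v))) (at x)"
    by (rule has_derivative_transform_within_open[OF _ assms(1) x assms(4)])
  moreover have "(F has_derivative (\<lambda>v. D1 F x * fst v + D2 F x * of_real (snd v))) (at x)"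
    using hol_smooth_has_partials[OF assms(2) x] by (simp add: has_partials_def)
  ultimately have *: "(\<lambda>v. exp (4 * A x) * (4 * D v)) = (\<lambda>v. D1 F x * fst v + D2 F x * of_real (snd v))"
    by (rule has_derivative_unique)
  have "D (h, 0) = D1 F x / (4 * exp (4 * A x)) * h" for h
    using fun_cong[OF *, of "(h, 0)"] by (simp add: field_simps)
  from has_partials_complex_linear[OF D this]
  show "\<exists>p q. has_partials A x p q" by blast
qed

lemma wave_data_pp_wave:
  assumes "vacuum_pp_wave U f" "log_potential U f a" "\<forall>p\<in>U. alpha a p \<noteq> 0"
  shows "wave_data (base U) (\<lambda>(z, u). f z u) (\<lambda>(z, u). a z u)"
proof
  let ?S = "base U" and ?\<phi> = "\<lambda>(z, u). f z u" and ?A = "\<lambda>(z, u). a z u"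
  show oS: "open ?S" using assms(1) by (simp add: open_base vacuum_pp_wave_def)
  show h\<phi>: "hol_smooth ?S ?\<phi>" by (rule hol_smooth_pp_wave[OF assms(1)])
  show ex: "exp (4 * ?A x) = D1 (D1 ?\<phi>) x" if "x \<in> ?S" for x
    using assms(2) that d1_d1_eq(2)[OF oS h\<phi>] unfolding log_potential_def by (cases x) auto
  show hA: "hol_smooth ?S ?A"
    using assms(2) by (intro hol_smooth_log[OF oS _ _ ex] hol_smooth_partials[OF oS] h\<phi>)
      (simp add: log_potential_def)
  show "D1 ?A x \<noteq> 0" if x: "x \<in> ?S" for x
  proof -
    obtain z u v where "(z, u, v) \<in> U" "x = (z, u)" using x by (auto simp: base_def)
    then show ?thesis
      using assms(3) d1_d1_eq(1)[OF oS hA, of z u] x by (fastforce simp: alpha_def)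
  qed
qed

section \<open>Derivatives of Z and L in terms of e, w and M\<close>

context wave_data
begin

context
  fixes Z L :: "complex \<Rightarrow> real \<Rightarrow> complex"
  assumes Z: "\<And>x. x \<in> S \<Longrightarrow> Z (A x) (snd x) = fst x"
    and smooth_Z: "smooth_on ((\<lambda>x. (A x, snd x)) ` S) (\<lambda>(a, u). Z a u)"
    and smooth_L: "smooth_on ((\<lambda>x. (A x, snd x)) ` S) (\<lambda>(a, u). L a u)"
    and exp_L: "\<And>x. x \<in> S \<Longrightarrow> exp (L (A x) (snd x)) = d1 Z (A x) (snd x)"
begin

text \<open>Z provides a left inverse, so the map is injective and invariance of domain applies.
  Openness permits identities on the image to be differentiated.\<close>

lemma open_image: "open ((\<lambda>x. (A x, snd x)) ` S)"
proof (rule invariance_of_domain[OF _ open_S])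
  show "continuous_on S (\<lambda>x. (A x, snd x))"
    by (intro continuous_on_Pair continuous_on_snd continuous_on_id
        smooth_on_continuous hol_smooth_smooth_on hol_A)
  show "inj_on (\<lambda>x. (A x, snd x)) S"
    by (rule inj_onI) (metis Z prod.inject prod_eq_iff)
qed

text \<open>Differentiate Z(A, u) = \<zeta> and solve the resulting linear relation for the
  derivative of Z.\<close>

lemma Z_partials:
  assumes "x \<in> S"
  shows "has_partials (\<lambda>(a, u). Z a u) (A x, snd x) (e x) (w x)"
proof -
  define D where "D = frechet_derivative (\<lambda>(a, u). Z a u) (at (A x, snd x))"
  have D: "((\<lambda>(a, u). Z a u) has_derivative D) (at (A x, snd x))"
    using smooth_on_has_derivative[OF smooth_Z, of "(A x, snd x)"] assms by (auto simp: D_def)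
  have "((\<lambda>x. (A x, snd x)) has_derivative (\<lambda>v. (1 / e x * fst v + - w x / e x * of_real (snd v), snd v))) (at x)"
    by (intro has_derivative_Pair A_partials[OF assms, unfolded has_partials_def] has_derivative_snd
        has_derivative_ident)
  from has_derivative_compose[OF this D]
  have "((\<lambda>x. Z (A x) (snd x)) has_derivative
      (\<lambda>v. D (1 / e x * fst v + - w x / e x * of_real (snd v), snd v))) (at x)" by simp
  then have "(fst has_derivative (\<lambda>v. D (1 / e x * fst v + - w x / e x * of_real (snd v), snd v))) (at x)"
    by (rule has_derivative_transform_within_open[OF _ open_S assms]) (simp add: Z)
  from has_derivative_unique[OF this has_derivative_fst[OF has_derivative_ident]]
  have *: "D (1 / e x * h + - w x / e x * of_real k, k) = h" for h k
    by (metis fst_conv snd_conv)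
  have 1: "D (h, 0) = e x * h" for h
    using *[of "e x * h" 0] e_nz[OF assms] by simp
  have "D (0, 1) = w x"
    using *[of "w x" 1] e_nz[OF assms] by simp
  then show ?thesis using has_partials_complex_linear[OF D 1] by simp
qed

lemma Z_derivs:
  assumes "x \<in> S"
  shows "d1 Z (A x) (snd x) = e x" "d2 Z (A x) (snd x) = w x"
    "d2 (d2 Z) (A x) (snd x) = D2 w x + w x * M x" "d2 L (A x) (snd x) = M x"
proof -
  let ?T = "(\<lambda>x. (A x, snd x)) ` S"
  have 1: "d1 Z (A x) (snd x) = e x" "d2 Z (A x) (snd x) = w x" if "x \<in> S" for x
    using has_partials_slices(3,4)[OF Z_partials[OF that]] by auto
  show "d1 Z (A x) (snd x) = e x" "d2 Z (A x) (snd x) = w x" by (rule 1[OF assms])+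
  have xT: "(A x, snd x) \<in> ?T" using assms by blast
  \<comment> \<open>On the image, Z_u and Z_a are w and e composed with (Z, u); this allows them to
    be differentiated at fixed a.\<close>
  have eq: "w ((\<lambda>(a, u). Z a u) y, snd y) = (\<lambda>(a, u). d2 Z a u) y"
    "e ((\<lambda>(a, u). Z a u) y, snd y) = (\<lambda>(a, u). exp (L a u)) y" if "y \<in> ?T" for y
  proof -
    obtain x' where x': "x' \<in> S" "y = (A x', snd x')" using \<open>y \<in> ?T\<close> by blast
    then show "w ((\<lambda>(a, u). Z a u) y, snd y) = (\<lambda>(a, u). d2 Z a u) y"
      "e ((\<lambda>(a, u). Z a u) y, snd y) = (\<lambda>(a, u). exp (L a u)) y"
      using 1[OF x'(1)] Z[OF x'(1)] exp_L[OF x'(1)] by simp_all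
  qed
  have "has_partials (\<lambda>(a, u). d2 Z a u) (A x, snd x) (M x * e x) (M x * w x + D2 w x)"
    by (rule has_partials_cong[OF has_partials_comp[where H = w, OF _ Z_partials[OF assms]] open_image xT eq(1)])
      (use hp[OF hol_w assms] in \<open>simp add: M_def Z[OF assms]\<close>)
  from has_partials_slices(4)[OF this]
  show "d2 (d2 Z) (A x) (snd x) = D2 w x + w x * M x" by (simp add: algebra_simps)
  have "has_partials (\<lambda>(a, u). exp (L a u)) (A x, snd x) ((C x - 1) * e x)
      ((C x - 1) * w x + (M x * e x - w x * (C x - 1)))"
    by (rule has_partials_cong[OF has_partials_comp[where H = e, OF _ Z_partials[OF assms]] open_image xT eq(2)])
      (use e_partials[OF assms] in \<open>simp add: Z[OF assms]\<close>)
  from has_partials_slices(2)[OF this]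
  have dexp: "((\<lambda>s. exp (L (A x) s)) has_vector_derivative M x * e x) (at (snd x))"
    by (simp add: algebra_simps)
  \<comment> \<open>Only exp L = Z_a is known, so L_u is obtained from the u derivative of exp L and
    division by e.\<close>
  have "((\<lambda>(a, u). L a u) has_derivative frechet_derivative (\<lambda>(a, u). L a u) (at (A x, snd x))) (at (A x, snd x))"
    by (rule smooth_on_has_derivative[OF smooth_L xT])
  moreover have "((\<lambda>s. (A x, s)) has_derivative (\<lambda>k. (0, k))) (at (snd x))"
    by (intro has_derivative_Pair has_derivative_ident has_derivative_const)
  ultimately have "(\<lambda>s. L (A x) s) differentiable (at (snd x))"
    using has_derivative_compose[of "\<lambda>s. (A x, s)" _ "snd x" UNIV "\<lambda>(a, u). L a u"]
    by (fastforce simp: differentiable_def)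
  then have dL: "((\<lambda>s. L (A x) s) has_vector_derivative d2 L (A x) (snd x)) (at (snd x))"
    unfolding d2_def by (simp add: vector_derivative_works)
  have "((\<lambda>s. exp (L (A x) s)) has_vector_derivative d2 L (A x) (snd x) * exp (L (A x) (snd x))) (at (snd x))"
    using field_vector_diff_chain_at[OF dL DERIV_exp] by (simp add: o_def)
  from vector_derivative_unique_at[OF this dexp]
  have "d2 L (A x) (snd x) * e x = M x * e x" by (simp add: exp_L[OF assms] 1[OF assms])
  then show "d2 L (A x) (snd x) = M x" using e_nz[OF assms] by simp
qed

end

end

section \<open>Assembly of the equivalence\<close>

theorem proposition6p3:
  fixes U :: "point set"
    and f a Z L :: "complex \<Rightarrow> real \<Rightarrow> complex"
  assumes pp_wave: "vacuum_pp_wave U f"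
    and a: "log_potential U f a"
    and alpha_nonzero: "\<forall>p\<in>U. alpha a p \<noteq> 0"
    and Z_L: "inverse_coordinate U a Z L"
    and constant_rank: "\<exists>r. \<forall>p\<in>U. invariant_rank f a Z L p = r"
    and alpha_alpha_bar:
      "\<forall>p\<in>U. wedge2 (ext_d (alpha a) p) (ext_d (\<lambda>q. cnj (alpha a q)) p) = (\<lambda>X Y. 0)"
    and alpha_mu:
      "\<forall>p\<in>U. wedge2 (ext_d (alpha a) p) (ext_d (mu a L) p) = (\<lambda>X Y. 0)"
    and alpha_nu:
      "\<forall>p\<in>U. wedge2 (ext_d (alpha a) p) (ext_d (nu f a Z) p) \<noteq> (\<lambda>X Y. 0)"
  shows "isometry_dim U (pp_metric f) 2 \<longleftrightarrow>
    (\<forall>p\<in>U. wedge3 (ext_d (alpha a) p) (ext_d (nu f a Z) p)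
        (ext_d (\<lambda>q. cnj (nu f a Z q)) p) = (\<lambda>X Y W. 0)) \<and>
    (\<forall>p\<in>U. wedge3 (ext_d (alpha a) p) (ext_d (nu f a Z) p)
        (ext_d (np_Delta f a Z (nu f a Z)) p) = (\<lambda>X Y W. 0))"
proof -
  let ?S = "base U" and ?\<phi> = "\<lambda>(z, u). f z u" and ?A = "\<lambda>(z, u). a z u"
  interpret wd: wave_data ?S ?\<phi> ?A
    by (rule wave_data_pp_wave[OF pp_wave a alpha_nonzero])
  have dom: "a_domain U a = (\<lambda>x. (?A x, snd x)) ` ?S"
    unfolding a_domain_def by (rule image_cong) auto
  have "Z (?A x) (snd x) = fst x" if "x \<in> ?S" for x
    using Z_L that unfolding inverse_coordinate_def by (cases x) auto
  moreover have "exp (L (?A x) (snd x)) = d1 Z (?A x) (snd x)" if "x \<in> ?S" for x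
    using Z_L that unfolding inverse_coordinate_def dom by fastforce
  moreover have "smooth_on ((\<lambda>x. (?A x, snd x)) ` ?S) (\<lambda>(a, u). Z a u)"
    "smooth_on ((\<lambda>x. (?A x, snd x)) ` ?S) (\<lambda>(a, u). L a u)"
    using Z_L unfolding inverse_coordinate_def dom by auto
  ultimately have Z: "d2 Z (?A x) (snd x) = wd.w x" "d2 (d2 Z) (?A x) (snd x) = D2 wd.w x + wd.w x * wd.M x"
    "d2 L (?A x) (snd x) = wd.M x" if "x \<in> ?S" for x
    using wd.Z_derivs[of Z L] that by blast+
  \<comment> \<open>These identities hold on the open cylinder over the base, so that they can be
    differentiated.\<close>
  have al: "alpha a q = wd.Al q" and mu: "mu a L q = wd.Mu q" and nu: "nu f a Z q = wd.Nu q"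
    if "q \<in> pr -` ?S" for q
  proof -
    obtain z u v where q: "q = (z, u, v)" by (cases q)
    have x: "(z, u) \<in> ?S" using that by (simp add: q)
    show "alpha a q = wd.Al q"
      using d1_d1_eq(1)[OF wd.open_S wd.hol_A x] by (simp add: q alpha_def wd.Al_def)
    show "mu a L q = wd.Mu q"
      using Z(3)[OF x] by (simp add: q mu_def wd.Mu_def)
    show "nu f a Z q = wd.Nu q"
      using Z(2)[OF x] d1_d1_eq(1)[OF wd.open_S wd.hol_\<phi> x] by (simp add: q nu_def wd.Nu_def)
  qed
  have oV: "open (pr -` ?S)"
    using wd.open_S bounded_linear_pr by (intro open_vimage linear_continuous_on)
  have UV: "q \<in> pr -` ?S" if "q \<in> U" for q
    using that by (auto simp: base_eq)
  note cong = frechet_derivative_cong_open[OF oV]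
  have d: "ext_d (alpha a) q = ext_d wd.Al q" "ext_d (\<lambda>q. cnj (alpha a q)) q = ext_d (\<lambda>q. cnj (wd.Al q)) q"
    "ext_d (mu a L) q = ext_d wd.Mu q" "ext_d (nu f a Z) q = ext_d wd.Nu q"
    "ext_d (\<lambda>q. cnj (nu f a Z q)) q = ext_d (\<lambda>q. cnj (wd.Nu q)) q" if "q \<in> pr -` ?S" for q
    by (rule cong[OF that]; simp only: al mu nu)+
  interpret wk: wave_killing ?S f ?A U
    by unfold_locales (use base_eq alpha_alpha_bar alpha_mu alpha_nu d[OF UV] in auto)
  \<comment> \<open>Stated on the whole cylinder, because \<open>wedge3_Delta_Nu_iff\<close>
    differentiates it once more.\<close>
  have Delta: "np_Delta f a Z (nu f a Z) q =
      wk.E4 q * (wk.G (pr q) - wd.M (pr q) * wk.\<rho> (pr q))" if "q \<in> pr -` ?S" for q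
  proof -
    obtain z u v where q: "q = (z, u, v)" by (cases q)
    have x: "pr q \<in> ?S" using that by simp
    have "(wd.Nu has_derivative coform (wd.e (pr q)) (wd.w (pr q)) (wk.E3 q * (- wk.g (pr q) + wk.\<rho> (pr q) * 1))
        (wk.E3 q * (- 3 * wk.g (pr q) + wk.\<rho> (pr q) * - cnj (wd.C (pr q))))
        (wk.E3 q * (wk.G (pr q) + wk.\<rho> (pr q) * - wd.M (pr q)))) (at q)"
      using wk.cf_Nu[OF x] by (simp add: has_coform_def)
    then have "wd.Nu differentiable (at q)" by (auto simp: differentiable_def)
    then have "nu f a Z differentiable (at q)"
      using has_derivative_transform_within_open[OF _ oV that, of wd.Nu _ UNIV "nu f a Z"] nu
      unfolding differentiable_def by metis
    then have "np_Delta f a Z (nu f a Z) q = exp (- a z u - cnj (a z u)) *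
        ext_d wd.Nu q (wd.w (pr q), 1, Re (wd.w (pr q) * cnj (wd.w (pr q))) - 2 * Re (f z u))"
      using np_Delta_explicit[of "nu f a Z" z u v f a Z] Z(1)[OF x] d(4)[OF that] by (simp add: q)
    also have "\<dots> = exp (- a z u - cnj (a z u)) * (wk.E3 q * (wk.G (pr q) + wk.\<rho> (pr q) * - wd.M (pr q)))"
      unfolding has_coform_ext_d[OF wk.cf_Nu[OF x]] coform_frame[OF wd.e_nz[OF x]] ..
    also have "\<dots> = (exp (- a z u - cnj (a z u)) * wk.E3 q) * (wk.G (pr q) - wd.M (pr q) * wk.\<rho> (pr q))"
      by (simp add: algebra_simps)
    also have "exp (- a z u - cnj (a z u)) * wk.E3 q = wk.E4 q"
      unfolding wk.E3_def wk.E4_def by (simp add: q flip: exp_add)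
    finally show ?thesis .
  qed
  have c1: "wedge3 (ext_d (alpha a) p) (ext_d (nu f a Z) p) (ext_d (\<lambda>q. cnj (nu f a Z q)) p) = (\<lambda>X Y W. 0)
      \<longleftrightarrow> wk.cond1 (pr p)" if "p \<in> U" for p
    using wk.wedge3_Nu_iff[of p] UV[OF that] by (simp add: d[OF UV[OF that]])
  have c2: "wedge3 (ext_d (alpha a) p) (ext_d (nu f a Z) p) (ext_d (np_Delta f a Z (nu f a Z)) p) = (\<lambda>X Y W. 0)
      \<longleftrightarrow> wk.cond2 (pr p)" if "p \<in> U" for p
    using wk.wedge3_Delta_Nu_iff[OF _ oV UV[OF that] Delta] UV[OF that] by (simp add: d[OF UV[OF that]])
  have dim: "isometry_dim U (pp_metric f) 2 \<longleftrightarrow>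
      (\<forall>p\<in>U. \<exists>X. killing_near (pp_metric f) p X \<and> fst (snd (X p)) \<noteq> 0)"
    unfolding isometry_dim_def using wk.killing_germs_dim_2_iff UV by auto
  show ?thesis
  proof
    assume "isometry_dim U (pp_metric f) 2"
    then have "wk.cond1 (pr p) \<and> wk.cond2 (pr p)" if "p \<in> U" for p
      using wk.killing_conditions UV[OF that] that unfolding dim by blast
    then show "(\<forall>p\<in>U. wedge3 (ext_d (alpha a) p) (ext_d (nu f a Z) p)
        (ext_d (\<lambda>q. cnj (nu f a Z q)) p) = (\<lambda>X Y W. 0)) \<and>
      (\<forall>p\<in>U. wedge3 (ext_d (alpha a) p) (ext_d (nu f a Z) p)
        (ext_d (np_Delta f a Z (nu f a Z)) p) = (\<lambda>X Y W. 0))"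
      using c1 c2 by blast
  next
    assume "(\<forall>p\<in>U. wedge3 (ext_d (alpha a) p) (ext_d (nu f a Z) p)
        (ext_d (\<lambda>q. cnj (nu f a Z q)) p) = (\<lambda>X Y W. 0)) \<and>
      (\<forall>p\<in>U. wedge3 (ext_d (alpha a) p) (ext_d (nu f a Z) p)
        (ext_d (np_Delta f a Z (nu f a Z)) p) = (\<lambda>X Y W. 0))"
    \<comment> \<open>Both conditions depend only on the base point, and every base point is the
      projection of a point of U.\<close>
    then have "wk.cond1 x \<and> wk.cond2 x" if "x \<in> ?S" for x
      using c1 c2 that unfolding base_eq by blast
    then show "isometry_dim U (pp_metric f) 2"
      unfolding dim using wk.killing_exists UV by blast
  qed
qed

end
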